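(* A language $L$ of ordered-data trees over a finite alphabet $\Sigma$ is accepted by a weak ODTA if and only if $L$ is expressible by a sentence of the form $\exists X_1\cdots\exists X_m\ \varphi\wedge\psi$, where $\varphi$ is a formula of $\mathrm{FO}^2(E_{\downarrow},E_{\rightarrow})$ and $\psi$ is a formula of $\mathrm{FO}(\sim,\prec,\prec_{suc})$, both extended with the unary predicates $X_1,\dots,X_m$ (and the label predicates).
   Context: An ordered-data tree over a finite alphabet $\Sigma$ is a finite unranked ordered tree in which each node $u$ carries a label $\mathrm{lab}_t(u)\in\Sigma$ and a data value $\mathrm{val}_t(u)\in\mathbb{N}$; $\mathrm{Proj}(t)$ denotes $t$ without its data values. It is a structure with the child relation $E_{\downarrow}$, next-sibling relation $E_{\rightarrow}$, label predicates $a(\cdot)$, $x\sim y$ iff equal data values, $x\prec y$ iff $\mathrm{val}(x)<\mathrm{val}(y)$, and $x\prec_{suc}y$ iff $\mathrm{val}(y)$ is the least data value in the tree greater than $\mathrm{val}(x)$. $\mathrm{FO}^2$ is two-variable first-order logic; $X_i$ are existentially quantified monadic second-order variables. A letter-to-letter tree transducer from $\Sigma$ to $\Gamma$ is an unranked tree automaton (states $Q$, final states $F$, transitions $\delta(q,a)$ regular languages over $Q$ constraining the state-word of the children) with an output relation $\mu\subseteq Q\times\Sigma\times\Gamma$; $t'$ is an output on $t$ if there is an accepting run $\rho$ on $t$ with $(\rho(u),\mathrm{lab}_t(u),\mathrm{lab}_{t'}(u))\in\mu$ at every node. For $t$ over $\Gamma$, $V_t(a)$ is the set of data values of $a$-nodes,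 $[S]_t=\bigcap_{a\in S}V_t(a)\cap\bigcap_{b\notin S}\overline{V_t(b)}$ for $S\subseteq\Gamma$, and if $d_1<\dots<d_m$ are all data values of $t$, $\mathcal{V}_\Gamma(t)=S_1\cdots S_m$ over $2^\Gamma\setminus\{\emptyset\}$ with $d_i\in[S_i]_t$. A weak ODTA over $\Sigma$ is $\langle\mathcal{T},\mathcal{M},\Gamma_0\rangle$ where $\mathcal{T}$ is a letter-to-letter tree transducer from $\Sigma$ to $\Gamma$, $\mathcal{M}$ a finite string automaton over $2^\Gamma$, and $\Gamma_0\subseteq\Gamma$; it accepts $t$ iff there is an ordered-data tree $t'$ over $\Gamma$ that is an output of $\mathcal{T}$ on $\mathrm{Proj}(t)$ (carrying the data values of $t$) such that $\mathcal{M}$ accepts $\mathcal{V}_\Gamma(t')$ and for every $a\in\Gamma_0$ the $a$-nodes of $t'$ have pairwise distinct data values. *)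

theory Defs
  imports Main
begin

subsection \<open>Ordered-data trees\<close>

datatype (labels: 'l) utree = Node (root: 'l) (children: "'l utree list")

text \<open>Nodes are addressed by positions: the root is the empty list, and the children of the node
  \<open>u\<close> are, from left to right, \<open>u @ [0]\<close>, \<open>u @ [1]\<close>, and so on.\<close>

type_synonym pos = "nat list"

primrec is_node :: "'l utree \<Rightarrow> pos \<Rightarrow> bool" where
  "is_node t [] = True"
| "is_node t (i # p) = (i < length (children t) \<and> is_node (children t ! i) p)"

definition nodes :: "'l utree \<Rightarrow> pos set" where
  "nodes t = {u. is_node t u}"

primrec subtree :: "'l utree \<Rightarrow> pos \<Rightarrow> 'l utree" where
  "subtree t [] = t"
| "subtree t (i # p) = subtree (children t ! i) p"

definition label_at :: "'l utree \<Rightarrow> pos \<Rightarrow> 'l" where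
  "label_at t u = root (subtree t u)"

definition arity :: "'l utree \<Rightarrow> pos \<Rightarrow> nat" where
  "arity t u = length (children (subtree t u))"

type_synonym 'a odtree = "('a \<times> nat) utree"

definition lab :: "'a odtree \<Rightarrow> pos \<Rightarrow> 'a" where
  "lab t u = fst (label_at t u)"

definition val :: "'a odtree \<Rightarrow> pos \<Rightarrow> nat" where
  "val t u = snd (label_at t u)"

definition Proj :: "'a odtree \<Rightarrow> 'a utree" where
  "Proj t = map_utree fst t"

definition odtrees :: "'a set \<Rightarrow> 'a odtree set" where
  "odtrees \<Sigma> = {t. \<forall>u\<in>nodes t. lab t u \<in> \<Sigma>}"

definition data_values :: "'a odtree \<Rightarrow> nat set" where
  "data_values t = val t ` nodes t"

lemma finite_nodes: "finite (nodes t)"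
proof (induction t)
  case (Node x ts)
  have "nodes (Node x ts) \<subseteq> insert [] (\<Union>i<length ts. (#) i ` nodes (ts ! i))"
  proof
    fix u assume "u \<in> nodes (Node x ts)"
    then show "u \<in> insert [] (\<Union>i<length ts. (#) i ` nodes (ts ! i))"
      by (cases u) (auto simp: nodes_def)
  qed
  moreover have "finite (insert [] (\<Union>i<length ts. (#) i ` nodes (ts ! i)))"
    using Node.IH by auto
  ultimately show ?case by (rule finite_subset)
qed

lemma finite_data_values: "finite (data_values t)"
  by (simp add: data_values_def finite_nodes)


subsection \<open>Strings of sets of letters attached to data values\<close>

definition V :: "'a odtree \<Rightarrow> 'a \<Rightarrow> nat set" where
  "V t a = {val t u | u. u \<in> nodes t \<and> lab t u = a}"

definition cell :: "'a set \<Rightarrow> 'a odtree \<Rightarrow> 'a set \<Rightarrow> nat set" where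
  "cell \<Gamma> t S = (\<Inter>a\<in>S. V t a) \<inter> (\<Inter>b\<in>\<Gamma> - S. - V t b)"

definition value_string :: "'a set \<Rightarrow> 'a odtree \<Rightarrow> 'a set list" where
  "value_string \<Gamma> t =
     map (\<lambda>d. THE S. S \<in> Pow \<Gamma> - {{}} \<and> d \<in> cell \<Gamma> t S) (sorted_list_of_set (data_values t))"

text \<open>The definite description is well-defined for trees over \<open>\<Gamma>\<close>.\<close>

lemma cell_iff:
  assumes "t \<in> odtrees \<Gamma>" "d \<in> data_values t"
  shows "S \<in> Pow \<Gamma> - {{}} \<and> d \<in> cell \<Gamma> t S \<longleftrightarrow> S = {a \<in> \<Gamma>. d \<in> V t a}"
  using assms unfolding cell_def V_def odtrees_def data_values_def by blast

lemma value_string_eq: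
  assumes "t \<in> odtrees \<Gamma>"
  shows "value_string \<Gamma> t =
    map (\<lambda>d. {a \<in> \<Gamma>. d \<in> V t a}) (sorted_list_of_set (data_values t))"
  unfolding value_string_def
  by (rule map_cong[OF refl])
    (simp only: set_sorted_list_of_set[OF finite_data_values] cell_iff[OF assms] the_eq_trivial)


subsection \<open>Finite string automata and regular languages\<close>

record ('s, 'x) nfa =
  nfa_states :: "'s set"
  nfa_init :: "'s set"
  nfa_final :: "'s set"
  nfa_trans :: "('s \<times> 'x \<times> 's) set"

definition nfa_over :: "'x set \<Rightarrow> ('s, 'x) nfa \<Rightarrow> bool" where
  "nfa_over X A \<longleftrightarrow> finite (nfa_states A) \<and> nfa_init A \<subseteq> nfa_states A \<and>
     nfa_final A \<subseteq> nfa_states A \<and> nfa_trans A \<subseteq> nfa_states A \<times> X \<times> nfa_states A"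

definition nfa_accepts :: "('s, 'x) nfa \<Rightarrow> 'x list \<Rightarrow> bool" where
  "nfa_accepts A w \<longleftrightarrow> (\<exists>r. r 0 \<in> nfa_init A \<and>
     (\<forall>i<length w. (r i, w ! i, r (Suc i)) \<in> nfa_trans A) \<and> r (length w) \<in> nfa_final A)"

text \<open>States of automata and output letters of transducers come from finite sets whose names
  are immaterial; where automata are quantified existentially these sets are taken to be finite
  sets of natural numbers.\<close>

definition regular :: "'x set \<Rightarrow> 'x list set \<Rightarrow> bool" where
  "regular X R \<longleftrightarrow> (\<exists>A :: (nat, 'x) nfa. nfa_over X A \<and> R = {w. nfa_accepts A w})"


subsection \<open>Letter-to-letter tree transducers\<close>

record ('q, 'a, 'g) transducer =
  tr_states :: "'q set"
  tr_final :: "'q set"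
  tr_delta :: "'q \<Rightarrow> 'a \<Rightarrow> 'q list set"
  tr_out :: "('q \<times> 'a \<times> 'g) set"

definition transducer_over :: "'a set \<Rightarrow> 'g set \<Rightarrow> ('q, 'a, 'g) transducer \<Rightarrow> bool" where
  "transducer_over \<Sigma> \<Gamma> T \<longleftrightarrow>
     finite (tr_states T) \<and> tr_final T \<subseteq> tr_states T \<and>
     (\<forall>q\<in>tr_states T. \<forall>a\<in>\<Sigma>. regular (tr_states T) (tr_delta T q a)) \<and>
     tr_out T \<subseteq> tr_states T \<times> \<Sigma> \<times> \<Gamma>"

definition accepting_run :: "('q, 'a, 'g) transducer \<Rightarrow> 'a utree \<Rightarrow> (pos \<Rightarrow> 'q) \<Rightarrow> bool" where
  "accepting_run T t \<rho> \<longleftrightarrow>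
     (\<forall>u\<in>nodes t. \<rho> u \<in> tr_states T \<and>
        map (\<lambda>i. \<rho> (u @ [i])) [0..<arity t u] \<in> tr_delta T (\<rho> u) (label_at t u)) \<and>
     \<rho> [] \<in> tr_final T"

definition is_output :: "('q, 'a, 'g) transducer \<Rightarrow> 'a utree \<Rightarrow> 'g utree \<Rightarrow> bool" where
  "is_output T t t' \<longleftrightarrow> nodes t' = nodes t \<and>
     (\<exists>\<rho>. accepting_run T t \<rho> \<and>
        (\<forall>u\<in>nodes t. (\<rho> u, label_at t u, label_at t' u) \<in> tr_out T))"


subsection \<open>Weak ODTA\<close>

definition weak_odta_over ::
  "'a set \<Rightarrow> 'g set \<Rightarrow> ('q, 'a, 'g) transducer \<times> ('s, 'g set) nfa \<times> 'g set \<Rightarrow> bool" where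
  "weak_odta_over \<Sigma> \<Gamma> = (\<lambda>(T, M, \<Gamma>0).
     finite \<Gamma> \<and> transducer_over \<Sigma> \<Gamma> T \<and> nfa_over (Pow \<Gamma>) M \<and> \<Gamma>0 \<subseteq> \<Gamma>)"

definition weak_odta_accepts ::
  "'g set \<Rightarrow> ('q, 'a, 'g) transducer \<times> ('s, 'g set) nfa \<times> 'g set \<Rightarrow> 'a odtree \<Rightarrow> bool" where
  "weak_odta_accepts \<Gamma> = (\<lambda>(T, M, \<Gamma>0) t.
     \<exists>t'\<in>odtrees \<Gamma>. is_output T (Proj t) (Proj t') \<and> (\<forall>u\<in>nodes t. val t' u = val t u) \<and>
       nfa_accepts M (value_string \<Gamma> t') \<and>
       (\<forall>a\<in>\<Gamma>0. inj_on (val t') {u \<in> nodes t'. lab t' u = a}))"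

definition weak_odta_recognizable :: "'a set \<Rightarrow> 'a odtree set \<Rightarrow> bool" where
  "weak_odta_recognizable \<Sigma> L \<longleftrightarrow>
     (\<exists>(\<Gamma> :: nat set) (W :: (nat, 'a, nat) transducer \<times> (nat, nat set) nfa \<times> nat set).
        weak_odta_over \<Sigma> \<Gamma> W \<and> L = {t \<in> odtrees \<Sigma>. weak_odta_accepts \<Gamma> W t})"


subsection \<open>First-order logic with set variables\<close>

text \<open>Formulas are parameterised by the type \<open>'r\<close> of binary relation symbols. First-order
  variables are named (and may be requantified), as needed for the two-variable fragment.
  \<open>Mem i x\<close> is the atom \<open>X\<^sub>i(x)\<close>, set variables
  being numbered from 0.\<close>

datatype ('a, 'r) fo =
    Eq nat nat
  | Lab 'a nat
  | Mem nat nat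
  | Rel 'r nat nat
  | Neg "('a, 'r) fo"
  | Conj "('a, 'r) fo" "('a, 'r) fo"
  | Disj "('a, 'r) fo" "('a, 'r) fo"
  | Ex nat "('a, 'r) fo"
  | All nat "('a, 'r) fo"

primrec vars :: "('a, 'r) fo \<Rightarrow> nat set" where
  "vars (Eq x y) = {x, y}"
| "vars (Lab a x) = {x}"
| "vars (Mem i x) = {x}"
| "vars (Rel r x y) = {x, y}"
| "vars (Neg \<phi>) = vars \<phi>"
| "vars (Conj \<phi> \<psi>) = vars \<phi> \<union> vars \<psi>"
| "vars (Disj \<phi> \<psi>) = vars \<phi> \<union> vars \<psi>"
| "vars (Ex x \<phi>) = insert x (vars \<phi>)"
| "vars (All x \<phi>) = insert x (vars \<phi>)"

primrec free_vars :: "('a, 'r) fo \<Rightarrow> nat set" where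
  "free_vars (Eq x y) = {x, y}"
| "free_vars (Lab a x) = {x}"
| "free_vars (Mem i x) = {x}"
| "free_vars (Rel r x y) = {x, y}"
| "free_vars (Neg \<phi>) = free_vars \<phi>"
| "free_vars (Conj \<phi> \<psi>) = free_vars \<phi> \<union> free_vars \<psi>"
| "free_vars (Disj \<phi> \<psi>) = free_vars \<phi> \<union> free_vars \<psi>"
| "free_vars (Ex x \<phi>) = free_vars \<phi> - {x}"
| "free_vars (All x \<phi>) = free_vars \<phi> - {x}"

primrec set_vars :: "('a, 'r) fo \<Rightarrow> nat set" where
  "set_vars (Eq x y) = {}"
| "set_vars (Lab a x) = {}"
| "set_vars (Mem i x) = {i}"
| "set_vars (Rel r x y) = {}"
| "set_vars (Neg \<phi>) = set_vars \<phi>"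
| "set_vars (Conj \<phi> \<psi>) = set_vars \<phi> \<union> set_vars \<psi>"
| "set_vars (Disj \<phi> \<psi>) = set_vars \<phi> \<union> set_vars \<psi>"
| "set_vars (Ex x \<phi>) = set_vars \<phi>"
| "set_vars (All x \<phi>) = set_vars \<phi>"

primrec label_preds :: "('a, 'r) fo \<Rightarrow> 'a set" where
  "label_preds (Eq x y) = {}"
| "label_preds (Lab a x) = {a}"
| "label_preds (Mem i x) = {}"
| "label_preds (Rel r x y) = {}"
| "label_preds (Neg \<phi>) = label_preds \<phi>"
| "label_preds (Conj \<phi> \<psi>) = label_preds \<phi> \<union> label_preds \<psi>"
| "label_preds (Disj \<phi> \<psi>) = label_preds \<phi> \<union> label_preds \<psi>"
| "label_preds (Ex x \<phi>) = label_preds \<phi>"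
| "label_preds (All x \<phi>) = label_preds \<phi>"

text \<open>Satisfaction in a tree \<open>t\<close>, where \<open>I\<close> interprets the binary relation symbols, \<open>X\<close> the set
  variables, and \<open>e\<close> the first-order variables.\<close>

primrec holds ::
  "('r \<Rightarrow> pos \<Rightarrow> pos \<Rightarrow> bool) \<Rightarrow> 'a odtree \<Rightarrow> (nat \<Rightarrow> pos set) \<Rightarrow> (nat \<Rightarrow> pos) \<Rightarrow> ('a, 'r) fo \<Rightarrow> bool"
where
  "holds I t X e (Eq x y) = (e x = e y)"
| "holds I t X e (Lab a x) = (lab t (e x) = a)"
| "holds I t X e (Mem i x) = (e x \<in> X i)"
| "holds I t X e (Rel r x y) = I r (e x) (e y)"
| "holds I t X e (Neg \<phi>) = (\<not> holds I t X e \<phi>)"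
| "holds I t X e (Conj \<phi> \<psi>) = (holds I t X e \<phi> \<and> holds I t X e \<psi>)"
| "holds I t X e (Disj \<phi> \<psi>) = (holds I t X e \<phi> \<or> holds I t X e \<psi>)"
| "holds I t X e (Ex x \<phi>) = (\<exists>u\<in>nodes t. holds I t X (e(x := u)) \<phi>)"
| "holds I t X e (All x \<phi>) = (\<forall>u\<in>nodes t. holds I t X (e(x := u)) \<phi>)"

datatype tree_rel = Child | Next_Sibling

fun tree_interp :: "tree_rel \<Rightarrow> pos \<Rightarrow> pos \<Rightarrow> bool" where
  "tree_interp Child u v = (\<exists>i. v = u @ [i])"
| "tree_interp Next_Sibling u v = (\<exists>w i. u = w @ [i] \<and> v = w @ [Suc i])"

datatype data_rel = Sim | Prec | Prec_Suc

fun data_interp :: "'a odtree \<Rightarrow> data_rel \<Rightarrow> pos \<Rightarrow> pos \<Rightarrow> bool" where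
  "data_interp t Sim u v = (val t u = val t v)"
| "data_interp t Prec u v = (val t u < val t v)"
| "data_interp t Prec_Suc u v =
     (val t u < val t v \<and> (\<forall>d\<in>data_values t. val t u < d \<longrightarrow> val t v \<le> d))"

definition sentence_over :: "'a set \<Rightarrow> nat \<Rightarrow> ('a, 'r) fo \<Rightarrow> bool" where
  "sentence_over \<Sigma> m \<phi> \<longleftrightarrow>
     free_vars \<phi> = {} \<and> label_preds \<phi> \<subseteq> \<Sigma> \<and> set_vars \<phi> \<subseteq> {..<m}"

definition two_variable :: "('a, 'r) fo \<Rightarrow> bool" where
  "two_variable \<phi> \<longleftrightarrow> vars \<phi> \<subseteq> {0, 1}"

text \<open>Sentences do not depend on the assignment of first-order variables, so an arbitrary one
  (mapping everything to the root) is used.\<close>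

definition models ::
  "'a odtree \<Rightarrow> nat \<Rightarrow> ('a, tree_rel) fo \<Rightarrow> ('a, data_rel) fo \<Rightarrow> bool" where
  "models t m \<phi> \<psi> \<longleftrightarrow> (\<exists>X. (\<forall>i<m. X i \<subseteq> nodes t) \<and>
     holds tree_interp t X (\<lambda>_. []) \<phi> \<and> holds (data_interp t) t X (\<lambda>_. []) \<psi>)"

definition logic_expressible :: "'a set \<Rightarrow> 'a odtree set \<Rightarrow> bool" where
  "logic_expressible \<Sigma> L \<longleftrightarrow>
     (\<exists>m (\<phi> :: ('a, tree_rel) fo) (\<psi> :: ('a, data_rel) fo).
        sentence_over \<Sigma> m \<phi> \<and> two_variable \<phi> \<and> sentence_over \<Sigma> m \<psi> \<and>
        L = {t \<in> odtrees \<Sigma>. models t m \<phi> \<psi>})"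

end

theory Submission
  imports Defs
begin

text \<open>
  For the direction from logic to automata, the Ehrenfeucht--Fraisse equivalence of a fixed
  quantifier rank has finite index and is a congruence for composing structures in which the
  relations between two parts depend only on the colours of the elements (Feferman--Vaught).
  Hence the classes of trees and hedges are the states of a tree transducer, and
  the classes of strings over \<open>2\<^sup>\<Gamma>\<close>, read as structures ordered by data values, those of a
  string automaton. A first-order formula with \<open>K\<close> variables counts the nodes that share
  a value and a label only up to \<open>K\<close>. The transducer therefore outputs a counter in \<open>{0..K}\<close> along with
  the label. Requiring counters below \<open>K\<close> to be unique for each value, which is what \<open>\<Gamma>\<^sub>0\<close> can
  express, lets the string automaton read off the truncated multiplicities.

  Conversely, the set variables encode at each node its state, its output letter, and the states of
  the horizontal automaton and of the string automaton before and after reading it. The correctness of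
  these runs is a condition on pairs of nodes.
\<close>

subsection \<open>Positions in trees\<close>

text \<open>Uniqueness of the counters below \<open>K\<close> is not enough: a single node could
  still carry the counter \<open>K\<close>. The string automaton therefore also checks that the
  counters used with a label at a value form an initial segment, so that an occurrence of
  \<open>K\<close> certifies \<open>K + 1\<close> nodes. The bound comes from the pebbles: when one
  of \<open>K\<close> pebbles is placed, fewer than \<open>K\<close> elements are occupied by the
  others, so larger multiplicities cannot be told apart.

  Relations between two parts may depend only on colours, but next sibling and successor value look
  at the border of a part. Colours therefore carry border flags besides labels, and gluing must be
  able to recolour.

  In the other direction, two variables cannot name a parent and two consecutive children at once.
  Recording at a child the horizontal state both before and after reading it makes a transition a
  condition on parent and child, and the chaining of transitions a condition on adjacent siblings.
  Data values are treated in the same way, with consecutive values in place of siblings.\<close>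

lemma is_node_append: "is_node t (u @ v) \<longleftrightarrow> is_node t u \<and> is_node (subtree t u) v"
  by (induction u arbitrary: t) auto

lemma subtree_append: "subtree t (u @ v) = subtree (subtree t u) v"
  by (induction u arbitrary: t) auto

lemma Nil_in_nodes [simp]: "[] \<in> nodes t"
  by (simp add: nodes_def)

lemma Cons_in_nodes [simp]:
  "i # p \<in> nodes t \<longleftrightarrow> i < length (children t) \<and> p \<in> nodes (children t ! i)"
  by (simp add: nodes_def)

lemma append_in_nodes: "u @ v \<in> nodes t \<longleftrightarrow> u \<in> nodes t \<and> v \<in> nodes (subtree t u)"
  by (simp add: nodes_def is_node_append)

lemma child_in_nodes: "u @ [i] \<in> nodes t \<longleftrightarrow> u \<in> nodes t \<and> i < arity t u"
  by (simp add: append_in_nodes arity_def)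

lemma label_at_Nil [simp]: "label_at t [] = root t"
  by (simp add: label_at_def)

lemma label_at_Cons [simp]: "label_at t (i # p) = label_at (children t ! i) p"
  by (simp add: label_at_def)

lemma label_at_append: "label_at t (u @ v) = label_at (subtree t u) v"
  by (simp add: label_at_def subtree_append)

lemma subtree_map_utree: "u \<in> nodes t \<Longrightarrow> subtree (map_utree f t) u = map_utree f (subtree t u)"
proof (induction u arbitrary: t)
  case (Cons i u)
  then show ?case by (cases t) simp
qed simp

lemma nodes_map_utree [simp]: "nodes (map_utree f t) = nodes t"
proof -
  have "u \<in> nodes (map_utree f t) \<longleftrightarrow> u \<in> nodes t" for u
  proof (induction u arbitrary: t)
    case (Cons i u)
    have "children (map_utree f t) = map (map_utree f) (children t)"
      by (rule utree.map_sel)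
    then show ?case by (simp add: Cons.IH cong: conj_cong)
  qed simp
  then show ?thesis by blast
qed

lemma label_at_map_utree [simp]: "u \<in> nodes t \<Longrightarrow> label_at (map_utree f t) u = f (label_at t u)"
  by (simp add: label_at_def subtree_map_utree utree.map_sel)

lemma arity_map_utree [simp]: "u \<in> nodes t \<Longrightarrow> arity (map_utree f t) u = arity t u"
  by (simp add: arity_def subtree_map_utree utree.map_sel)

lemma nodes_Proj [simp]: "nodes (Proj t) = nodes t"
  by (simp add: Proj_def)

lemma label_at_Proj [simp]: "u \<in> nodes t \<Longrightarrow> label_at (Proj t) u = lab t u"
  by (simp add: Proj_def lab_def)

lemma arity_Proj [simp]: "u \<in> nodes t \<Longrightarrow> arity (Proj t) u = arity t u"
  by (simp add: Proj_def)

lemma arity_cong: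
  assumes "nodes t = nodes t'" "u \<in> nodes t"
  shows "arity t u = arity t' u"
proof -
  have "i < arity t u \<longleftrightarrow> i < arity t' u" for i
    using assms child_in_nodes[of u i t] child_in_nodes[of u i t'] by simp
  then show ?thesis by (meson linorder_neq_iff less_irrefl)
qed

text \<open>Trees are a datatype, not a labelling of a set of positions, so a tree with prescribed
  labels has to be rebuilt from its subtrees. Both directions use this to obtain the output tree of
  the transducer from letters chosen at positions.\<close>

lemma ex_relabel: "\<exists>t'. nodes t' = nodes t \<and> (\<forall>u\<in>nodes t. label_at t' u = f u)"
proof (induction t arbitrary: f)
  case (Node a ts)
  have "\<exists>t'. nodes t' = nodes (ts ! i) \<and> (\<forall>u\<in>nodes (ts ! i). label_at t' u = f (i # u))"
    if "i < length ts" for i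
    using that by (intro Node.IH) simp
  then obtain g where g: "nodes (g i) = nodes (ts ! i)"
    "\<forall>u\<in>nodes (ts ! i). label_at (g i) u = f (i # u)" if "i < length ts" for i
    by metis
  let ?t' = "Node (f []) (map g [0..<length ts])"
  have "u \<in> nodes ?t' \<longleftrightarrow> u \<in> nodes (Node a ts)" for u
    using g(1) by (cases u) auto
  moreover have "label_at ?t' u = f u" if "u \<in> nodes (Node a ts)" for u
    using g(2) that by (cases u) auto
  ultimately show ?case by blast
qed

subsection \<open>Ehrenfeucht--Fraisse games with partial assignments\<close>

text \<open>\<open>col\<close> bundles all unary information, kept apart from \<open>rel\<close>:
  gluing may relate elements of different parts through their colours alone, and may recolour
  them.\<close>

record ('u, 'c, 'r) str =
  uni :: "'u set"
  col :: "'u \<Rightarrow> 'c"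
  rel :: "'r \<Rightarrow> 'u \<Rightarrow> 'u \<Rightarrow> bool"

text \<open>Partial isomorphism between pebbled elements. The pebbles are the variables
  \<open>x < k\<close> and can be moved again, as fits formulas that requantify a variable;
  \<open>None\<close> is an unplaced pebble.\<close>

definition piso :: "nat \<Rightarrow> ('u, 'c, 'r) str \<Rightarrow> (nat \<Rightarrow> 'u option) \<Rightarrow> ('v, 'c, 'r) str \<Rightarrow> (nat \<Rightarrow> 'v option) \<Rightarrow> bool" where
  "piso k A e B f \<longleftrightarrow>
     (\<forall>x<k. (e x = None \<longleftrightarrow> f x = None)) \<and>
     (\<forall>x<k. \<forall>u v. e x = Some u \<longrightarrow> f x = Some v \<longrightarrow> u \<in> uni A \<and> v \<in> uni B \<and> col A u = col B v) \<and>
     (\<forall>x<k. \<forall>y<k. \<forall>u u' v v'. e x = Some u \<longrightarrow> e y = Some u' \<longrightarrow> f x = Some v \<longrightarrow> f y = Some v' \<longrightarrow>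
        (u = u' \<longleftrightarrow> v = v') \<and> (\<forall>r. rel A r u u' \<longleftrightarrow> rel B r v v'))"

lemma pisoI:
  assumes "\<And>x. x < k \<Longrightarrow> e x = None \<longleftrightarrow> f x = None"
    and "\<And>x u v. x < k \<Longrightarrow> e x = Some u \<Longrightarrow> f x = Some v \<Longrightarrow> u \<in> uni A \<and> v \<in> uni B \<and> col A u = col B v"
    and "\<And>x y u u' v v'. x < k \<Longrightarrow> y < k \<Longrightarrow> e x = Some u \<Longrightarrow> e y = Some u' \<Longrightarrow>
      f x = Some v \<Longrightarrow> f y = Some v' \<Longrightarrow> (u = u' \<longleftrightarrow> v = v') \<and> (\<forall>r. rel A r u u' \<longleftrightarrow> rel B r v v')"
  shows "piso k A e B f"
  unfolding piso_def using assms by blast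

lemma piso_None: "piso k A e B f \<Longrightarrow> x < k \<Longrightarrow> e x = None \<longleftrightarrow> f x = None"
  unfolding piso_def by blast

lemma piso_SomeE:
  assumes "piso k A e B f" "x < k" "e x = Some u"
  obtains v where "f x = Some v" "u \<in> uni A" "v \<in> uni B" "col A u = col B v"
proof -
  from assms obtain v where "f x = Some v"
    using piso_None[OF assms(1,2)] by (cases "f x") simp_all
  with assms show thesis unfolding piso_def by (intro that[of v]) simp_all
qed

lemma piso_Some:
  assumes "piso k A e B f" "x < k" "e x = Some u" "f x = Some v"
  shows "u \<in> uni A \<and> v \<in> uni B \<and> col A u = col B v"
  by (rule piso_SomeE[OF assms(1-3)]) (use assms(4) in simp)

lemma piso_rel:
  assumes "piso k A e B f" "x < k" "y < k" "e x = Some u" "e y = Some u'" "f x = Some v" "f y = Some v'"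
  shows "u = u' \<longleftrightarrow> v = v'" "rel A r u u' \<longleftrightarrow> rel B r v v'"
  using assms unfolding piso_def by blast+

lemma piso_sym:
  assumes "piso k A e B f"
  shows "piso k B f A e"
proof (rule pisoI)
  show "f x = None \<longleftrightarrow> e x = None" if "x < k" for x using piso_None[OF assms that] by (rule sym)
  show "v \<in> uni B \<and> u \<in> uni A \<and> col B v = col A u" if "x < k" "f x = Some v" "e x = Some u" for x u v
    by (rule piso_SomeE[OF assms that(1,3)]) (use that(2) in simp)
  show "(v = v' \<longleftrightarrow> u = u') \<and> (\<forall>r. rel B r v v' \<longleftrightarrow> rel A r u u')"
    if "x < k" "y < k" "f x = Some v" "f y = Some v'" "e x = Some u" "e y = Some u'" for x y u u' v v'
    using piso_rel[OF assms that(1,2,5,6,3,4)] by simp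
qed

lemma piso_trans:
  assumes "piso k A e B f" "piso k B f C g"
  shows "piso k A e C g"
proof (rule pisoI)
  show "e x = None \<longleftrightarrow> g x = None" if "x < k" for x
    using piso_None[OF assms(1) that] piso_None[OF assms(2) that] by simp
  show "u \<in> uni A \<and> w \<in> uni C \<and> col A u = col C w" if x: "x < k" "e x = Some u" "g x = Some w" for x u w
  proof -
    obtain v where v: "f x = Some v" "u \<in> uni A" "col A u = col B v" by (rule piso_SomeE[OF assms(1) x(1,2)])
    show ?thesis by (rule piso_SomeE[OF assms(2) x(1) v(1)]) (use v x in simp)
  qed
  show "(u = u' \<longleftrightarrow> w = w') \<and> (\<forall>r. rel A r u u' \<longleftrightarrow> rel C r w w')"
    if x: "x < k" "y < k" "e x = Some u" "e y = Some u'" "g x = Some w" "g y = Some w'" for x y u u' w w'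
  proof -
    obtain v where v: "f x = Some v" by (rule piso_SomeE[OF assms(1) x(1,3)])
    obtain v' where v': "f y = Some v'" by (rule piso_SomeE[OF assms(1) x(2,4)])
    show ?thesis
      using piso_rel[OF assms(1) x(1-4) v v'] piso_rel[OF assms(2) x(1,2) v v' x(5,6)] by simp
  qed
qed

text \<open>The value \<open>None\<close> stands for a variable placed outside the structure; such moves are needed
  when the structure is a part of a larger one.\<close>

primrec ef :: "nat \<Rightarrow> nat \<Rightarrow> ('u, 'c, 'r) str \<Rightarrow> (nat \<Rightarrow> 'u option) \<Rightarrow> ('v, 'c, 'r) str \<Rightarrow> (nat \<Rightarrow> 'v option) \<Rightarrow> bool" where
  "ef k 0 A e B f = piso k A e B f"
| "ef k (Suc n) A e B f \<longleftrightarrow> ef k n A e B f \<and> (\<forall>x<k.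
     ef k n A (e(x := None)) B (f(x := None)) \<and>
     (\<forall>u\<in>uni A. \<exists>v\<in>uni B. ef k n A (e(x := Some u)) B (f(x := Some v))) \<and>
     (\<forall>v\<in>uni B. \<exists>u\<in>uni A. ef k n A (e(x := Some u)) B (f(x := Some v))))"

lemma ef_piso: "ef k n A e B f \<Longrightarrow> piso k A e B f"
  by (induction n) auto

text \<open>Built into the successor clause by its first conjunct. It lets one part of a composed
  structure sit out a round.\<close>

lemma ef_mono: "ef k (Suc n) A e B f \<Longrightarrow> ef k n A e B f"
  by simp

lemma ef_None: "ef k (Suc n) A e B f \<Longrightarrow> x < k \<Longrightarrow> ef k n A (e(x := None)) B (f(x := None))"
  by simp

lemma ef_forth:
  assumes "ef k (Suc n) A e B f" "x < k" "u \<in> uni A"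
  obtains v where "v \<in> uni B" "ef k n A (e(x := Some u)) B (f(x := Some v))"
  using assms unfolding ef.simps(2) by blast

lemma ef_back:
  assumes "ef k (Suc n) A e B f" "x < k" "v \<in> uni B"
  obtains u where "u \<in> uni A" "ef k n A (e(x := Some u)) B (f(x := Some v))"
  using assms unfolding ef.simps(2) by blast

lemma ef_SucI:
  assumes "ef k n A e B f"
    and "\<And>x. x < k \<Longrightarrow> ef k n A (e(x := None)) B (f(x := None))"
    and "\<And>x u. x < k \<Longrightarrow> u \<in> uni A \<Longrightarrow> \<exists>v\<in>uni B. ef k n A (e(x := Some u)) B (f(x := Some v))"
    and "\<And>x v. x < k \<Longrightarrow> v \<in> uni B \<Longrightarrow> \<exists>u\<in>uni A. ef k n A (e(x := Some u)) B (f(x := Some v))"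
  shows "ef k (Suc n) A e B f"
  using assms by simp

declare ef.simps(2) [simp del]

lemma ef_refl: "\<forall>x<k. \<forall>u. e x = Some u \<longrightarrow> u \<in> uni A \<Longrightarrow> ef k n A e A e"
proof (induction n arbitrary: e)
  case 0
  then show ?case by (auto intro!: pisoI)
next
  case (Suc n)
  have "ef k n A (e(x := None)) A (e(x := None))" for x
    using Suc.prems by (intro Suc.IH) auto
  moreover have "ef k n A (e(x := Some u)) A (e(x := Some u))" if "u \<in> uni A" for x u
    using Suc.prems that by (intro Suc.IH) auto
  moreover have "ef k n A e A e" by (rule Suc.IH[OF Suc.prems])
  ultimately show ?case by (blast intro: ef_SucI)
qed

lemma ef_sym: "ef k n A e B f \<Longrightarrow> ef k n B f A e"
proof (induction n arbitrary: e f)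
  case 0
  then show ?case by (simp add: piso_sym)
next
  case (Suc n)
  show ?case
  proof (rule ef_SucI)
    show "ef k n B f A e" using ef_mono[OF Suc.prems] by (rule Suc.IH)
    show "ef k n B (f(x := None)) A (e(x := None))" if "x < k" for x
      using ef_None[OF Suc.prems that] by (rule Suc.IH)
    show "\<exists>v\<in>uni A. ef k n B (f(x := Some u)) A (e(x := Some v))" if "x < k" "u \<in> uni B" for x u
      by (rule ef_back[OF Suc.prems that]) (blast intro: Suc.IH)
    show "\<exists>u\<in>uni B. ef k n B (f(x := Some u)) A (e(x := Some v))" if "x < k" "v \<in> uni A" for x v
      by (rule ef_forth[OF Suc.prems that]) (blast intro: Suc.IH)
  qed
qed

lemma ef_trans: "ef k n A e B f \<Longrightarrow> ef k n B f C g \<Longrightarrow> ef k n A e C g"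
proof (induction n arbitrary: e f g)
  case 0
  then show ?case by (auto intro: piso_trans)
next
  case (Suc n)
  show ?case
  proof (rule ef_SucI)
    show "ef k n A e C g" using ef_mono[OF Suc.prems(1)] ef_mono[OF Suc.prems(2)] by (rule Suc.IH)
    show "ef k n A (e(x := None)) C (g(x := None))" if "x < k" for x
      using ef_None[OF Suc.prems(1) that] ef_None[OF Suc.prems(2) that] by (rule Suc.IH)
  next
    fix x u assume "x < k" "u \<in> uni A"
    then obtain v where v: "v \<in> uni B" "ef k n A (e(x := Some u)) B (f(x := Some v))"
      using ef_forth[OF Suc.prems(1)] by blast
    with \<open>x < k\<close> obtain w where "w \<in> uni C" "ef k n B (f(x := Some v)) C (g(x := Some w))"
      using ef_forth[OF Suc.prems(2)] by blast
    then show "\<exists>w\<in>uni C. ef k n A (e(x := Some u)) C (g(x := Some w))" using v Suc.IH by blast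
  next
    fix x w assume "x < k" "w \<in> uni C"
    then obtain v where v: "v \<in> uni B" "ef k n B (f(x := Some v)) C (g(x := Some w))"
      using ef_back[OF Suc.prems(2)] by blast
    with \<open>x < k\<close> obtain u where "u \<in> uni A" "ef k n A (e(x := Some u)) B (f(x := Some v))"
      using ef_back[OF Suc.prems(1)] by blast
    then show "\<exists>u\<in>uni A. ef k n A (e(x := Some u)) C (g(x := Some w))" using v Suc.IH by blast
  qed
qed

subsection \<open>Composition of structures\<close>

text \<open>Values of \<open>b\<close> at variables placed by \<open>a\<close> are irrelevant, so a move into the first part needs
  no update of \<open>b\<close>.\<close>

definition join :: "('u \<Rightarrow> 'w) \<Rightarrow> ('v \<Rightarrow> 'w) \<Rightarrow> (nat \<Rightarrow> 'u option) \<Rightarrow> (nat \<Rightarrow> 'v option) \<Rightarrow> nat \<Rightarrow> 'w option" where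
  "join f1 f2 a b x = (case a x of Some u \<Rightarrow> Some (f1 u) | None \<Rightarrow> map_option f2 (b x))"

text \<open>The generalised sum of Feferman and Vaught: the parts embed by \<open>f1\<close> and
  \<open>f2\<close>, and \<open>F\<close> and \<open>G\<close> compute the relations across from the
  colours. \<open>h1\<close> and \<open>h2\<close> recolour because border flags change when a part
  is absorbed into a larger structure.\<close>

definition glued ::
  "('c \<Rightarrow> 'c) \<Rightarrow> ('c \<Rightarrow> 'c) \<Rightarrow> ('r \<Rightarrow> 'c \<Rightarrow> 'c \<Rightarrow> bool) \<Rightarrow> ('r \<Rightarrow> 'c \<Rightarrow> 'c \<Rightarrow> bool) \<Rightarrow>
   ('u, 'c, 'r) str \<Rightarrow> ('u \<Rightarrow> 'w) \<Rightarrow> ('v, 'c, 'r) str \<Rightarrow> ('v \<Rightarrow> 'w) \<Rightarrow> ('w, 'c, 'r) str \<Rightarrow> bool" where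
  "glued h1 h2 F G A f1 B f2 C \<longleftrightarrow>
     uni C = f1 ` uni A \<union> f2 ` uni B \<and>
     (\<forall>u\<in>uni A. \<forall>v\<in>uni A. (f1 u = f1 v \<longleftrightarrow> u = v) \<and> (\<forall>r. rel C r (f1 u) (f1 v) = rel A r u v)) \<and>
     (\<forall>u\<in>uni B. \<forall>v\<in>uni B. (f2 u = f2 v \<longleftrightarrow> u = v) \<and> (\<forall>r. rel C r (f2 u) (f2 v) = rel B r u v)) \<and>
     (\<forall>u\<in>uni A. \<forall>v\<in>uni B. f1 u \<noteq> f2 v \<and>
        (\<forall>r. rel C r (f1 u) (f2 v) = F r (col A u) (col B v) \<and> rel C r (f2 v) (f1 u) = G r (col B v) (col A u))) \<and>
     (\<forall>u\<in>uni A. col C (f1 u) = h1 (col A u)) \<and> (\<forall>u\<in>uni B. col C (f2 u) = h2 (col B u))"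

lemma piso_glued:
  assumes C: "glued h1 h2 F G A f1 B f2 C" and C': "glued h1 h2 F G A' f1' B' f2' C'"
    and A: "piso k A a A' a'" and B: "piso k B b B' b'"
  shows "piso k C (join f1 f2 a b) C' (join f1' f2' a' b')"
proof -
  \<comment> \<open>A pebble lies in the same part on both sides, on elements of equal colour.
    Relations within a part then come from the two isomorphisms, relations across from
    \<open>F\<close> and \<open>G\<close>.\<close>
  have place: "(a x = None \<and> a' x = None \<and> b x = None \<and> b' x = None) \<or>
     (\<exists>u v. a x = Some u \<and> a' x = Some v \<and> u \<in> uni A \<and> v \<in> uni A' \<and> col A u = col A' v) \<or>
     (\<exists>u v. a x = None \<and> a' x = None \<and> b x = Some u \<and> b' x = Some v \<and> u \<in> uni B \<and> v \<in> uni B' \<and> col B u = col B' v)"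
    if "x < k" for x
  proof (cases "a x")
    case None
    then have "a' x = None" using piso_None[OF A that] by simp
    show ?thesis
    proof (cases "b x")
      case None
      then show ?thesis using \<open>a x = None\<close> \<open>a' x = None\<close> piso_None[OF B that] by simp
    next
      case (Some u)
      show ?thesis
        by (rule piso_SomeE[OF B that Some]) (use Some \<open>a x = None\<close> \<open>a' x = None\<close> in simp)
    qed
  next
    case (Some u)
    show ?thesis by (rule piso_SomeE[OF A that Some]) (use Some in simp)
  qed
  show ?thesis
  proof (rule pisoI)
    fix x assume x: "x < k"
    show "join f1 f2 a b x = None \<longleftrightarrow> join f1' f2' a' b' x = None"
      using place[OF x] by (elim disjE exE conjE) (simp_all add: join_def)
    fix u v assume uv: "join f1 f2 a b x = Some u" "join f1' f2' a' b' x = Some v"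
    show "u \<in> uni C \<and> v \<in> uni C' \<and> col C u = col C' v"
      using place[OF x] uv C C' unfolding glued_def
      by (elim disjE exE conjE) (auto simp: join_def)
    fix y u' v' assume y: "y < k"
      and uv': "join f1 f2 a b y = Some u'" "join f1' f2' a' b' y = Some v'"
    show "(u = u' \<longleftrightarrow> v = v') \<and> (\<forall>r. rel C r u u' = rel C' r v v')"
    proof -
      have x': "(\<exists>p q. a x = Some p \<and> a' x = Some q \<and> p \<in> uni A \<and> q \<in> uni A' \<and> col A p = col A' q
            \<and> u = f1 p \<and> v = f1' q) \<or>
          (\<exists>p q. b x = Some p \<and> b' x = Some q \<and> p \<in> uni B \<and> q \<in> uni B' \<and> col B p = col B' q
            \<and> u = f2 p \<and> v = f2' q)"
        using place[OF x] uv by (elim disjE exE conjE) (simp_all add: join_def)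
      have y': "(\<exists>p q. a y = Some p \<and> a' y = Some q \<and> p \<in> uni A \<and> q \<in> uni A' \<and> col A p = col A' q
            \<and> u' = f1 p \<and> v' = f1' q) \<or>
          (\<exists>p q. b y = Some p \<and> b' y = Some q \<and> p \<in> uni B \<and> q \<in> uni B' \<and> col B p = col B' q
            \<and> u' = f2 p \<and> v' = f2' q)"
        using place[OF y] uv' by (elim disjE exE conjE) (simp_all add: join_def)
      show ?thesis
        using x' y'
      proof (elim disjE exE conjE)
        fix p q p' q' assume 1: "a x = Some p" "a' x = Some q" "a y = Some p'" "a' y = Some q'"
          and "p \<in> uni A" "q \<in> uni A'" "p' \<in> uni A" "q' \<in> uni A'"
          and "u = f1 p" "v = f1' q" "u' = f1 p'" "v' = f1' q'"
        then show ?thesis using C C' piso_rel[OF A x y 1(1,3,2,4)] unfolding glued_def by simp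
      next
        fix p q p' q' assume 1: "b x = Some p" "b' x = Some q" "b y = Some p'" "b' y = Some q'"
          and "p \<in> uni B" "q \<in> uni B'" "p' \<in> uni B" "q' \<in> uni B'"
          and "u = f2 p" "v = f2' q" "u' = f2 p'" "v' = f2' q'"
        then show ?thesis using C C' piso_rel[OF B x y 1(1,3,2,4)] unfolding glued_def by simp
      next
        fix p q p' q' assume "p \<in> uni A" "q \<in> uni A'" "p' \<in> uni B" "q' \<in> uni B'"
          and "col A p = col A' q" "col B p' = col B' q'"
          and "u = f1 p" "v = f1' q" "u' = f2 p'" "v' = f2' q'"
        then show ?thesis using C C' unfolding glued_def by simp
      next
        fix p q p' q' assume *: "p \<in> uni B" "q \<in> uni B'" "p' \<in> uni A" "q' \<in> uni A'"
          and "col B p = col B' q" "col A p' = col A' q'"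
          and "u = f2 p" "v = f2' q" "u' = f1 p'" "v' = f1' q'"
        moreover have "f1 p' \<noteq> f2 p" "f1' q' \<noteq> f2' q" using * C C' unfolding glued_def by simp_all
        ultimately show ?thesis using C C' unfolding glued_def by metis
      qed
    qed
  qed
qed

text \<open>\<open>join\<close> consults \<open>a\<close> first, so a pebble placed in the second
  part must be lifted from the first. The \<open>None\<close> moves of \<open>ef\<close> make this
  possible.\<close>

lemma join_None: "(join f1 f2 a b)(x := None) = join f1 f2 (a(x := None)) (b(x := None))"
  and join_Some1: "(join f1 f2 a b)(x := Some (f1 u)) = join f1 f2 (a(x := Some u)) b"
  and join_Some2: "(join f1 f2 a b)(x := Some (f2 v)) = join f1 f2 (a(x := None)) (b(x := Some v))"
  by (simp_all add: join_def fun_eq_iff split: option.split)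

text \<open>The reply is made in the part where the move was made. After a move in the first part
  the second only loses a round (\<open>ef_mono\<close>); after a move in the second part the first
  also loses the pebble (\<open>ef_None\<close>).\<close>

lemma ef_glued:
  assumes C: "glued h1 h2 F G A f1 B f2 C" and C': "glued h1 h2 F G A' f1' B' f2' C'"
  shows "ef k n A a A' a' \<Longrightarrow> ef k n B b B' b' \<Longrightarrow> ef k n C (join f1 f2 a b) C' (join f1' f2' a' b')"
proof (induction n arbitrary: a a' b b')
  case 0
  then show ?case using piso_glued[OF C C'] by simp
next
  case (Suc n)
  have uC: "uni C = f1 ` uni A \<union> f2 ` uni B" and uC': "uni C' = f1' ` uni A' \<union> f2' ` uni B'"
    using C C' unfolding glued_def by simp_all
  show ?case
  proof (rule ef_SucI)
    show "ef k n C (join f1 f2 a b) C' (join f1' f2' a' b')"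
      by (rule Suc.IH[OF Suc.prems[THEN ef_mono]])
  next
    fix x assume x: "x < k"
    note N = ef_None[OF Suc.prems(1) x] ef_None[OF Suc.prems(2) x]
    show "ef k n C ((join f1 f2 a b)(x := None)) C' ((join f1' f2' a' b')(x := None))"
      unfolding join_None by (rule Suc.IH[OF N])
    {
      fix u assume "u \<in> uni C"
      then consider (1) p where "p \<in> uni A" "u = f1 p" | (2) p where "p \<in> uni B" "u = f2 p"
        unfolding uC by blast
      then show "\<exists>v\<in>uni C'. ef k n C ((join f1 f2 a b)(x := Some u)) C' ((join f1' f2' a' b')(x := Some v))"
      proof cases
        case 1
        obtain q where q: "q \<in> uni A'" "ef k n A (a(x := Some p)) A' (a'(x := Some q))"
          by (rule ef_forth[OF Suc.prems(1) x 1(1)])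
        show ?thesis
        proof (rule bexI[of _ "f1' q"])
          show "f1' q \<in> uni C'" using q uC' by blast
          show "ef k n C ((join f1 f2 a b)(x := Some u)) C' ((join f1' f2' a' b')(x := Some (f1' q)))"
            unfolding 1(2) join_Some1 by (rule Suc.IH[OF q(2) ef_mono[OF Suc.prems(2)]])
        qed
      next
        case 2
        obtain q where q: "q \<in> uni B'" "ef k n B (b(x := Some p)) B' (b'(x := Some q))"
          by (rule ef_forth[OF Suc.prems(2) x 2(1)])
        show ?thesis
        proof (rule bexI[of _ "f2' q"])
          show "f2' q \<in> uni C'" using q uC' by blast
          show "ef k n C ((join f1 f2 a b)(x := Some u)) C' ((join f1' f2' a' b')(x := Some (f2' q)))"
            unfolding 2(2) join_Some2 by (rule Suc.IH[OF N(1) q(2)])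
        qed
      qed
    }
    {
      fix v assume "v \<in> uni C'"
      then consider (1) q where "q \<in> uni A'" "v = f1' q" | (2) q where "q \<in> uni B'" "v = f2' q"
        unfolding uC' by blast
      then show "\<exists>u\<in>uni C. ef k n C ((join f1 f2 a b)(x := Some u)) C' ((join f1' f2' a' b')(x := Some v))"
      proof cases
        case 1
        obtain p where p: "p \<in> uni A" "ef k n A (a(x := Some p)) A' (a'(x := Some q))"
          by (rule ef_back[OF Suc.prems(1) x 1(1)])
        show ?thesis
        proof (rule bexI[of _ "f1 p"])
          show "f1 p \<in> uni C" using p uC by blast
          show "ef k n C ((join f1 f2 a b)(x := Some (f1 p))) C' ((join f1' f2' a' b')(x := Some v))"
            unfolding 1(2) join_Some1 by (rule Suc.IH[OF p(2) ef_mono[OF Suc.prems(2)]])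
        qed
      next
        case 2
        obtain p where p: "p \<in> uni B" "ef k n B (b(x := Some p)) B' (b'(x := Some q))"
          by (rule ef_back[OF Suc.prems(2) x 2(1)])
        show ?thesis
        proof (rule bexI[of _ "f2 p"])
          show "f2 p \<in> uni C" using p uC by blast
          show "ef k n C ((join f1 f2 a b)(x := Some (f2 p))) C' ((join f1' f2' a' b')(x := Some v))"
            unfolding 2(2) join_Some2 by (rule Suc.IH[OF N(1) p(2)])
        qed
      qed
    }
  qed
qed

abbreviation efc :: "nat \<Rightarrow> nat \<Rightarrow> ('u, 'c, 'r) str \<Rightarrow> ('v, 'c, 'r) str \<Rightarrow> bool" where
  "efc k n A B \<equiv> ef k n A (\<lambda>_. None) B (\<lambda>_. None)"

lemma efc_glued:
  assumes "glued h1 h2 F G A f1 B f2 C" "glued h1 h2 F G A' f1' B' f2' C'"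
    and "efc k n A A'" "efc k n B B'"
  shows "efc k n C C'"
  using ef_glued[OF assms] by (simp add: join_def[abs_def])

lemma efc_refl: "efc k n A A"
  by (rule ef_refl) simp

subsection \<open>Finite index and preservation of formulas\<close>

lemma ex_inj_nat: "finite A \<Longrightarrow> \<exists>g :: 'x \<Rightarrow> nat. inj_on g A"
  using finite_imp_inj_to_nat_seg by fast

text \<open>Asks only for an invariant with finitely many values that refines \<open>R\<close>, so
  that types of growing rank can be collected without being canonical; \<open>findex_class\<close>
  makes the classes exact.\<close>

definition findex :: "'x set \<Rightarrow> ('x \<Rightarrow> 'x \<Rightarrow> bool) \<Rightarrow> bool" where
  "findex D R \<longleftrightarrow> (\<exists>c :: 'x \<Rightarrow> nat. finite (c ` D) \<and> (\<forall>p\<in>D. \<forall>q\<in>D. c p = c q \<longrightarrow> R p q))"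

lemma findexI:
  assumes "finite (c ` D)" "\<And>p q. p \<in> D \<Longrightarrow> q \<in> D \<Longrightarrow> c p = c q \<Longrightarrow> R p q"
  shows "findex D R"
proof -
  from ex_inj_nat[OF assms(1)] obtain g :: "_ \<Rightarrow> nat" where g: "inj_on g (c ` D)" ..
  have "finite ((g \<circ> c) ` D)" using assms(1) by (metis finite_imageI image_comp)
  moreover have "R p q" if "p \<in> D" "q \<in> D" "(g \<circ> c) p = (g \<circ> c) q" for p q
    using assms(2) that g by (simp add: inj_on_eq_iff)
  ultimately show ?thesis unfolding findex_def by blast
qed

lemma findex_class:
  assumes "findex D R" and refl: "\<And>p. p \<in> D \<Longrightarrow> R p p"
    and sym: "\<And>p q. R p q \<Longrightarrow> R q p" and trans: "\<And>p q s. R p q \<Longrightarrow> R q s \<Longrightarrow> R p s"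
  obtains cl :: "'x \<Rightarrow> nat" where "finite (cl ` D)"
    "\<And>p q. p \<in> D \<Longrightarrow> q \<in> D \<Longrightarrow> cl p = cl q \<longleftrightarrow> R p q"
proof -
  obtain c :: "'x \<Rightarrow> nat" where c: "finite (c ` D)" "\<forall>p\<in>D. \<forall>q\<in>D. c p = c q \<longrightarrow> R p q"
    using assms(1) unfolding findex_def by blast
  \<comment> \<open>For equivalent \<open>p\<close> and \<open>q\<close> the predicates
    \<open>R p\<close> and \<open>R q\<close> coincide, so the choice operator returns the same
    representative. This makes \<open>c \<circ> rep\<close> exact.\<close>
  define rep where "rep p = (SOME y. y \<in> D \<and> R p y)" for p
  have rep: "rep p \<in> D \<and> R p (rep p)" if "p \<in> D" for p
    unfolding rep_def by (rule someI[of _ p]) (use refl that in simp)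
  show thesis
  proof (rule that[of "c \<circ> rep"])
    show "finite ((c \<circ> rep) ` D)" by (rule finite_subset[OF _ c(1)]) (use rep in auto)
    fix p q assume pq: "p \<in> D" "q \<in> D"
    show "(c \<circ> rep) p = (c \<circ> rep) q \<longleftrightarrow> R p q"
    proof
      assume "(c \<circ> rep) p = (c \<circ> rep) q"
      then have "R (rep p) (rep q)" using c(2) rep pq by simp
      then show "R p q" using rep[OF pq(1)] rep[OF pq(2)] sym trans by blast
    next
      assume "R p q"
      then have "R p y \<longleftrightarrow> R q y" for y using sym trans by blast
      then show "(c \<circ> rep) p = (c \<circ> rep) q" by (simp add: rep_def)
    qed
  qed
qed

definition placed :: "nat \<Rightarrow> 'c set \<Rightarrow> (('u, 'c, 'r) str \<times> (nat \<Rightarrow> 'u option)) set" where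
  "placed k C = {(A, e). col A ` uni A \<subseteq> C \<and> (\<forall>x<k. \<forall>u. e x = Some u \<longrightarrow> u \<in> uni A)}"

text \<open>Up to \<open>piso\<close> a position is given by its atomic type: unplaced pebbles,
  colours, equalities and relations, all drawn from finite sets.\<close>

lemma findex_piso:
  assumes "finite C" "finite (UNIV :: 'r set)"
  shows "findex (placed k C) (\<lambda>(A :: ('u, 'c, 'r) str, e) (B, f). piso k A e B f)"
proof (rule findexI)
  let ?c = "\<lambda>(A :: ('u, 'c, 'r) str, e). ({x. x < k \<and> e x = None},
    {(x, c). x < k \<and> (\<exists>u. e x = Some u \<and> c = col A u)},
    {(x, y). x < k \<and> y < k \<and> (\<exists>u. e x = Some u \<and> e y = Some u)},
    {(r, x, y). x < k \<and> y < k \<and> (\<exists>u v. e x = Some u \<and> e y = Some v \<and> rel A r u v)})"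
  let ?N = "{..<k}"
  have "?c ` placed k C \<subseteq> Pow ?N \<times> Pow (?N \<times> C) \<times> Pow (?N \<times> ?N) \<times> Pow (UNIV \<times> ?N \<times> ?N)"
    by (auto simp: placed_def)
  moreover have "finite (Pow ?N \<times> Pow (?N \<times> C) \<times> Pow (?N \<times> ?N) \<times> Pow ((UNIV :: 'r set) \<times> ?N \<times> ?N))"
    using assms by simp
  ultimately show "finite (?c ` placed k C)" by (rule finite_subset)
  fix p q assume p: "p \<in> placed k C" and q: "q \<in> placed k C" and eq: "?c p = ?c q"
  obtain A e where [simp]: "p = (A, e)" by (cases p)
  obtain B f where [simp]: "q = (B, f)" by (cases q)
  have 1: "x < k \<and> e x = None \<longleftrightarrow> x < k \<and> f x = None"
    and 2: "x < k \<and> (\<exists>u. e x = Some u \<and> c = col A u) \<longleftrightarrow> x < k \<and> (\<exists>u. f x = Some u \<and> c = col B u)"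
    and 3: "x < k \<and> y < k \<and> (\<exists>u. e x = Some u \<and> e y = Some u) \<longleftrightarrow>
      x < k \<and> y < k \<and> (\<exists>u. f x = Some u \<and> f y = Some u)"
    and 4: "x < k \<and> y < k \<and> (\<exists>u v. e x = Some u \<and> e y = Some v \<and> rel A r u v) \<longleftrightarrow>
      x < k \<and> y < k \<and> (\<exists>u v. f x = Some u \<and> f y = Some v \<and> rel B r u v)" for x y c r
    using eq by (simp_all add: set_eq_iff)
  have "piso k A e B f"
  proof (rule pisoI)
    show "e x = None \<longleftrightarrow> f x = None" if "x < k" for x using 1[of x] that by simp
    show "u \<in> uni A \<and> v \<in> uni B \<and> col A u = col B v" if "x < k" "e x = Some u" "f x = Some v" for x u v
      using p q 2[of x "col A u"] that by (simp add: placed_def)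
    show "(u = u' \<longleftrightarrow> v = v') \<and> (\<forall>r. rel A r u u' \<longleftrightarrow> rel B r v v')"
      if "x < k" "y < k" "e x = Some u" "e y = Some u'" "f x = Some v" "f y = Some v'" for x y u u' v v'
      using 3[of x y] 4[of x y] that by auto
  qed
  then show "(case p of (A, e) \<Rightarrow> \<lambda>(B, f). piso k A e B f) q" by simp
qed

text \<open>As with Hintikka formulas, the type of rank \<open>Suc n\<close> consists of the type of
  rank \<open>n\<close> and of the types of rank \<open>n\<close> reached by lifting a pebble or by
  placing one. Finitely many types thus yield finitely many again.\<close>

lemma findex_ef:
  assumes "finite C" "finite (UNIV :: 'r set)"
  shows "findex (placed k C) (\<lambda>(A :: ('u, 'c, 'r) str, e) (B, f). ef k n A e B f)"
proof (induction n)
  case 0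
  show ?case using findex_piso[OF assms] by simp
next
  case (Suc n)
  then obtain c :: "('u, 'c, 'r) str \<times> _ \<Rightarrow> nat" where c1: "finite (c ` placed k C)"
    and c2: "\<forall>p\<in>placed k C. \<forall>q\<in>placed k C. c p = c q \<longrightarrow> (\<lambda>(A, e) (B, f). ef k n A e B f) p q"
    unfolding findex_def by blast
  have c: "finite (c ` placed k C)"
    "(A, e) \<in> placed k C \<Longrightarrow> (B, f) \<in> placed k C \<Longrightarrow> c (A, e) = c (B, f) \<Longrightarrow> ef k n A e B f" for A e B f
    using c1 c2 by force+
  let ?D = "placed k C :: (('u, 'c, 'r) str \<times> (nat \<Rightarrow> 'u option)) set"
  let ?c = "\<lambda>(A :: ('u, 'c, 'r) str, e). (c (A, e), {(x, y). x < k \<and> y = c (A, e(x := None))},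
     {(x, y). x < k \<and> (\<exists>u\<in>uni A. y = c (A, e(x := Some u)))})"
  have upd: "(A, e(x := None)) \<in> ?D" "u \<in> uni A \<Longrightarrow> (A, e(x := Some u)) \<in> ?D"
    if "(A, e) \<in> ?D" for A e x u
    using that by (auto simp: placed_def)
  show ?case
  proof (rule findexI)
    have "?c p \<in> c ` ?D \<times> Pow ({..<k} \<times> c ` ?D) \<times> Pow ({..<k} \<times> c ` ?D)" if "p \<in> ?D" for p
    proof -
      obtain A e where p: "p = (A, e)" by (cases p)
      have pD: "(A, e) \<in> ?D" using that p by simp
      have "{(x, y). x < k \<and> y = c (A, e(x := None))} \<subseteq> {..<k} \<times> c ` ?D"
        using upd(1)[OF pD] by auto
      moreover have "{(x, y). x < k \<and> (\<exists>u\<in>uni A. y = c (A, e(x := Some u)))} \<subseteq> {..<k} \<times> c ` ?D"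
        using upd(2)[OF pD] by auto
      ultimately show ?thesis using pD by (simp add: p)
    qed
    then have "?c ` ?D \<subseteq> c ` ?D \<times> Pow ({..<k} \<times> c ` ?D) \<times> Pow ({..<k} \<times> c ` ?D)"
      by blast
    then show "finite (?c ` ?D)" by (rule finite_subset) (simp add: c(1))
    fix p q assume p: "p \<in> ?D" and q: "q \<in> ?D" and eq: "?c p = ?c q"
    obtain A e where [simp]: "p = (A, e)" by (cases p)
    obtain B f where [simp]: "q = (B, f)" by (cases q)
    have 1: "c (A, e) = c (B, f)"
      and 2: "x < k \<and> y = c (A, e(x := None)) \<longleftrightarrow> x < k \<and> y = c (B, f(x := None))"
      and 3: "x < k \<and> (\<exists>u\<in>uni A. y = c (A, e(x := Some u))) \<longleftrightarrow>
        x < k \<and> (\<exists>u\<in>uni B. y = c (B, f(x := Some u)))" for x y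
      using eq by (simp_all add: set_eq_iff)
    have pq: "(A, e) \<in> ?D" "(B, f) \<in> ?D" using p q by simp_all
    have "ef k (Suc n) A e B f"
    proof (rule ef_SucI)
      show "ef k n A e B f" by (rule c(2)[OF pq 1])
      fix x assume x: "x < k"
      show "ef k n A (e(x := None)) B (f(x := None))"
        using 2[of x "c (A, e(x := None))"] x by (intro c(2) upd pq) simp
      show "\<exists>v\<in>uni B. ef k n A (e(x := Some u)) B (f(x := Some v))" if "u \<in> uni A" for u
      proof -
        have "\<exists>v\<in>uni B. c (A, e(x := Some u)) = c (B, f(x := Some v))"
          using 3[of x "c (A, e(x := Some u))"] x that by auto
        then obtain v where v: "v \<in> uni B" "c (A, e(x := Some u)) = c (B, f(x := Some v))" by fast
        then show ?thesis using c(2)[OF upd(2)[OF pq(1) that] upd(2)[OF pq(2) v(1)] v(2)] by fast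
      qed
      show "\<exists>u\<in>uni A. ef k n A (e(x := Some u)) B (f(x := Some v))" if "v \<in> uni B" for v
      proof -
        have "\<exists>u\<in>uni A. c (B, f(x := Some v)) = c (A, e(x := Some u))"
          using 3[of x "c (B, f(x := Some v))"] x that by auto
        then obtain u where u: "u \<in> uni A" "c (B, f(x := Some v)) = c (A, e(x := Some u))" by fast
        then show ?thesis using c(2)[OF upd(2)[OF pq(1) u(1)] upd(2)[OF pq(2) that] u(2)[symmetric]] by fast
      qed
    qed
    then show "(case p of (A, e) \<Rightarrow> \<lambda>(B, f). ef k (Suc n) A e B f) q" by simp
  qed
qed

text \<open>Classes are named by natural numbers because \<open>regular\<close> and
  \<open>weak_odta_recognizable\<close> ask for states of type \<open>nat\<close>.\<close>

lemma ex_efc_class: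
  assumes "finite C" "finite (UNIV :: 'r set)"
  shows "\<exists>cl :: ('u, 'c, 'r) str \<Rightarrow> nat. finite (cl ` {A. col A ` uni A \<subseteq> C}) \<and>
    (\<forall>A B. col A ` uni A \<subseteq> C \<longrightarrow> col B ` uni B \<subseteq> C \<longrightarrow> (cl A = cl B \<longleftrightarrow> efc k n A B))"
proof -
  let ?R = "\<lambda>(A :: ('u, 'c, 'r) str, e) (B, f). ef k n A e B f"
  obtain cl :: "('u, 'c, 'r) str \<times> (nat \<Rightarrow> 'u option) \<Rightarrow> nat" where cl: "finite (cl ` placed k C)"
    "\<And>p q. p \<in> placed k C \<Longrightarrow> q \<in> placed k C \<Longrightarrow> cl p = cl q \<longleftrightarrow> ?R p q"
  proof (rule findex_class[OF findex_ef[OF assms]])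
    show "?R p p" if "p \<in> placed k C" for p
      using that by (auto simp: placed_def intro: ef_refl)
    show "?R q p" if "?R p q" for p q using that by (auto intro: ef_sym)
    show "?R p s" if "?R p q" "?R q s" for p q s using that by (auto intro: ef_trans)
  qed (rule that)
  have pl: "(A, \<lambda>_. None) \<in> placed k C" if "col A ` uni A \<subseteq> C" for A :: "('u, 'c, 'r) str"
    using that by (simp add: placed_def)
  show ?thesis
  proof (rule exI[of _ "\<lambda>A. cl (A, \<lambda>_. None)"], intro conjI allI impI)
    show "finite ((\<lambda>A. cl (A, \<lambda>_. None)) ` {A. col A ` uni A \<subseteq> C})"
      by (rule finite_subset[OF _ cl(1)]) (use pl in auto)
    show "cl (A, \<lambda>_. None) = cl (B, \<lambda>_. None) \<longleftrightarrow> efc k n A B"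
      if "col A ` uni A \<subseteq> C" "col B ` uni B \<subseteq> C" for A B
      using cl(2)[OF pl[OF that(1)] pl[OF that(2)]] by simp
  qed
qed

text \<open>A colour consists of a letter, the indices of the set variables that contain the
  element, and flags of type \<open>'z\<close> that no formula sees.\<close>

primrec sat :: "('u, ('a \<times> nat set) \<times> 'z, 'r) str \<Rightarrow> (nat \<Rightarrow> 'u) \<Rightarrow> ('a, 'r) fo \<Rightarrow> bool" where
  "sat A e (Eq x y) = (e x = e y)"
| "sat A e (Lab a x) = (fst (fst (col A (e x))) = a)"
| "sat A e (Mem i x) = (i \<in> snd (fst (col A (e x))))"
| "sat A e (Rel r x y) = rel A r (e x) (e y)"
| "sat A e (Neg \<phi>) = (\<not> sat A e \<phi>)"
| "sat A e (Conj \<phi> \<psi>) = (sat A e \<phi> \<and> sat A e \<psi>)"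
| "sat A e (Disj \<phi> \<psi>) = (sat A e \<phi> \<or> sat A e \<psi>)"
| "sat A e (Ex x \<phi>) = (\<exists>u\<in>uni A. sat A (e(x := u)) \<phi>)"
| "sat A e (All x \<phi>) = (\<forall>u\<in>uni A. sat A (e(x := u)) \<phi>)"

primrec qr :: "('a, 'r) fo \<Rightarrow> nat" where
  "qr (Eq x y) = 0"
| "qr (Lab a x) = 0"
| "qr (Mem i x) = 0"
| "qr (Rel r x y) = 0"
| "qr (Neg \<phi>) = qr \<phi>"
| "qr (Conj \<phi> \<psi>) = max (qr \<phi>) (qr \<psi>)"
| "qr (Disj \<phi> \<psi>) = max (qr \<phi>) (qr \<psi>)"
| "qr (Ex x \<phi>) = Suc (qr \<phi>)"
| "qr (All x \<phi>) = Suc (qr \<phi>)"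

section \<open>Formulas are preserved by the game\<close>

lemma finite_vars: "finite (vars \<phi>)"
  by (induction \<phi>) simp_all

lemma holds_eq_sat:
  assumes "uni A = nodes t" "\<forall>r. \<forall>u\<in>nodes t. \<forall>v\<in>nodes t. rel A r u v \<longleftrightarrow> I r u v"
    and "\<forall>u\<in>nodes t. fst (fst (col A u)) = lab t u"
    and "\<forall>u\<in>nodes t. \<forall>i\<in>set_vars \<phi>. i \<in> snd (fst (col A u)) \<longleftrightarrow> u \<in> X i"
    and "\<forall>x. e x \<in> nodes t"
  shows "holds I t X e \<phi> \<longleftrightarrow> sat A e \<phi>"
  using assms(4,5) by (induction \<phi> arbitrary: e) (simp_all add: assms(1-3))

text \<open>Each quantifier spends one round. Bound variables need a pebble, hence the bound on
  \<open>vars\<close>, but only free variables have to be placed at the start, so sentences begin on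
  the empty board.\<close>

lemma ef_sat:
  assumes "ef k n A a B b" "qr \<phi> \<le> n" "vars \<phi> \<subseteq> {..<k}"
    "\<forall>x\<in>free_vars \<phi>. x < k \<and> a x = Some (e x) \<and> b x = Some (f x)"
  shows "sat A e \<phi> \<longleftrightarrow> sat B f \<phi>"
  using assms
proof (induction \<phi> arbitrary: n a b e f)
  case (Eq x y)
  then show ?case using piso_rel(1)[OF ef_piso[OF Eq(1)], of x y] by simp
next
  case (Lab l x)
  then have x: "x < k" "a x = Some (e x)" "b x = Some (f x)" by simp_all
  show ?case by (rule piso_SomeE[OF ef_piso[OF Lab(1)] x(1,2)]) (use x in simp)
next
  case (Mem i x)
  then have x: "x < k" "a x = Some (e x)" "b x = Some (f x)" by simp_all
  show ?case by (rule piso_SomeE[OF ef_piso[OF Mem(1)] x(1,2)]) (use x in simp)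
next
  case (Rel r x y)
  then show ?case using piso_rel(2)[OF ef_piso[OF Rel(1)], of x y _ _ _ _ r] by simp
next
  case (Neg \<phi>)
  show ?case using Neg.IH[OF Neg.prems(1), of e f] Neg.prems(2-) by simp
next
  case (Conj \<phi> \<psi>)
  show ?case using Conj.IH(1)[OF Conj.prems(1), of e f] Conj.IH(2)[OF Conj.prems(1), of e f] Conj.prems(2-) by simp
next
  case (Disj \<phi> \<psi>)
  show ?case using Disj.IH(1)[OF Disj.prems(1), of e f] Disj.IH(2)[OF Disj.prems(1), of e f] Disj.prems(2-) by simp
next
  case (Ex x \<phi>)
  then obtain m where n: "n = Suc m" "qr \<phi> \<le> m" and x: "x < k" by (cases n) simp_all
  have IH: "sat A (e(x := u)) \<phi> \<longleftrightarrow> sat B (f(x := v)) \<phi>"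
    if "ef k m A (a(x := Some u)) B (b(x := Some v))" for u v
    using that n(2) by (rule Ex.IH) (use Ex.prems(3,4) in simp_all)
  note E = Ex.prems(1)[unfolded n(1)]
  have fwd: "\<exists>v\<in>uni B. sat A (e(x := u)) \<phi> \<longleftrightarrow> sat B (f(x := v)) \<phi>" if "u \<in> uni A" for u
    by (rule ef_forth[OF E x that]) (use IH in blast)
  have bwd: "\<exists>u\<in>uni A. sat A (e(x := u)) \<phi> \<longleftrightarrow> sat B (f(x := v)) \<phi>" if "v \<in> uni B" for v
    by (rule ef_back[OF E x that]) (use IH in blast)
  show ?case using fwd bwd unfolding sat.simps by blast
next
  case (All x \<phi>)
  then obtain m where n: "n = Suc m" "qr \<phi> \<le> m" and x: "x < k" by (cases n) simp_all
  have IH: "sat A (e(x := u)) \<phi> \<longleftrightarrow> sat B (f(x := v)) \<phi>"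
    if "ef k m A (a(x := Some u)) B (b(x := Some v))" for u v
    using that n(2) by (rule All.IH) (use All.prems(3,4) in simp_all)
  note E = All.prems(1)[unfolded n(1)]
  have fwd: "\<exists>v\<in>uni B. sat A (e(x := u)) \<phi> \<longleftrightarrow> sat B (f(x := v)) \<phi>" if "u \<in> uni A" for u
    by (rule ef_forth[OF E x that]) (use IH in blast)
  have bwd: "\<exists>u\<in>uni A. sat A (e(x := u)) \<phi> \<longleftrightarrow> sat B (f(x := v)) \<phi>" if "v \<in> uni B" for v
    by (rule ef_back[OF E x that]) (use IH in blast)
  show ?case using fwd bwd unfolding sat.simps by blast
qed

lemma efc_sat:
  assumes "efc k n A B" "qr \<phi> \<le> n" "vars \<phi> \<subseteq> {..<k}" "free_vars \<phi> = {}"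
  shows "sat A e \<phi> \<longleftrightarrow> sat B f \<phi>"
  using assms(1-3) by (rule ef_sat) (simp add: assms(4))

subsection \<open>Threshold counting and quotient automata\<close>

text \<open>Fewer than \<open>k\<close> elements are occupied by the other pebbles, so a class with at least \<open>k\<close>
  elements always offers a free one.\<close>

lemma threshold_forth:
  fixes A :: "('u, 'c, 'r) str" and B :: "('v, 'c, 'r) str"
  assumes iso: "piso k A e B f"
    and rel: "\<And>r u v. rel A r u v" "\<And>r u v. rel B r u v"
    and fin: "finite (uni A)" "finite (uni B)"
    and count: "\<And>c. card {u\<in>uni A. col A u = c} = card {v\<in>uni B. col B v = c} \<or>
      k \<le> card {v\<in>uni B. col B v = c}"
    and x: "x < k" and u: "u \<in> uni A"
  shows "\<exists>v\<in>uni B. piso k A (e(x := Some u)) B (f(x := Some v))"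
proof -
  let ?Q = "\<lambda>w. {v. \<exists>y<k. y \<noteq> x \<and> e y = Some w \<and> f y = Some v}"
  have "\<exists>v\<in>uni B. col B v = col A u \<and> (\<forall>y<k. y \<noteq> x \<longrightarrow> (e y = Some u \<longleftrightarrow> f y = Some v))"
  proof (cases "\<exists>y<k. y \<noteq> x \<and> e y = Some u")
    \<comment> \<open>If \<open>u\<close> already carries another pebble, the reply is forced: it is
      the partner under that pebble.\<close>
    case True
    then obtain y where y: "y < k" "y \<noteq> x" "e y = Some u" by blast
    obtain v where v: "f y = Some v" "v \<in> uni B" "col A u = col B v" by (rule piso_SomeE[OF iso y(1,3)])
    have "e z = Some u \<longleftrightarrow> f z = Some v" if zk: "z < k" for z
    proof
      assume z: "e z = Some u"
      obtain w where w: "f z = Some w" by (rule piso_SomeE[OF iso zk z])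
      show "f z = Some v" using w piso_rel(1)[OF iso zk y(1) z y(3) w v(1)] by simp
    next
      assume z: "f z = Some v"
      obtain w where w: "e z = Some w" by (rule piso_SomeE[OF piso_sym[OF iso] zk z])
      show "e z = Some u" using w piso_rel(1)[OF iso zk y(1) w y(3) z v(1)] by simp
    qed
    then show ?thesis using v by metis
  next
    case False
    let ?c = "col A u"
    \<comment> \<open>Only other pebbles on elements coloured like \<open>u\<close> can block a
      reply: \<open>?P\<close> are the blocked elements of \<open>B\<close>, \<open>?R\<close> their
      partners in \<open>A\<close>.\<close>
    let ?Y = "{y. y < k \<and> y \<noteq> x \<and> (\<exists>w. e y = Some w \<and> col A w = ?c)}"
    let ?P = "(\<lambda>y. the (f y)) ` ?Y"
    let ?R = "(\<lambda>y. the (e y)) ` ?Y"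
    have Y: "?Y \<subseteq> {..<k} - {x}" by blast
    have finY: "finite ?Y" by (rule finite_subset[OF Y]) simp
    have R: "?R \<subseteq> {w\<in>uni A. col A w = ?c} - {u}"
    proof (rule image_subsetI)
      fix y assume "y \<in> ?Y"
      then obtain w where w: "y < k" "y \<noteq> x" "e y = Some w" "col A w = ?c" by blast
      have "w \<in> uni A" by (rule piso_SomeE[OF iso w(1,3)])
      moreover have "w \<noteq> u" using False w by blast
      ultimately show "the (e y) \<in> {w\<in>uni A. col A w = ?c} - {u}" using w by simp
    qed
    \<comment> \<open>Pebbles on equal elements of \<open>A\<close> lie on equal elements of
      \<open>B\<close>, so a function \<open>h\<close> on \<open>?R\<close> covers
      \<open>?P\<close>. Since \<open>u\<close> is not in \<open>?R\<close>, the class of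
      \<open>u\<close> is strictly larger.\<close>
    have "card ?P \<le> card ?R"
    proof -
      define h where "h w = the (f (SOME y. y \<in> ?Y \<and> the (e y) = w))" for w
      have "the (f y) = h (the (e y))" if y: "y \<in> ?Y" for y
      proof -
        let ?z = "SOME z. z \<in> ?Y \<and> the (e z) = the (e y)"
        have z: "?z \<in> ?Y \<and> the (e ?z) = the (e y)" by (rule someI[of _ y]) (use y in simp)
        then obtain w where w: "?z < k" "e ?z = Some w" by blast
        have yw: "y < k" "e y = Some w" using y z w by auto
        obtain v where v: "f y = Some v" by (rule piso_SomeE[OF iso yw])
        obtain v' where v': "f ?z = Some v'" by (rule piso_SomeE[OF iso w])
        have "f ?z = f y" using piso_rel(1)[OF iso w(1) yw(1) w(2) yw(2) v' v] v v' by simp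
        then show ?thesis unfolding h_def by simp
      qed
      then have "?P \<subseteq> h ` ?R" by blast
      then have "card ?P \<le> card (h ` ?R)" using finY by (intro card_mono) simp_all
      also have "\<dots> \<le> card ?R" using finY by (intro card_image_le) simp
      finally show ?thesis .
    qed
    also have "\<dots> < card {w\<in>uni A. col A w = ?c}"
    proof (rule psubset_card_mono)
      show "?R \<subset> {w\<in>uni A. col A w = ?c}" using R u by blast
    qed (use fin in simp)
    finally have "card ?P < card {w\<in>uni A. col A w = ?c}" .
    moreover have "card ?P < k"
    proof -
      have "card ?P \<le> card ?Y" by (rule card_image_le[OF finY])
      also have "\<dots> \<le> card ({..<k} - {x})" by (rule card_mono[OF _ Y]) simp
      also have "\<dots> < k" using x by simp
      finally show ?thesis .
    qed
    \<comment> \<open>\<open>card ?P\<close> is below the size of the class in \<open>A\<close>,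
      which settles equal sizes, and below \<open>k\<close>, which settles large classes.\<close>
    ultimately have "card ?P < card {v\<in>uni B. col B v = ?c}" using count[of ?c] by linarith
    then have "\<not> {v\<in>uni B. col B v = ?c} \<subseteq> ?P" using card_mono[of ?P] finY by (meson finite_imageI not_less)
    then obtain v where v: "v \<in> uni B" "col B v = ?c" "v \<notin> ?P" by blast
    have "f y \<noteq> Some v" if y: "y < k" "y \<noteq> x" for y
    proof
      assume f: "f y = Some v"
      obtain w where w: "e y = Some w" "col B v = col A w" by (rule piso_SomeE[OF piso_sym[OF iso] y(1) f])
      then have "y \<in> ?Y" using y v(2) by simp
      then have "the (f y) \<in> ?P" by blast
      then show False using f v(3) by simp
    qed
    then show ?thesis using v False by blast
  qed
  then obtain v where v: "v \<in> uni B" "col B v = col A u"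
    "\<And>y. y < k \<Longrightarrow> y \<noteq> x \<Longrightarrow> e y = Some u \<longleftrightarrow> f y = Some v" by blast
  have "piso k A (e(x := Some u)) B (f(x := Some v))"
  proof (rule pisoI)
    show "(e(x := Some u)) y = None \<longleftrightarrow> (f(x := Some v)) y = None" if "y < k" for y
      using piso_None[OF iso that] by simp
    show "p \<in> uni A \<and> q \<in> uni B \<and> col A p = col B q"
      if "y < k" "(e(x := Some u)) y = Some p" "(f(x := Some v)) y = Some q" for y p q
    proof (cases "y = x")
      case False
      then have "e y = Some p" "f y = Some q" using that by simp_all
      then show ?thesis by (rule piso_Some[OF iso that(1)])
    qed (use that u v in simp)
    show "(p = p' \<longleftrightarrow> q = q') \<and> (\<forall>r. rel A r p p' \<longleftrightarrow> rel B r q q')"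
      if yz: "y < k" "z < k" "(e(x := Some u)) y = Some p" "(e(x := Some u)) z = Some p'"
        "(f(x := Some v)) y = Some q" "(f(x := Some v)) z = Some q'" for y z p p' q q'
    proof -
      have "p = p' \<longleftrightarrow> q = q'"
      proof (cases "y = x"; cases "z = x")
        assume "y \<noteq> x" "z \<noteq> x"
        then show ?thesis using yz piso_rel(1)[OF iso yz(1,2)] by simp
      next
        assume "y = x" "z \<noteq> x"
        then show ?thesis using yz v(3)[of z] by auto
      next
        assume "y \<noteq> x" "z = x"
        then show ?thesis using yz v(3)[of y] by auto
      qed (use yz in simp)
      then show ?thesis using rel by simp
    qed
  qed
  then show ?thesis using v(1) by blast
qed

text \<open>\<open>A0\<close> and \<open>B0\<close> are bare sets coloured by \<alpha> and \<beta>,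
  with relations that always hold. These colours determine the original colours and relations, so a
  reply need only match them and equality. By counting, such a reply exists in every position, hence
  the arbitrary number of rounds.\<close>

lemma threshold_ef:
  fixes A :: "('u, 'c, 'r) str" and B :: "('v, 'c, 'r) str" and \<alpha> :: "'u \<Rightarrow> 'x" and \<beta> :: "'v \<Rightarrow> 'x"
  defines "A0 \<equiv> \<lparr>uni = uni A, col = \<alpha>, rel = (\<lambda>(_ :: 'r) _ _. True)\<rparr>"
    and "B0 \<equiv> \<lparr>uni = uni B, col = \<beta>, rel = (\<lambda>(_ :: 'r) _ _. True)\<rparr>"
  assumes fin: "finite (uni A)" "finite (uni B)"
    and count: "\<And>c. card {u\<in>uni A. \<alpha> u = c} = card {v\<in>uni B. \<beta> v = c} \<or>
      (k \<le> card {u\<in>uni A. \<alpha> u = c} \<and> k \<le> card {v\<in>uni B. \<beta> v = c})"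
    and col: "\<And>u v. u \<in> uni A \<Longrightarrow> v \<in> uni B \<Longrightarrow> \<alpha> u = \<beta> v \<Longrightarrow> col A u = col B v"
    and rel: "\<And>r u u' v v'. u \<in> uni A \<Longrightarrow> v \<in> uni B \<Longrightarrow> \<alpha> u = \<beta> v \<Longrightarrow>
      u' \<in> uni A \<Longrightarrow> v' \<in> uni B \<Longrightarrow> \<alpha> u' = \<beta> v' \<Longrightarrow> rel A r u u' \<longleftrightarrow> rel B r v v'"
  shows "piso k A0 e B0 f \<Longrightarrow> ef k n A e B f"
proof (induction n arbitrary: e f)
  case 0
  have "piso k A e B f"
  proof (rule pisoI)
    show "e x = None \<longleftrightarrow> f x = None" if "x < k" for x using piso_None[OF 0 that] .
    have *: "u \<in> uni A \<and> v \<in> uni B \<and> \<alpha> u = \<beta> v" if "x < k" "e x = Some u" "f x = Some v" for x u v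
      by (rule piso_SomeE[OF 0 that(1,2)]) (use that in \<open>simp add: A0_def B0_def\<close>)
    show "u \<in> uni A \<and> v \<in> uni B \<and> col A u = col B v" if "x < k" "e x = Some u" "f x = Some v" for x u v
      using *[OF that] col by blast
    show "(u = u' \<longleftrightarrow> v = v') \<and> (\<forall>r. rel A r u u' \<longleftrightarrow> rel B r v v')"
      if "x < k" "y < k" "e x = Some u" "e y = Some u'" "f x = Some v" "f y = Some v'" for x y u u' v v'
      using piso_rel(1)[OF 0 that] *[OF that(1,3,5)] *[OF that(2,4,6)] rel[of u v u' v'] by simp
  qed
  then show ?case by simp
next
  case (Suc n)
  show ?case
  proof (rule ef_SucI)
    show "ef k n A e B f" by (rule Suc.IH[OF Suc.prems])
  next
    fix x assume x: "x < k"
    show "ef k n A (e(x := None)) B (f(x := None))"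
    proof (rule Suc.IH, rule pisoI)
      show "(e(x := None)) y = None \<longleftrightarrow> (f(x := None)) y = None" if "y < k" for y
        using piso_None[OF Suc.prems that] by simp
      show "u \<in> uni A0 \<and> v \<in> uni B0 \<and> str.col A0 u = str.col B0 v"
        if "y < k" "(e(x := None)) y = Some u" "(f(x := None)) y = Some v" for y u v
      proof -
        have "e y = Some u" "f y = Some v" using that by (simp_all split: if_splits)
        then show ?thesis by (rule piso_Some[OF Suc.prems that(1)])
      qed
      show "(u = u' \<longleftrightarrow> v = v') \<and> (\<forall>r. str.rel A0 r u u' \<longleftrightarrow> str.rel B0 r v v')"
        if "y < k" "z < k" "(e(x := None)) y = Some u" "(e(x := None)) z = Some u'"
          "(f(x := None)) y = Some v" "(f(x := None)) z = Some v'" for y z u u' v v'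
        using that piso_rel[OF Suc.prems that(1,2)] by (simp split: if_splits)
    qed
    show "\<exists>v\<in>uni B. ef k n A (e(x := Some u)) B (f(x := Some v))" if "u \<in> uni A" for u
    proof -
      have "\<exists>v\<in>uni B0. piso k A0 (e(x := Some u)) B0 (f(x := Some v))"
        by (rule threshold_forth[OF Suc.prems]) (use fin count x that in \<open>auto simp: A0_def B0_def\<close>)
      then show ?thesis using Suc.IH by (auto simp: B0_def)
    qed
    show "\<exists>u\<in>uni A. ef k n A (e(x := Some u)) B (f(x := Some v))" if "v \<in> uni B" for v
    proof -
      have count': "card {v\<in>uni B. \<beta> v = c} = card {u\<in>uni A. \<alpha> u = c} \<or> k \<le> card {u\<in>uni A. \<alpha> u = c}" for c
        using count[of c] by linarith
      have "\<exists>u\<in>uni A0. piso k B0 (f(x := Some v)) A0 (e(x := Some u))"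
        by (rule threshold_forth[OF piso_sym[OF Suc.prems]])
          (use fin count' x that in \<open>simp_all add: A0_def B0_def\<close>)
      then show ?thesis using Suc.IH piso_sym by (force simp: A0_def)
    qed
  qed
qed

lemma threshold_efc:
  fixes A :: "('u, 'c, 'r) str" and B :: "('v, 'c, 'r) str" and \<alpha> :: "'u \<Rightarrow> 'x" and \<beta> :: "'v \<Rightarrow> 'x"
  assumes "finite (uni A)" "finite (uni B)"
    and "\<And>c. card {u\<in>uni A. \<alpha> u = c} = card {v\<in>uni B. \<beta> v = c} \<or>
      (k \<le> card {u\<in>uni A. \<alpha> u = c} \<and> k \<le> card {v\<in>uni B. \<beta> v = c})"
    and "\<And>u v. u \<in> uni A \<Longrightarrow> v \<in> uni B \<Longrightarrow> \<alpha> u = \<beta> v \<Longrightarrow> col A u = col B v"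
    and "\<And>r u u' v v'. u \<in> uni A \<Longrightarrow> v \<in> uni B \<Longrightarrow> \<alpha> u = \<beta> v \<Longrightarrow>
      u' \<in> uni A \<Longrightarrow> v' \<in> uni B \<Longrightarrow> \<alpha> u' = \<beta> v' \<Longrightarrow> rel A r u u' \<longleftrightarrow> rel B r v v'"
  shows "efc k n A B"
  by (rule threshold_ef[where \<alpha> = \<alpha> and \<beta> = \<beta>, OF assms]) (auto intro: pisoI)

text \<open>States are the classes of the congruence, and transitions are the realised triples.\<close>

lemma quotient_nfa:
  fixes f :: "'y list \<Rightarrow> nat" and g :: "'y \<Rightarrow> 'x"
  assumes fin: "finite (f ` lists D)" and X: "g ` D \<subseteq> X"
    and cong: "\<And>ys ys' y y'. ys \<in> lists D \<Longrightarrow> ys' \<in> lists D \<Longrightarrow> y \<in> D \<Longrightarrow> y' \<in> D \<Longrightarrow>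
      f ys = f ys' \<Longrightarrow> g y = g y' \<Longrightarrow> f (ys @ [y]) = f (ys' @ [y'])"
    and P: "\<And>ys ys'. ys \<in> lists D \<Longrightarrow> ys' \<in> lists D \<Longrightarrow> f ys = f ys' \<Longrightarrow> P ys \<Longrightarrow> P ys'"
  shows "\<exists>M :: (nat, 'x) nfa. nfa_over X M \<and> (\<forall>w. nfa_accepts M w \<longleftrightarrow> (\<exists>ys\<in>lists D. w = map g ys \<and> P ys))"
proof -
  define M where "M = \<lparr>nfa_states = f ` lists D, nfa_init = {f []}, nfa_final = f ` {ys\<in>lists D. P ys},
    nfa_trans = {(f ys, g y, f (ys @ [y])) | ys y. ys \<in> lists D \<and> y \<in> D}\<rparr>"
  have "nfa_over X M"
    unfolding nfa_over_def M_def using fin X by (auto intro!: imageI)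
  moreover have "nfa_accepts M w \<longleftrightarrow> (\<exists>ys\<in>lists D. w = map g ys \<and> P ys)" for w
  proof
    assume "nfa_accepts M w"
    then obtain r where r: "r 0 = f []" "r (length w) \<in> f ` {ys\<in>lists D. P ys}"
      and step: "\<And>i. i < length w \<Longrightarrow> \<exists>ys y. r i = f ys \<and> w ! i = g y \<and> r (Suc i) = f (ys @ [y]) \<and> ys \<in> lists D \<and> y \<in> D"
      unfolding nfa_accepts_def M_def by auto
    \<comment> \<open>Invariant: the state after \<open>i\<close> letters is the class of some
      preimage of that prefix. The preimage need not be the one that witnesses the next transition;
      \<open>cong\<close> carries the step over.\<close>
    have "i \<le> length w \<Longrightarrow> \<exists>ys\<in>lists D. take i w = map g ys \<and> r i = f ys" for i
    proof (induction i)
      case 0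
      then show ?case using r(1) by simp
    next
      case (Suc i)
      then obtain ys where ys: "ys \<in> lists D" "take i w = map g ys" "r i = f ys" by auto
      obtain zs y where zs: "r i = f zs" "w ! i = g y" "r (Suc i) = f (zs @ [y])" "zs \<in> lists D" "y \<in> D"
        using step[of i] Suc.prems by auto
      have "f (ys @ [y]) = f (zs @ [y])" using ys zs by (intro cong) simp_all
      moreover have "take (Suc i) w = map g (ys @ [y])"
        using ys zs Suc.prems by (simp add: take_Suc_conv_app_nth)
      ultimately show ?case using ys zs by (intro bexI[of _ "ys @ [y]"]) simp_all
    qed
    from this[of "length w"] obtain ys where ys: "ys \<in> lists D" "w = map g ys" "r (length w) = f ys"
      by (auto simp del: map_eq_conv in_lists_conv_set simp flip: length_map)
    then obtain zs where "zs \<in> lists D" "P zs" "f zs = f ys" using r(2) by force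
    then have "P ys" using P ys by blast
    then show "\<exists>ys\<in>lists D. w = map g ys \<and> P ys" using ys by blast
  next
    assume "\<exists>ys\<in>lists D. w = map g ys \<and> P ys"
    then obtain ys where ys: "ys \<in> lists D" "w = map g ys" "P ys" by blast
    have "(f (take i ys), w ! i, f (take (Suc i) ys)) \<in> nfa_trans M" if "i < length w" for i
    proof -
      have "take (Suc i) ys = take i ys @ [ys ! i]" using that ys by (simp add: take_Suc_conv_app_nth)
      moreover have "take i ys \<in> lists D" "ys ! i \<in> D"
        using ys that by (auto dest: in_set_takeD)
      ultimately show ?thesis using that ys by (auto simp: M_def)
    qed
    then show "nfa_accepts M w"
      unfolding nfa_accepts_def using ys
      by (intro exI[of _ "\<lambda>i. f (take i ys)"]) (auto simp: M_def)
  qed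
  ultimately show ?thesis by blast
qed

subsection \<open>A transducer for tree formulas\<close>

lemma finite_UNIV_tree_rel: "finite (UNIV :: tree_rel set)"
proof -
  have "(UNIV :: tree_rel set) \<subseteq> {Child, Next_Sibling}" using tree_rel.exhaust by blast
  then show ?thesis by (rule finite_subset) simp
qed

definition trees_over :: "'l set \<Rightarrow> 'l utree set" where
  "trees_over \<Lambda> = {t. \<forall>u\<in>nodes t. label_at t u \<in> \<Lambda>}"

lemma root_in: "t \<in> trees_over \<Lambda> \<Longrightarrow> root t \<in> \<Lambda>"
  unfolding trees_over_def by (metis (mono_tags) Nil_in_nodes label_at_Nil mem_Collect_eq)

lemma subtree_trees_over: "t \<in> trees_over \<Lambda> \<Longrightarrow> u \<in> nodes t \<Longrightarrow> subtree t u \<in> trees_over \<Lambda>"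
  unfolding trees_over_def by (simp add: label_at_append[symmetric]) (simp add: append_in_nodes)

lemma Node_trees_over: "l \<in> \<Lambda> \<Longrightarrow> ts \<in> lists (trees_over \<Lambda>) \<Longrightarrow> Node l ts \<in> trees_over \<Lambda>"
proof -
  assume "l \<in> \<Lambda>" and ts: "ts \<in> lists (trees_over \<Lambda>)"
  have "label_at (Node l ts) u \<in> \<Lambda>" if "u \<in> nodes (Node l ts)" for u
  proof (cases u)
    case Nil
    then show ?thesis using \<open>l \<in> \<Lambda>\<close> by simp
  next
    case (Cons i p)
    then have "ts ! i \<in> trees_over \<Lambda>" "p \<in> nodes (ts ! i)" using that ts by auto
    then show ?thesis using Cons by (simp add: trees_over_def)
  qed
  then show ?thesis by (simp add: trees_over_def)
qed

lemma children_trees_over: "t \<in> trees_over \<Lambda> \<Longrightarrow> children t \<in> lists (trees_over \<Lambda>)"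
proof -
  assume t: "t \<in> trees_over \<Lambda>"
  have "children t ! i \<in> trees_over \<Lambda>" if "i < length (children t)" for i
    using subtree_trees_over[OF t, of "[i]"] that by simp
  then show ?thesis by (auto simp: in_set_conv_nth)
qed

text \<open>The flags of a colour mark the roots and the last root of a hedge.\<close>

definition tree_str :: "'l utree \<Rightarrow> (pos, 'l \<times> bool \<times> bool, tree_rel) str" where
  "tree_str t = \<lparr>uni = nodes t, col = (\<lambda>u. (label_at t u, u = [], False)), rel = tree_interp\<rparr>"

text \<open>A dummy root provides the addresses \<open>i # p\<close> and is then removed. For the
  empty hedge the value of \<open>length ts - 1\<close> is immaterial, the universe being
  empty.\<close>

definition hedge_str :: "'l utree list \<Rightarrow> (pos, 'l \<times> bool \<times> bool, tree_rel) str" where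
  "hedge_str ts = \<lparr>uni = nodes (Node undefined ts) - {[]},
     col = (\<lambda>u. (label_at (Node undefined ts) u, length u = 1, u = [length ts - 1])), rel = tree_interp\<rparr>"

section \<open>Hedges and trees as glued structures\<close>

lemma tree_interp_Cons: "tree_interp r (i # u) (i # v) \<longleftrightarrow> tree_interp r u v"
proof (cases r)
  case Next_Sibling
  have "(\<exists>w j. i # u = w @ [j] \<and> i # v = w @ [Suc j]) \<longleftrightarrow> (\<exists>w j. u = w @ [j] \<and> v = w @ [Suc j])"
  proof
    assume "\<exists>w j. i # u = w @ [j] \<and> i # v = w @ [Suc j]"
    then obtain w j where w: "i # u = w @ [j]" "i # v = w @ [Suc j]" by blast
    then show "\<exists>w j. u = w @ [j] \<and> v = w @ [Suc j]" by (cases w) auto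
  next
    assume "\<exists>w j. u = w @ [j] \<and> v = w @ [Suc j]"
    then show "\<exists>w j. i # u = w @ [j] \<and> i # v = w @ [Suc j]" by (metis append_Cons)
  qed
  then show ?thesis by (simp add: Next_Sibling)
qed simp

lemma tree_interp_neq:
  assumes "i \<noteq> j"
  shows "tree_interp r (i # u) (j # v) \<longleftrightarrow> r = Next_Sibling \<and> u = [] \<and> v = [] \<and> j = Suc i"
proof (cases r)
  case Next_Sibling
  have "(\<exists>w k. i # u = w @ [k] \<and> j # v = w @ [Suc k]) \<longleftrightarrow> u = [] \<and> v = [] \<and> j = Suc i"
  proof
    assume "\<exists>w k. i # u = w @ [k] \<and> j # v = w @ [Suc k]"
    then obtain w k where w: "i # u = w @ [k]" "j # v = w @ [Suc k]" by blast
    then show "u = [] \<and> v = [] \<and> j = Suc i" using assms by (cases w) auto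
  qed auto
  then show ?thesis by (simp add: Next_Sibling)
qed (use assms in simp)

text \<open>Different trees of a hedge are related only by next sibling between adjacent roots, so
  the flags decide everything across the border. Appending \<open>t\<close> clears the old mark of
  the last root and copies the root flag of \<open>t\<close> into it.\<close>

lemma glued_hedge:
  "glued (\<lambda>(l, a, b). (l, a, False)) (\<lambda>(l, a, b). (l, a, a))
     (\<lambda>r c d. r = Next_Sibling \<and> snd (snd c) \<and> fst (snd d)) (\<lambda>_ _ _. False)
     (hedge_str ts) id (tree_str t) ((#) (length ts)) (hedge_str (ts @ [t]))"
proof -
  let ?N = "\<lambda>ts. nodes (Node undefined ts) - {[]}"
  have N: "u \<in> ?N ss \<longleftrightarrow> (\<exists>i p. u = i # p \<and> i < length ss \<and> p \<in> nodes (ss ! i))" for u and ss :: "'a utree list"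
    by (cases u) auto
  have 1: "?N (ts @ [t]) = id ` ?N ts \<union> (#) (length ts) ` nodes t" (is "?L = ?R")
  proof (rule set_eqI)
    fix u show "u \<in> ?L \<longleftrightarrow> u \<in> ?R"
      by (cases u) (auto simp: nth_append less_Suc_eq image_iff)
  qed
  have 2: "label_at (Node undefined (ts @ [t])) u = label_at (Node undefined ts) u"
    "u \<noteq> length ts # v" "u \<noteq> [length ts]"
    "tree_interp r u (length ts # v) \<longleftrightarrow> r = Next_Sibling \<and> u = [length ts - 1] \<and> v = []"
    "\<not> tree_interp r (length ts # v) u" if "u \<in> ?N ts" for u v r
    using that by (cases u; auto simp: nth_append tree_interp_neq)+
  show ?thesis
    unfolding glued_def hedge_str_def tree_str_def str.simps
    by (intro conjI ballI allI 1) (auto simp: 2 nth_append tree_interp_Cons)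
qed

text \<open>Across the border the new root is related only to the roots of the hedge, by
  \<open>Child\<close>. They are no longer roots afterwards, hence the clearing of both
  flags.\<close>

lemma glued_Node:
  "glued id (\<lambda>(l, a, b). (l, False, False)) (\<lambda>r c d. r = Child \<and> fst (snd d)) (\<lambda>_ _ _. False)
     \<lparr>uni = {[]}, col = (\<lambda>_. (l, True, False)), rel = tree_interp\<rparr> id (hedge_str ts) id (tree_str (Node l ts))"
proof -
  have "nodes (Node l ts) = id ` {[]} \<union> id ` (nodes (Node undefined ts) - {[]})" (is "?L = ?R")
  proof (rule set_eqI)
    fix u show "u \<in> ?L \<longleftrightarrow> u \<in> ?R" by (cases u) auto
  qed
  moreover have "label_at (Node l ts) u = label_at (Node undefined ts) u" if "u \<noteq> []" for u
    using that by (cases u) auto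
  moreover have "tree_interp r [] u \<longleftrightarrow> r = Child \<and> length u = 1" for r u
    by (cases r) (auto simp: length_Suc_conv)
  moreover have "\<not> tree_interp r u []" for r u
    by (cases r) auto
  ultimately show ?thesis
    unfolding glued_def hedge_str_def tree_str_def by auto
qed

text \<open>Tree classes \<tau> and hedge classes \<eta> form one congruence: a hedge grows by a
  tree, and a tree arises from a letter and a hedge. They become the states of the transducer and of
  its horizontal automata.\<close>

lemma ex_tree_classes:
  fixes \<phi> :: "('a, tree_rel) fo" and \<Lambda> :: "('a \<times> nat set) set"
  assumes fin: "finite \<Lambda>" and closed: "free_vars \<phi> = {}"
  defines "D \<equiv> trees_over \<Lambda>"
  shows "\<exists>(\<tau> :: ('a \<times> nat set) utree \<Rightarrow> nat) (\<eta> :: ('a \<times> nat set) utree list \<Rightarrow> nat).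
    finite (\<tau> ` D) \<and> finite (\<eta> ` lists D) \<and>
    (\<forall>t t'. t \<in> D \<longrightarrow> t' \<in> D \<longrightarrow> \<tau> t = \<tau> t' \<longrightarrow>
       root t = root t' \<and> (\<forall>e. sat (tree_str t) e \<phi> \<longleftrightarrow> sat (tree_str t') e \<phi>)) \<and>
    (\<forall>ts ts' t t'. ts \<in> lists D \<longrightarrow> ts' \<in> lists D \<longrightarrow> t \<in> D \<longrightarrow> t' \<in> D \<longrightarrow>
       \<eta> ts = \<eta> ts' \<longrightarrow> \<tau> t = \<tau> t' \<longrightarrow> \<eta> (ts @ [t]) = \<eta> (ts' @ [t'])) \<and>
    (\<forall>ts ts' l. ts \<in> lists D \<longrightarrow> ts' \<in> lists D \<longrightarrow> l \<in> \<Lambda> \<longrightarrow> \<eta> ts = \<eta> ts' \<longrightarrow>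
       \<tau> (Node l ts) = \<tau> (Node l ts'))"
proof -
  obtain k where k: "vars \<phi> \<subseteq> {..<k}"
    using finite_vars[of \<phi>] unfolding finite_nat_set_iff_bounded by auto
  let ?C = "\<Lambda> \<times> (UNIV :: (bool \<times> bool) set)"
  have "finite ?C" using fin by simp
  from ex_efc_class[OF this finite_UNIV_tree_rel, of k "qr \<phi>"]
  obtain cl :: "(pos, ('a \<times> nat set) \<times> bool \<times> bool, tree_rel) str \<Rightarrow> nat" where
    *: "finite (cl ` {A. col A ` uni A \<subseteq> ?C}) \<and>
      (\<forall>A B. col A ` uni A \<subseteq> ?C \<longrightarrow> col B ` uni B \<subseteq> ?C \<longrightarrow> (cl A = cl B \<longleftrightarrow> efc k (qr \<phi>) A B))" ..
  then have cl: "finite (cl ` {A. col A ` uni A \<subseteq> ?C})" ..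
  from * have cl_iff: "col A ` uni A \<subseteq> ?C \<Longrightarrow> col B ` uni B \<subseteq> ?C \<Longrightarrow> cl A = cl B \<longleftrightarrow> efc k (qr \<phi>) A B" for A B
    by blast
  have T: "col (tree_str t) ` uni (tree_str t) \<subseteq> ?C" if "t \<in> D" for t
    using that by (auto simp: tree_str_def D_def trees_over_def)
  have H: "col (hedge_str ts) ` uni (hedge_str ts) \<subseteq> ?C" if "ts \<in> lists D" for ts
  proof -
    have "label_at (Node undefined ts) u \<in> \<Lambda>" if u: "u \<in> nodes (Node undefined ts)" "u \<noteq> []" for u
    proof -
      obtain i p where "u = i # p" using u by (cases u) auto
      moreover from this have "ts ! i \<in> D" using u \<open>ts \<in> lists D\<close> by auto
      ultimately show ?thesis using u by (simp add: D_def trees_over_def)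
    qed
    then show ?thesis by (auto simp: hedge_str_def)
  qed
  \<comment> \<open>The root label is added because a small rank may not reveal it, while
    \<open>tr_out\<close> has to compare it with the output letter.\<close>
  let ?q = "\<lambda>t. (cl (tree_str t), root t)"
  have "?q ` D \<subseteq> cl ` {A. col A ` uni A \<subseteq> ?C} \<times> \<Lambda>"
    using T root_in by (auto simp: D_def)
  then have fq: "finite (?q ` D)" by (rule finite_subset) (use cl fin in simp)
  from ex_inj_nat[OF this] obtain g :: "nat \<times> 'a \<times> nat set \<Rightarrow> nat" where g: "inj_on g (?q ` D)" ..
  define \<tau> where "\<tau> t = g (?q t)" for t
  define \<eta> where "\<eta> ts = cl (hedge_str ts)" for ts
  have \<tau>: "\<tau> t = \<tau> t' \<longleftrightarrow> efc k (qr \<phi>) (tree_str t) (tree_str t') \<and> root t = root t'"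
    if "t \<in> D" "t' \<in> D" for t t'
    using inj_on_eq_iff[OF g, of "?q t" "?q t'"] that cl_iff[OF T T] by (simp add: \<tau>_def)
  have \<eta>: "\<eta> ts = \<eta> ts' \<longleftrightarrow> efc k (qr \<phi>) (hedge_str ts) (hedge_str ts')"
    if "ts \<in> lists D" "ts' \<in> lists D" for ts ts'
    unfolding \<eta>_def by (rule cl_iff[OF H[OF that(1)] H[OF that(2)]])
  show ?thesis
  proof (rule exI[of _ \<tau>], rule exI[of _ \<eta>], intro conjI allI impI)
    have "\<tau> ` D = g ` ?q ` D" unfolding image_image \<tau>_def ..
    then show "finite (\<tau> ` D)" using fq by simp
    show "finite (\<eta> ` lists D)"
      by (rule finite_subset[OF _ cl]) (use H in \<open>auto simp: \<eta>_def simp del: in_lists_conv_set\<close>)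
    show "root t = root t'" if "t \<in> D" "t' \<in> D" "\<tau> t = \<tau> t'" for t t'
      using \<tau> that by blast
    show "sat (tree_str t) e \<phi> \<longleftrightarrow> sat (tree_str t') e \<phi>" if "t \<in> D" "t' \<in> D" "\<tau> t = \<tau> t'" for t t' e
      by (rule efc_sat[OF _ order_refl k closed]) (use \<tau> that in blast)
    show "\<eta> (ts @ [t]) = \<eta> (ts' @ [t'])"
      if "ts \<in> lists D" "ts' \<in> lists D" "t \<in> D" "t' \<in> D" "\<eta> ts = \<eta> ts'" "\<tau> t = \<tau> t'" for ts ts' t t'
    proof -
      have 1: "efc k (qr \<phi>) (hedge_str ts) (hedge_str ts')" using \<eta>[OF that(1,2)] that(5) by simp
      have 2: "efc k (qr \<phi>) (tree_str t) (tree_str t')" using \<tau>[OF that(3,4)] that(6) by simp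
      have "efc k (qr \<phi>) (hedge_str (ts @ [t])) (hedge_str (ts' @ [t']))"
        by (rule efc_glued[OF glued_hedge glued_hedge 1 2])
      then show ?thesis using \<eta>[of "ts @ [t]" "ts' @ [t']"] that by simp
    qed
    show "\<tau> (Node l ts) = \<tau> (Node l ts')"
      if "ts \<in> lists D" "ts' \<in> lists D" "l \<in> \<Lambda>" "\<eta> ts = \<eta> ts'" for ts ts' l
    proof -
      have 1: "efc k (qr \<phi>) (hedge_str ts) (hedge_str ts')" using \<eta>[OF that(1,2)] that(4) by simp
      have "efc k (qr \<phi>) (tree_str (Node l ts)) (tree_str (Node l ts'))"
        by (rule efc_glued[OF glued_Node glued_Node efc_refl 1])
      moreover have "Node l ts \<in> D" "Node l ts' \<in> D"
        unfolding D_def by (rule Node_trees_over[OF that(3)], use that D_def in blast)+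
      ultimately show ?thesis using \<tau> by simp
    qed
  qed
qed


text \<open>The state at a node is the class of its subtree in the output tree decoded by
  \<open>d\<close>. For a fixed output this run is forced on the nodes, so, once the labels agree,
  acceptance is satisfaction of \<phi> in the whole decoded tree.\<close>

lemma tree_transducer:
  fixes \<phi> :: "('a, tree_rel) fo" and \<Lambda> :: "('a \<times> nat set) set" and d :: "nat \<Rightarrow> 'a \<times> nat set"
  assumes fin: "finite \<Lambda>" and closed: "free_vars \<phi> = {}"
    and \<Lambda>: "fst ` \<Lambda> \<subseteq> \<Sigma>" and \<Gamma>: "d ` \<Gamma> \<subseteq> \<Lambda>"
  shows "\<exists>T :: (nat, 'a, nat) transducer. transducer_over \<Sigma> \<Gamma> T \<and>
    (\<forall>s s'. nodes s' = nodes s \<and> (\<forall>u\<in>nodes s. label_at s' u \<in> \<Gamma>) \<longrightarrow>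
      (is_output T s s' \<longleftrightarrow> (\<forall>u\<in>nodes s. fst (d (label_at s' u)) = label_at s u) \<and>
         sat (tree_str (map_utree d s')) (\<lambda>_. []) \<phi>))"
proof -
  define D where "D = trees_over \<Lambda>"
  obtain \<tau> :: "('a \<times> nat set) utree \<Rightarrow> nat" and \<eta> :: "('a \<times> nat set) utree list \<Rightarrow> nat" where
    fin\<tau>: "finite (\<tau> ` D)" and fin\<eta>: "finite (\<eta> ` lists D)"
    and "\<forall>t t'. t \<in> D \<longrightarrow> t' \<in> D \<longrightarrow> \<tau> t = \<tau> t' \<longrightarrow>
       root t = root t' \<and> (\<forall>e. sat (tree_str t) e \<phi> \<longleftrightarrow> sat (tree_str t') e \<phi>)"
    and "\<forall>ts ts' t t'. ts \<in> lists D \<longrightarrow> ts' \<in> lists D \<longrightarrow> t \<in> D \<longrightarrow> t' \<in> D \<longrightarrow>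
       \<eta> ts = \<eta> ts' \<longrightarrow> \<tau> t = \<tau> t' \<longrightarrow> \<eta> (ts @ [t]) = \<eta> (ts' @ [t'])"
    and "\<forall>ts ts' l. ts \<in> lists D \<longrightarrow> ts' \<in> lists D \<longrightarrow> l \<in> \<Lambda> \<longrightarrow> \<eta> ts = \<eta> ts' \<longrightarrow>
       \<tau> (Node l ts) = \<tau> (Node l ts')"
    using ex_tree_classes[OF fin closed] unfolding D_def by blast
  then have \<tau>_root: "t \<in> D \<Longrightarrow> t' \<in> D \<Longrightarrow> \<tau> t = \<tau> t' \<Longrightarrow> root t = root t'"
    and \<tau>_sat: "t \<in> D \<Longrightarrow> t' \<in> D \<Longrightarrow> \<tau> t = \<tau> t' \<Longrightarrow> sat (tree_str t) e \<phi> \<longleftrightarrow> sat (tree_str t') e \<phi>"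
    and \<eta>_snoc: "ts \<in> lists D \<Longrightarrow> ts' \<in> lists D \<Longrightarrow> t \<in> D \<Longrightarrow> t' \<in> D \<Longrightarrow>
       \<eta> ts = \<eta> ts' \<Longrightarrow> \<tau> t = \<tau> t' \<Longrightarrow> \<eta> (ts @ [t]) = \<eta> (ts' @ [t'])"
    and \<tau>_Node: "ts \<in> lists D \<Longrightarrow> ts' \<in> lists D \<Longrightarrow> l \<in> \<Lambda> \<Longrightarrow> \<eta> ts = \<eta> ts' \<Longrightarrow> \<tau> (Node l ts) = \<tau> (Node l ts')"
    for t t' e ts ts' l
    by blast+
  \<comment> \<open>A word of tree classes determines the hedge class. This allows a hedge that
    realises a transition to be exchanged for the actual children.\<close>
  have map_\<eta>: "ts \<in> lists D \<Longrightarrow> ts' \<in> lists D \<Longrightarrow> map \<tau> ts = map \<tau> ts' \<Longrightarrow> \<eta> ts = \<eta> ts'" for ts ts'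
  proof (induction ts arbitrary: ts' rule: rev_induct)
    case (snoc t ts)
    then obtain ss s where ts': "ts' = ss @ [s]" by (cases ts' rule: rev_cases) auto
    with snoc show ?case using \<eta>_snoc[of ts ss t s] by simp
  qed simp
  \<comment> \<open>Transitions disregard the input letter: a state fixes the root label, and
    \<open>tr_out\<close> ties that label to the input and the output letter.\<close>
  define T :: "(nat, 'a, nat) transducer" where "T = \<lparr>tr_states = \<tau> ` D,
    tr_final = \<tau> ` {t\<in>D. sat (tree_str t) (\<lambda>_. []) \<phi>},
    tr_delta = (\<lambda>q a. {map \<tau> ts | ts. ts \<in> lists D \<and> (\<exists>l\<in>\<Lambda>. \<tau> (Node l ts) = q)}),
    tr_out = {(\<tau> t, fst (root t), g) | t g. t \<in> D \<and> g \<in> \<Gamma> \<and> d g = root t}\<rparr>"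
  have over: "transducer_over \<Sigma> \<Gamma> T"
    unfolding transducer_over_def
  proof (intro conjI ballI)
    show "finite (tr_states T)" using fin\<tau> by (simp add: T_def)
    show "tr_final T \<subseteq> tr_states T" by (auto simp: T_def)
    show "tr_out T \<subseteq> tr_states T \<times> \<Sigma> \<times> \<Gamma>"
      using \<Lambda> root_in by (fastforce simp: T_def D_def)
    fix q a
    have "\<exists>M :: (nat, nat) nfa. nfa_over (\<tau> ` D) M \<and>
        (\<forall>w. nfa_accepts M w \<longleftrightarrow> (\<exists>ts\<in>lists D. w = map \<tau> ts \<and> (\<exists>l\<in>\<Lambda>. \<tau> (Node l ts) = q)))"
    proof (rule quotient_nfa[OF fin\<eta> order_refl \<eta>_snoc])
      fix ys ys' assume "ys \<in> lists D" "ys' \<in> lists D" "\<eta> ys = \<eta> ys'" "\<exists>l\<in>\<Lambda>. \<tau> (Node l ys) = q"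
      then show "\<exists>l\<in>\<Lambda>. \<tau> (Node l ys') = q" using \<tau>_Node[of ys ys'] by metis
    qed
    then obtain M :: "(nat, nat) nfa" where M: "nfa_over (\<tau> ` D) M"
      "\<forall>w. nfa_accepts M w \<longleftrightarrow> (\<exists>ts\<in>lists D. w = map \<tau> ts \<and> (\<exists>l\<in>\<Lambda>. \<tau> (Node l ts) = q))" by blast
    have "tr_delta T q a = {w. nfa_accepts M w}" using M(2) by (auto simp: T_def)
    then show "regular (tr_states T) (tr_delta T q a)"
      unfolding regular_def using M(1) by (auto simp: T_def)
  qed
  have "is_output T s s' \<longleftrightarrow> (\<forall>u\<in>nodes s. fst (d (label_at s' u)) = label_at s u) \<and>
      sat (tree_str (map_utree d s')) (\<lambda>_. []) \<phi>"
    if s': "nodes s' = nodes s" "\<forall>u\<in>nodes s. label_at s' u \<in> \<Gamma>" for s s'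
  proof -
    let ?S = "map_utree d s'"
    have S: "?S \<in> D" using s' \<Gamma> by (auto simp: D_def trees_over_def)
    have nS: "nodes ?S = nodes s" using s' by simp
    have subD: "subtree ?S u \<in> D" if "u \<in> nodes s" for u
      using subtree_trees_over S that nS unfolding D_def by blast
    have chD: "children (subtree ?S u) \<in> lists D" if "u \<in> nodes s" for u
      using children_trees_over subD[OF that] unfolding D_def by blast
    have root_sub: "root (subtree ?S u) = d (label_at s' u)" if "u \<in> nodes s" for u
      using that s' label_at_map_utree[of u s' d] by (simp add: label_at_def)
    have ch: "map (\<lambda>i. h (subtree ?S (u @ [i]))) [0..<arity s u] = map h (children (subtree ?S u))"
      if "u \<in> nodes s" for u and h :: "_ \<Rightarrow> nat"
    proof -
      have "arity s u = length (children (subtree ?S u))"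
        using arity_cong[OF nS] that nS by (simp add: arity_def)
      then show ?thesis by (auto intro!: nth_equalityI simp: subtree_append)
    qed
    have Sub: "subtree ?S u = Node (d (label_at s' u)) (children (subtree ?S u))" if "u \<in> nodes s" for u
      using root_sub[OF that] by (metis utree.collapse)
    show ?thesis
    proof
      assume "is_output T s s'"
      then obtain \<rho> where run: "accepting_run T s \<rho>"
        and out: "\<forall>u\<in>nodes s. (\<rho> u, label_at s u, label_at s' u) \<in> tr_out T"
        unfolding is_output_def by blast
      have \<rho>: "\<rho> u = \<tau> (subtree ?S u)" if "u \<in> nodes s" for u
        using that
      proof (induction "subtree ?S u" arbitrary: u rule: measure_induct_rule[of size])
        case (less u)
        have IH: "\<rho> (u @ [i]) = \<tau> (subtree ?S (u @ [i]))" if "i < arity s u" for i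
        proof (rule less.hyps)
          show n: "u @ [i] \<in> nodes s" using less.prems that child_in_nodes by blast
          have "i < length (children (subtree ?S u))"
            using that arity_cong[OF nS] less.prems nS by (simp add: arity_def)
          then have "subtree ?S (u @ [i]) \<in> set (children (subtree ?S u))"
            by (simp add: subtree_append)
          moreover have "size x < size t" if "x \<in> set (children t)" for x t :: "('a \<times> nat set) utree"
            using that by (cases t) (simp add: size_list_estimation less_Suc_eq_le size_list_estimation')
          ultimately show "size (subtree ?S (u @ [i])) < size (subtree ?S u)" by blast
        qed
        have "map (\<lambda>i. \<rho> (u @ [i])) [0..<arity s u] \<in> tr_delta T (\<rho> u) (label_at s u)"
          using run less.prems unfolding accepting_run_def by blast
        moreover have "map (\<lambda>i. \<rho> (u @ [i])) [0..<arity s u] = map \<tau> (children (subtree ?S u))"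
          unfolding ch[OF less.prems, symmetric] using IH by simp
        ultimately obtain ts l where ts: "ts \<in> lists D" "l \<in> \<Lambda>" "map \<tau> (children (subtree ?S u)) = map \<tau> ts"
          "\<tau> (Node l ts) = \<rho> u"
          by (auto simp: T_def)
        obtain t where t: "t \<in> D" "\<rho> u = \<tau> t" "d (label_at s' u) = root t"
          using out less.prems by (auto simp: T_def)
        \<comment> \<open>The transition may be realised by another tree \<open>Node l ts\<close>.
          As classes determine the root label, its letter is still the decoded output
          letter.\<close>
        have "Node l ts \<in> D" unfolding D_def by (rule Node_trees_over[OF ts(2) ts(1)[unfolded D_def]])
        then have "l = root t" using \<tau>_root[of "Node l ts" t] ts t by simp
        then have "l = d (label_at s' u)" using t by simp
        moreover have "\<tau> (Node l ts) = \<tau> (Node l (children (subtree ?S u)))"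
          by (rule \<tau>_Node[OF ts(1) chD[OF less.prems] ts(2) map_\<eta>])
            (use ts chD[OF less.prems] in simp_all)
        ultimately show ?case using ts(4) Sub[OF less.prems] by simp
      qed
      have "fst (d (label_at s' u)) = label_at s u" if "u \<in> nodes s" for u
        using out that by (auto simp: T_def)
      moreover have "\<tau> ?S \<in> tr_final T"
        using run \<rho>[of "[]"] by (simp add: accepting_run_def)
      then have "sat (tree_str ?S) (\<lambda>_. []) \<phi>" using \<tau>_sat[OF _ S] by (auto simp: T_def)
      ultimately show "(\<forall>u\<in>nodes s. fst (d (label_at s' u)) = label_at s u) \<and> sat (tree_str ?S) (\<lambda>_. []) \<phi>"
        by blast
    next
      assume *: "(\<forall>u\<in>nodes s. fst (d (label_at s' u)) = label_at s u) \<and> sat (tree_str ?S) (\<lambda>_. []) \<phi>"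
      let ?\<rho> = "\<lambda>u. \<tau> (subtree ?S u)"
      have "accepting_run T s ?\<rho>"
        unfolding accepting_run_def
      proof (intro conjI ballI)
        show "?\<rho> [] \<in> tr_final T" using * S by (auto simp: T_def)
        fix u assume u: "u \<in> nodes s"
        show "?\<rho> u \<in> tr_states T" using subD[OF u] by (simp add: T_def)
        have "d (label_at s' u) \<in> \<Lambda>" using u s'(2) \<Gamma> by blast
        moreover have "\<tau> (Node (d (label_at s' u)) (children (subtree ?S u))) = ?\<rho> u"
          by (rule arg_cong[OF Sub[OF u, symmetric]])
        ultimately have "\<exists>ts. map \<tau> (children (subtree ?S u)) = map \<tau> ts \<and> ts \<in> lists D \<and> (\<exists>l\<in>\<Lambda>. \<tau> (Node l ts) = ?\<rho> u)"
          using chD[OF u] by (intro exI[of _ "children (subtree ?S u)"] conjI refl bexI)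
        then show "map (\<lambda>i. ?\<rho> (u @ [i])) [0..<arity s u] \<in> tr_delta T (?\<rho> u) (label_at s u)"
          unfolding ch[OF u] by (simp add: T_def)
      qed
      moreover have "(?\<rho> u, label_at s u, label_at s' u) \<in> tr_out T" if "u \<in> nodes s" for u
        using * s'(2) that subD[OF that] root_sub[OF that] by (auto simp: T_def intro!: exI[of _ "subtree ?S u"])
      ultimately show "is_output T s s'" unfolding is_output_def using s'(1) by blast
    qed
  qed
  then show ?thesis using over by blast
qed

subsection \<open>An automaton for data formulas\<close>

lemma finite_UNIV_data_rel: "finite (UNIV :: data_rel set)"
proof -
  have "(UNIV :: data_rel set) \<subseteq> {Sim, Prec, Prec_Suc}" using data_rel.exhaust by blast
  then show ?thesis by (rule finite_subset) simp
qed

text \<open>The index of a data value in increasing order, counted from 0, which is also the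
  position of its set in \<open>value_string\<close>.\<close>

definition value_rank :: "'a odtree \<Rightarrow> pos \<Rightarrow> nat" where
  "value_rank t u = (THE i. i < card (data_values t) \<and> sorted_list_of_set (data_values t) ! i = val t u)"

lemma
  assumes u: "u \<in> nodes t"
  shows value_rank_less: "value_rank t u < card (data_values t)"
    and nth_value_rank: "sorted_list_of_set (data_values t) ! value_rank t u = val t u"
proof -
  let ?ds = "sorted_list_of_set (data_values t)"
  have "val t u \<in> set ?ds" using u by (simp add: finite_data_values) (simp add: data_values_def)
  then have "\<exists>!i. i < length ?ds \<and> ?ds ! i = val t u"
    by (intro distinct_Ex1) simp_all
  then have "\<exists>!i. i < card (data_values t) \<and> ?ds ! i = val t u" by simp
  from theI'[OF this] show "value_rank t u < card (data_values t)" "?ds ! value_rank t u = val t u"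
    unfolding value_rank_def by simp_all
qed

lemma value_rank_surj: "i < card (data_values t) \<Longrightarrow> \<exists>u\<in>nodes t. value_rank t u = i"
proof -
  let ?ds = "sorted_list_of_set (data_values t)"
  assume i: "i < card (data_values t)"
  then have "?ds ! i \<in> set ?ds" by (intro nth_mem) simp
  then obtain u where u: "u \<in> nodes t" "?ds ! i = val t u"
    by (auto simp: finite_data_values) (auto simp: data_values_def)
  have "value_rank t u = i"
    using value_rank_less[OF u(1)] nth_value_rank[OF u(1)] u(2) i
      nth_eq_iff_index_eq[of ?ds i "value_rank t u"] by simp
  then show ?thesis using u(1) by blast
qed

lemma value_rank_less_iff:
  assumes "u \<in> nodes t" "v \<in> nodes t"
  shows "value_rank t u < value_rank t v \<longleftrightarrow> val t u < val t v"
proof -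
  let ?ds = "sorted_list_of_set (data_values t)"
  have mono: "?ds ! i < ?ds ! j" if "i < j" "j < card (data_values t)" for i j
    by (rule sorted_wrt_nth_less[of "(<)"]) (use that in simp_all)
  show ?thesis
    using mono[of "value_rank t u" "value_rank t v"] mono[of "value_rank t v" "value_rank t u"]
      value_rank_less[OF assms(1)] value_rank_less[OF assms(2)]
      nth_value_rank[OF assms(1)] nth_value_rank[OF assms(2)]
    by (metis linorder_neqE_nat not_less_iff_gr_or_eq)
qed

lemma value_rank_eq_iff:
  assumes "u \<in> nodes t" "v \<in> nodes t"
  shows "value_rank t u = value_rank t v \<longleftrightarrow> val t u = val t v"
  using value_rank_less_iff[OF assms] value_rank_less_iff[OF assms(2,1)] by linarith

fun rank_interp :: "data_rel \<Rightarrow> nat \<Rightarrow> nat \<Rightarrow> bool" where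
  "rank_interp Sim i j = (i = j)"
| "rank_interp Prec i j = (i < j)"
| "rank_interp Prec_Suc i j = (j = Suc i)"

text \<open>Ranks leave no gaps, every number below the count of values being attained; hence the
  least larger value has the next rank.\<close>

lemma data_interp_iff:
  assumes "u \<in> nodes t" "v \<in> nodes t"
  shows "data_interp t r u v \<longleftrightarrow> rank_interp r (value_rank t u) (value_rank t v)"
proof (cases r)
  case Prec_Suc
  have "(\<forall>d\<in>data_values t. val t u < d \<longrightarrow> val t v \<le> d) \<longleftrightarrow>
      (\<forall>w\<in>nodes t. value_rank t u < value_rank t w \<longrightarrow> value_rank t v \<le> value_rank t w)"
    using value_rank_less_iff[OF assms(1)] value_rank_less_iff[OF _ assms(2)]
    by (simp add: data_values_def not_less[symmetric])
  also have "\<dots> \<longleftrightarrow> (\<forall>j<card (data_values t). value_rank t u < j \<longrightarrow> value_rank t v \<le> j)"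
    using value_rank_surj value_rank_less by metis
  finally have "data_interp t Prec_Suc u v \<longleftrightarrow> value_rank t u < value_rank t v \<and>
      (\<forall>j<card (data_values t). value_rank t u < j \<longrightarrow> value_rank t v \<le> j)"
    using value_rank_less_iff[OF assms] by simp
  also have "\<dots> \<longleftrightarrow> value_rank t v = Suc (value_rank t u)"
    (is "?l \<longleftrightarrow> ?r")
  proof
    assume l: ?l
    then have "Suc (value_rank t u) < card (data_values t)" using value_rank_less[OF assms(2)] by linarith
    with l have "value_rank t v \<le> Suc (value_rank t u)" by simp
    with l show ?r by linarith
  qed simp
  finally show ?thesis by (simp add: Prec_Suc)
qed (use assms in \<open>simp_all add: value_rank_eq_iff value_rank_less_iff\<close>)

section \<open>Value strings as structures\<close>

lemma length_value_string [simp]: "length (value_string \<Gamma> t) = card (data_values t)"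
  by (simp add: value_string_def)

lemma mem_value_string:
  assumes "t \<in> odtrees \<Gamma>" "i < card (data_values t)"
  shows "g \<in> value_string \<Gamma> t ! i \<longleftrightarrow> (\<exists>u\<in>nodes t. value_rank t u = i \<and> lab t u = g)"
proof -
  let ?ds = "sorted_list_of_set (data_values t)"
  obtain w where w: "w \<in> nodes t" "value_rank t w = i" using value_rank_surj[OF assms(2)] by blast
  have "value_string \<Gamma> t ! i = {a \<in> \<Gamma>. val t w \<in> V t a}"
    using assms w nth_value_rank[OF w(1)] by (simp add: value_string_eq)
  also have "g \<in> \<dots> \<longleftrightarrow> (\<exists>u\<in>nodes t. val t u = val t w \<and> lab t u = g)"
    using assms(1) by (auto simp: V_def odtrees_def, metis)
  also have "\<dots> \<longleftrightarrow> (\<exists>u\<in>nodes t. value_rank t u = i \<and> lab t u = g)"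
    using value_rank_eq_iff[OF _ w(1)] w(2) by auto
  finally show ?thesis .
qed

lemma value_string_Pow: "t \<in> odtrees \<Gamma> \<Longrightarrow> value_string \<Gamma> t \<in> lists (Pow \<Gamma>)"
  by (auto simp: value_string_eq)

text \<open>Each letter of a position is realised by exactly one element. The flag of a colour marks the
  elements of the last position.\<close>

definition word_str :: "('g \<Rightarrow> 'l) \<Rightarrow> 'g set list \<Rightarrow> (nat \<times> 'g, 'l \<times> bool, data_rel) str" where
  "word_str d w = \<lparr>uni = {(i, g). i < length w \<and> g \<in> w ! i}, col = (\<lambda>(i, g). (d g, Suc i = length w)),
     rel = (\<lambda>r p q. rank_interp r (fst p) (fst q))\<rparr>"

text \<open>All earlier positions precede the new one, and only the flagged last one is its
  immediate predecessor. Appending clears the old flags, whereas in a one-letter word every element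
  is flagged already, hence \<open>id\<close>.\<close>

lemma glued_word:
  "glued (\<lambda>(l, b). (l, False)) id (\<lambda>r c e. r = Prec \<or> r = Prec_Suc \<and> snd c) (\<lambda>_ _ _. False)
     (word_str d w) id (word_str d [S]) (\<lambda>(_, g). (length w, g)) (word_str d (w @ [S]))"
proof -
  have 1: "rank_interp r i n \<longleftrightarrow> r = Prec \<or> r = Prec_Suc \<and> Suc i = n" "\<not> rank_interp r n i" if "i < n" for r i n
    using that by (cases r; auto)+
  let ?f2 = "\<lambda>(_ :: nat, g). (length w, g)"
  have 2: "uni (word_str d (w @ [S])) = id ` uni (word_str d w) \<union> ?f2 ` uni (word_str d [S])" (is "?L = ?R")
  proof (rule set_eqI)
    fix p show "p \<in> ?L \<longleftrightarrow> p \<in> ?R"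
      by (cases p) (auto simp: word_str_def nth_append less_Suc_eq image_iff)
  qed
  have 3: "fst p < length w" if "p \<in> uni (word_str d w)" for p
    using that by (auto simp: word_str_def)
  have 4: "\<exists>g. p = (0, g)" if "p \<in> uni (word_str d [S])" for p
    using that by (auto simp: word_str_def)
  show ?thesis
    unfolding glued_def
  proof (intro conjI ballI allI 2)
    fix p q r assume p: "p \<in> uni (word_str d w)" and q: "q \<in> uni (word_str d [S])"
    obtain g where q': "q = (0, g)" using 4[OF q] by blast
    obtain i h where p': "p = (i, h)" by (cases p)
    have i: "i < length w" using 3[OF p] p' by simp
    show "id p \<noteq> ?f2 q" using i p' q' by simp
    show "rel (word_str d (w @ [S])) r (id p) (?f2 q) \<longleftrightarrow>
        r = Prec \<or> r = Prec_Suc \<and> snd (col (word_str d w) p)"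
      using 1(1)[OF i] p' q' by (simp add: word_str_def)
    show "rel (word_str d (w @ [S])) r (?f2 q) (id p) \<longleftrightarrow> False"
      using 1(2)[OF i] p' q' by (simp add: word_str_def)
  next
    fix p q r assume "p \<in> uni (word_str d [S])" "q \<in> uni (word_str d [S])"
    then obtain g h where "p = (0, g)" "q = (0, h)" using 4 by blast
    then show "?f2 p = ?f2 q \<longleftrightarrow> p = q"
      "rel (word_str d (w @ [S])) r (?f2 p) (?f2 q) \<longleftrightarrow> rel (word_str d [S]) r p q"
      by (cases r; simp add: word_str_def)+
  next
    fix p assume "p \<in> uni (word_str d [S])"
    then obtain g where "p = (0, g)" using 4 by blast
    then show "col (word_str d (w @ [S])) (?f2 p) = id (col (word_str d [S]) p)"
      by (simp add: word_str_def)
  next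
    fix p assume "p \<in> uni (word_str d w)"
    then show "col (word_str d (w @ [S])) (id p) = (\<lambda>(l, b). (l, False)) (col (word_str d w) p)"
      using 3[of p] by (cases p) (simp add: word_str_def)
  qed (simp_all add: word_str_def)
qed

text \<open>Besides \<psi> the automaton checks that every letter belongs to \<open>\<S>\<close>, so
  requirements on the sets at single values, such as those on counters, cost no further
  automaton.\<close>

lemma word_nfa:
  fixes \<psi> :: "('a, data_rel) fo" and d :: "nat \<Rightarrow> 'a \<times> nat set"
  assumes fin: "finite (d ` \<Gamma>)" and closed: "free_vars \<psi> = {}" and \<S>: "\<S> \<subseteq> Pow \<Gamma>"
  shows "\<exists>M :: (nat, nat set) nfa. nfa_over (Pow \<Gamma>) M \<and>
    (\<forall>w e. nfa_accepts M w \<longleftrightarrow> w \<in> lists \<S> \<and> sat (word_str d w) e \<psi>)"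
proof -
  obtain k where k: "vars \<psi> \<subseteq> {..<k}"
    using finite_vars[of \<psi>] unfolding finite_nat_set_iff_bounded by auto
  let ?C = "d ` \<Gamma> \<times> (UNIV :: bool set)"
  have "finite ?C" using fin by simp
  from ex_efc_class[OF this finite_UNIV_data_rel, of k "qr \<psi>"]
  obtain cl :: "(nat \<times> nat, ('a \<times> nat set) \<times> bool, data_rel) str \<Rightarrow> nat" where
    *: "finite (cl ` {A. col A ` uni A \<subseteq> ?C}) \<and>
      (\<forall>A B. col A ` uni A \<subseteq> ?C \<longrightarrow> col B ` uni B \<subseteq> ?C \<longrightarrow> (cl A = cl B \<longleftrightarrow> efc k (qr \<psi>) A B))" ..
  have C: "col (word_str d w) ` uni (word_str d w) \<subseteq> ?C" if "w \<in> lists \<S>" for w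
  proof -
    have "g \<in> \<Gamma>" if "i < length w" "g \<in> w ! i" for i g
    proof -
      have "w ! i \<in> \<S>" using \<open>w \<in> lists \<S>\<close> nth_mem[OF that(1)] by auto
      then show ?thesis using \<S> that(2) by blast
    qed
    then show ?thesis by (auto simp: word_str_def)
  qed
  define f where "f w = cl (word_str d w)" for w
  have f: "f w = f w' \<longleftrightarrow> efc k (qr \<psi>) (word_str d w) (word_str d w')"
    if "w \<in> lists \<S>" "w' \<in> lists \<S>" for w w'
    unfolding f_def using * C[OF that(1)] C[OF that(2)] by blast
  have "f ` lists \<S> \<subseteq> cl ` {A. col A ` uni A \<subseteq> ?C}"
  proof (rule image_subsetI)
    fix w assume "w \<in> lists \<S>"
    then show "f w \<in> cl ` {A. col A ` uni A \<subseteq> ?C}" unfolding f_def by (intro imageI CollectI C)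
  qed
  then have fin_f: "finite (f ` lists \<S>)" by (rule finite_subset) (use * in blast)
  have cong: "f (w @ [S]) = f (w' @ [S'])"
    if "w \<in> lists \<S>" "w' \<in> lists \<S>" "S \<in> \<S>" "S' \<in> \<S>" "f w = f w'" "id S = id S'" for w w' S S'
  proof -
    have 1: "efc k (qr \<psi>) (word_str d w) (word_str d w')" using f[OF that(1,2)] that(5) by simp
    have "efc k (qr \<psi>) (word_str d (w @ [S])) (word_str d (w' @ [S]))"
      by (rule efc_glued[OF glued_word glued_word 1 efc_refl])
    then show ?thesis using f[of "w @ [S]" "w' @ [S']"] that by simp
  qed
  have sat: "sat (word_str d w) e \<psi> \<longleftrightarrow> sat (word_str d w') e' \<psi>"
    if "w \<in> lists \<S>" "w' \<in> lists \<S>" "f w = f w'" for w w' e e'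
    by (rule efc_sat[OF _ order_refl k closed]) (use f that in blast)
  have "\<exists>M :: (nat, nat set) nfa. nfa_over (Pow \<Gamma>) M \<and> (\<forall>w. nfa_accepts M w \<longleftrightarrow>
      (\<exists>ys\<in>lists \<S>. w = map id ys \<and> sat (word_str d ys) (\<lambda>_. (0, 0)) \<psi>))"
  proof (rule quotient_nfa[OF fin_f _ cong])
    show "id ` \<S> \<subseteq> Pow \<Gamma>" using \<S> by simp
    show "sat (word_str d w') (\<lambda>_. (0, 0)) \<psi>"
      if "w \<in> lists \<S>" "w' \<in> lists \<S>" "f w = f w'" "sat (word_str d w) (\<lambda>_. (0, 0)) \<psi>" for w w'
      using sat[OF that(1-3)] that(4) by blast
  qed
  moreover have "(\<exists>ys\<in>lists \<S>. w = map id ys \<and> sat (word_str d ys) (\<lambda>_. (0, 0)) \<psi>) \<longleftrightarrow>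
      w \<in> lists \<S> \<and> sat (word_str d w) e \<psi>" for w e
    using sat[of w w _ e] by (auto simp del: in_lists_conv_set)
  ultimately show ?thesis by presburger
qed

text \<open>The counters \<open>0, \<dots>, K - 1\<close> number the nodes with the same value and the same \<open>d\<close>-label, and
  \<open>K\<close> is shared by all the remaining ones, so that the set of letters at a value
  determines the multiplicities up to \<open>K + 1\<close>.\<close>

lemma word_str_equiv:
  fixes t :: "'g odtree" and d :: "'g \<Rightarrow> 'l" and c :: "'g \<Rightarrow> nat"
  assumes t: "t \<in> odtrees \<Gamma>" and K: "k \<le> Suc K"
    and enc: "\<And>g. g \<in> \<Gamma> \<Longrightarrow> enc (d g, c g) = g" "\<And>g j. g \<in> \<Gamma> \<Longrightarrow> j \<le> K \<Longrightarrow> d (enc (d g, j)) = d g"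
       "\<And>g j. g \<in> \<Gamma> \<Longrightarrow> j \<le> K \<Longrightarrow> c (enc (d g, j)) = j"
    and c: "\<And>g. g \<in> \<Gamma> \<Longrightarrow> c g \<le> K"
    and inj: "\<And>g. g \<in> \<Gamma> \<Longrightarrow> c g < K \<Longrightarrow> inj_on (val t) {u \<in> nodes t. lab t u = g}"
    and down: "\<And>S g j. S \<in> set (value_string \<Gamma> t) \<Longrightarrow> g \<in> S \<Longrightarrow> j < c g \<Longrightarrow> enc (d g, j) \<in> S"
  shows "efc k n \<lparr>uni = nodes t, col = (\<lambda>u. (d (lab t u), Suc (value_rank t u) = card (data_values t))),
      rel = data_interp t\<rparr> (word_str d (value_string \<Gamma> t))" (is "efc k n ?A ?B")
proof (rule threshold_efc[where \<alpha> = "\<lambda>u. (value_rank t u, d (lab t u))" and \<beta> = "\<lambda>(i, g). (i, d g)"])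
  \<comment> \<open>Elements are classified by value and decoded label. This fixes colours and data
    relations and leaves only multiplicities to compare.\<close>
  let ?w = "value_string \<Gamma> t"
  have sub: "g \<in> \<Gamma>" if "i < length ?w" "g \<in> ?w ! i" for i g
    using value_string_Pow[OF t] that nth_mem[of i ?w] by auto
  have mem: "g \<in> ?w ! i \<longleftrightarrow> (\<exists>u\<in>nodes t. value_rank t u = i \<and> lab t u = g)" if "i < length ?w" for g i
    using mem_value_string[OF t] that by simp
  show fA: "finite (uni ?A)" by (simp add: finite_nodes)
  have uB: "uni ?B = (\<lambda>u. (value_rank t u, lab t u)) ` nodes t"
    using mem value_rank_less by (auto simp: word_str_def)
  then show fB: "finite (uni ?B)" by (simp add: finite_nodes)
  show "col ?A u = col ?B v" if "(value_rank t u, d (lab t u)) = (case v of (i, g) \<Rightarrow> (i, d g))" for u v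
    using that by (cases v) (simp add: word_str_def)
  show "rel ?A r u u' \<longleftrightarrow> rel ?B r v v'"
    if "u \<in> uni ?A" "u' \<in> uni ?A" "(value_rank t u, d (lab t u)) = (case v of (i, g) \<Rightarrow> (i, d g))"
      "(value_rank t u', d (lab t u')) = (case v' of (i, g) \<Rightarrow> (i, d g))" for r u u' v v'
    using that data_interp_iff[of u t u' r] by (cases v; cases v') (simp add: word_str_def)
  fix p :: "nat \<times> 'l"
  obtain i l where p: "p = (i, l)" by (cases p)
  let ?N = "{u \<in> uni ?A. (value_rank t u, d (lab t u)) = p}"
  let ?N' = "{v \<in> uni ?B. (case v of (i, g) \<Rightarrow> (i, d g)) = p}"
  let ?h = "\<lambda>u. (value_rank t u, lab t u)"
  have h: "?N' = ?h ` ?N" unfolding uB by auto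
  show "card ?N = card ?N' \<or> k \<le> card ?N \<and> k \<le> card ?N'"
  proof (cases "\<exists>g\<in>\<Gamma>. (i, g) \<in> ?N' \<and> c g = K")
    \<comment> \<open>No letter of this class has counter \<open>K\<close>, so nodes and letters
      correspond one to one.\<close>
    case False
    have "inj_on ?h ?N"
    proof (rule inj_onI)
      fix u v assume u: "u \<in> ?N" and v: "v \<in> ?N" and eq: "?h u = ?h v"
      have "lab t u \<in> \<Gamma>" using u t by (auto simp: odtrees_def)
      moreover have "(i, lab t u) \<in> ?N'" unfolding h using u p by (intro image_eqI[of _ _ u]) auto
      ultimately have "c (lab t u) < K" using False c[of "lab t u"] by force
      then show "u = v"
        using inj[OF \<open>lab t u \<in> \<Gamma>\<close>] u v eq value_rank_eq_iff[of u t v] by (auto dest: inj_onD)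
    qed
    then show ?thesis unfolding h by (simp add: card_image)
  next
    \<comment> \<open>A letter with counter \<open>K\<close> brings along all smaller counters by
      \<open>down\<close>. This gives at least \<open>K + 1\<close> letters, and no fewer nodes, as
      the letters are an image of the nodes.\<close>
    case True
    then obtain g where g: "g \<in> \<Gamma>" "(i, g) \<in> ?N'" "c g = K" by blast
    then have i: "i < length ?w" "g \<in> ?w ! i" "d g = l" using p by (auto simp: word_str_def)
    have "(\<lambda>j. (i, enc (l, j))) ` {..K} \<subseteq> ?N'"
    proof (rule image_subsetI)
      fix j assume "j \<in> {..K}"
      then have j: "j \<le> K" by simp
      have "enc (l, j) \<in> ?w ! i"
      proof (cases "j = K")
        case True
        then show ?thesis using enc(1)[OF g(1)] g(3) i by simp
      next
        case False
        then show ?thesis using down[of "?w ! i" g j] i j g(3) by simp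
      qed
      then show "(i, enc (l, j)) \<in> ?N'" using enc(2)[OF g(1) j] i p by (simp add: word_str_def)
    qed
    then have "card ((\<lambda>j. (i, enc (l, j))) ` {..K}) \<le> card ?N'" using fB by (intro card_mono) simp_all
    moreover have "inj_on (\<lambda>j. (i, enc (l, j))) {..K}"
    proof (rule inj_onI)
      fix j j' assume "j \<in> {..K}" "j' \<in> {..K}" "(i, enc (l, j)) = (i, enc (l, j'))"
      then show "j = j'" using enc(3)[OF g(1), of j] enc(3)[OF g(1), of j'] i(3) by simp
    qed
    ultimately have "Suc K \<le> card ?N'" by (simp add: card_image)
    moreover have "card ?N' \<le> card ?N" unfolding h using fA by (intro card_image_le) simp
    ultimately show ?thesis using K by linarith
  qed
qed

text \<open>Each fibre of \<open>f\<close> is numbered by an initial segment of the naturals.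
  Distinctness will give the uniqueness demanded by \<open>\<Gamma>0\<close>, the absence of gaps
  the membership in \<open>\<S>\<close>.\<close>

lemma ex_numbering:
  assumes "finite U"
  shows "\<exists>h :: 'u \<Rightarrow> nat. (\<forall>u\<in>U. \<forall>v\<in>U. f u = f v \<longrightarrow> h u = h v \<longrightarrow> u = v) \<and>
    (\<forall>u\<in>U. \<forall>j<h u. \<exists>v\<in>U. f v = f u \<and> h v = j)"
proof -
  have "\<forall>x. \<exists>h. bij_betw h {u\<in>U. f u = x} {0..<card {u\<in>U. f u = x}}"
    by (intro allI ex_bij_betw_finite_nat) (use assms in simp)
  from choice[OF this] obtain h where h: "\<forall>x. bij_betw (h x) {u\<in>U. f u = x} {0..<card {u\<in>U. f u = x}}" ..
  show ?thesis
  proof (rule exI[of _ "\<lambda>u. h (f u) u"], intro conjI ballI allI impI)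
    fix u v assume "u \<in> U" "v \<in> U" "f u = f v" "h (f u) u = h (f v) v"
    then show "u = v" using spec[OF h, of "f v"] by (auto simp: bij_betw_def dest: inj_onD)
  next
    fix u j assume u: "u \<in> U" and j: "j < h (f u) u"
    have "h (f u) u \<in> {0..<card {v\<in>U. f v = f u}}" using spec[OF h, of "f u"] u unfolding bij_betw_def by blast
    then have "j \<in> h (f u) ` {v\<in>U. f v = f u}" using spec[OF h, of "f u"] j unfolding bij_betw_def by simp
    then show "\<exists>v\<in>U. f v = f u \<and> h (f v) v = j" by auto
  qed
qed

subsection \<open>From logic to automata\<close>

lemma data_interp_cong:
  assumes "nodes t' = nodes t" "\<forall>u\<in>nodes t. val t' u = val t u" "u \<in> nodes t" "v \<in> nodes t"
  shows "data_interp t' r u v \<longleftrightarrow> data_interp t r u v"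
proof -
  have "data_values t' = data_values t" using assms(1,2) by (simp add: data_values_def)
  then show ?thesis using assms by (cases r) simp_all
qed

lemma logic_imp_weak_odta:
  fixes \<Sigma> :: "'a set" and \<phi> :: "('a, tree_rel) fo" and \<psi> :: "('a, data_rel) fo"
  assumes \<Sigma>: "finite \<Sigma>" and \<phi>: "sentence_over \<Sigma> m \<phi>" and \<psi>: "sentence_over \<Sigma> m \<psi>"
  shows "weak_odta_recognizable \<Sigma> {t \<in> odtrees \<Sigma>. models t m \<phi> \<psi>}"
proof -
  \<comment> \<open>\<open>K\<close> is both the number of pebbles in the game for \<psi> and the
    largest counter.\<close>
  obtain K where K: "vars \<psi> \<subseteq> {..<K}"
    using finite_vars[of \<psi>] unfolding finite_nat_set_iff_bounded by auto
  define \<Lambda> where "\<Lambda> = \<Sigma> \<times> Pow {..<m}"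
  have fin\<Lambda>: "finite \<Lambda>" using \<Sigma> by (simp add: \<Lambda>_def)
  then have "finite (\<Lambda> \<times> {..K})" by simp
  from ex_inj_nat[OF this] obtain enc :: "('a \<times> nat set) \<times> nat \<Rightarrow> nat" where enc: "inj_on enc (\<Lambda> \<times> {..K})" ..
  define \<Gamma> where "\<Gamma> = enc ` (\<Lambda> \<times> {..K})"
  define d where "d g = fst (inv_into (\<Lambda> \<times> {..K}) enc g)" for g
  define c where "c g = snd (inv_into (\<Lambda> \<times> {..K}) enc g)" for g
  have d_enc: "d (enc (l, j)) = l" "c (enc (l, j)) = j" if "l \<in> \<Lambda>" "j \<le> K" for l j
    using that enc by (simp_all add: d_def c_def)
  have \<Gamma>E: "d g \<in> \<Lambda> \<and> c g \<le> K \<and> enc (d g, c g) = g" if "g \<in> \<Gamma>" for g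
    using that d_enc by (auto simp: \<Gamma>_def)
  have fin\<Gamma>: "finite \<Gamma>" using fin\<Lambda> by (simp add: \<Gamma>_def)
  \<comment> \<open>Excludes a counter that occurs without the smaller ones, which the uniqueness
    stated by \<open>\<Gamma>0\<close> would allow.\<close>
  define \<S> where "\<S> = {S \<in> Pow \<Gamma>. \<forall>g\<in>S. \<forall>j<c g. enc (d g, j) \<in> S}"
  define \<Gamma>0 where "\<Gamma>0 = {g \<in> \<Gamma>. c g < K}"
  have closed: "free_vars \<phi> = {}" "free_vars \<psi> = {}" using \<phi> \<psi> by (simp_all add: sentence_over_def)
  have "fst ` \<Lambda> \<subseteq> \<Sigma>" by (auto simp: \<Lambda>_def)
  moreover have "d ` \<Gamma> \<subseteq> \<Lambda>" using \<Gamma>E by blast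
  ultimately have "fst ` \<Lambda> \<subseteq> \<Sigma>" "d ` \<Gamma> \<subseteq> \<Lambda>" .
  from tree_transducer[OF fin\<Lambda> closed(1) this] obtain T :: "(nat, 'a, nat) transducer" where
    T: "transducer_over \<Sigma> \<Gamma> T" and
    T_iff: "\<And>s s'. nodes s' = nodes s \<Longrightarrow> \<forall>u\<in>nodes s. label_at s' u \<in> \<Gamma> \<Longrightarrow>
      is_output T s s' \<longleftrightarrow> (\<forall>u\<in>nodes s. fst (d (label_at s' u)) = label_at s u) \<and>
         sat (tree_str (map_utree d s')) (\<lambda>_. []) \<phi>"
    by blast
  have "finite (d ` \<Gamma>)" "\<S> \<subseteq> Pow \<Gamma>" using fin\<Gamma> by (auto simp: \<S>_def)
  from word_nfa[OF this(1) closed(2) this(2)] obtain M :: "(nat, nat set) nfa" where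
    M: "nfa_over (Pow \<Gamma>) M" and
    M_iff: "\<And>w e. nfa_accepts M w \<longleftrightarrow> w \<in> lists \<S> \<and> sat (word_str d w) e \<psi>"
    by blast
  \<comment> \<open>Stated for any output tree that decodes to \<open>t\<close> and
    \<open>X\<close>, so that it serves both when \<open>X\<close> is read off an output and when an
    output is built from \<open>X\<close>.\<close>
  have transfer: "holds tree_interp t X (\<lambda>_. []) \<phi> \<longleftrightarrow> sat (tree_str (map_utree d (Proj t'))) (\<lambda>_. []) \<phi>"
    "holds (data_interp t) t X (\<lambda>_. []) \<psi> \<longleftrightarrow> sat (word_str d (value_string \<Gamma> t')) (\<lambda>_. (0, 0)) \<psi>"
    if t': "t' \<in> odtrees \<Gamma>" "nodes t' = nodes t" "\<forall>u\<in>nodes t. val t' u = val t u"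
      and l: "\<forall>u\<in>nodes t. fst (d (lab t' u)) = lab t u"
      and X: "\<forall>u\<in>nodes t. \<forall>i<m. i \<in> snd (d (lab t' u)) \<longleftrightarrow> u \<in> X i"
      and inj: "\<forall>a\<in>\<Gamma>0. inj_on (val t') {u \<in> nodes t'. lab t' u = a}"
      and w: "value_string \<Gamma> t' \<in> lists \<S>" for t t' X
  proof -
    have sv: "set_vars \<phi> \<subseteq> {..<m}" "set_vars \<psi> \<subseteq> {..<m}" using \<phi> \<psi> by (simp_all add: sentence_over_def)
    show "holds tree_interp t X (\<lambda>_. []) \<phi> \<longleftrightarrow> sat (tree_str (map_utree d (Proj t'))) (\<lambda>_. []) \<phi>"
    proof (rule holds_eq_sat)
      show "\<forall>u\<in>nodes t. \<forall>i\<in>set_vars \<phi>. i \<in> snd (fst (col (tree_str (map_utree d (Proj t'))) u)) \<longleftrightarrow> u \<in> X i"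
        using sv(1) X t'(2) by (auto simp: tree_str_def)
    qed (use t' l in \<open>simp_all add: tree_str_def\<close>)
    let ?A = "\<lparr>uni = nodes t', col = (\<lambda>u. (d (lab t' u), Suc (value_rank t' u) = card (data_values t'))),
      rel = data_interp t'\<rparr>"
    have "holds (data_interp t) t X (\<lambda>_. []) \<psi> \<longleftrightarrow> sat ?A (\<lambda>_. []) \<psi>"
    proof (rule holds_eq_sat)
      show "\<forall>u\<in>nodes t. \<forall>i\<in>set_vars \<psi>. i \<in> snd (fst (col ?A u)) \<longleftrightarrow> u \<in> X i"
        using sv(2) X by auto
      show "\<forall>r. \<forall>u\<in>nodes t. \<forall>v\<in>nodes t. rel ?A r u v \<longleftrightarrow> data_interp t r u v"
        using data_interp_cong[OF t'(2,3)] by simp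
    qed (use t' l in simp_all)
    also have "\<dots> \<longleftrightarrow> sat (word_str d (value_string \<Gamma> t')) (\<lambda>_. (0, 0)) \<psi>"
    proof (rule efc_sat[OF _ order_refl K closed(2)], rule word_str_equiv[OF t'(1), where K = K and enc = enc and c = c])
      show "inj_on (val t') {u \<in> nodes t'. lab t' u = g}" if "g \<in> \<Gamma>" "c g < K" for g
        using inj that by (simp add: \<Gamma>0_def)
      show "enc (d g, j) \<in> S" if "S \<in> set (value_string \<Gamma> t')" "g \<in> S" "j < c g" for S g j
        using w that unfolding \<S>_def in_lists_conv_set by blast
    qed (use \<Gamma>E d_enc in \<open>simp_all\<close>)
    finally show "holds (data_interp t) t X (\<lambda>_. []) \<psi> \<longleftrightarrow> sat (word_str d (value_string \<Gamma> t')) (\<lambda>_. (0, 0)) \<psi>" .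
  qed
  have "weak_odta_accepts \<Gamma> (T, M, \<Gamma>0) t \<longleftrightarrow> models t m \<phi> \<psi>" if t: "t \<in> odtrees \<Sigma>" for t
  proof
    assume "weak_odta_accepts \<Gamma> (T, M, \<Gamma>0) t"
    then obtain t' where t': "t' \<in> odtrees \<Gamma>" and out: "is_output T (Proj t) (Proj t')"
      and val: "\<forall>u\<in>nodes t. val t' u = val t u" and acc: "nfa_accepts M (value_string \<Gamma> t')"
      and inj: "\<forall>a\<in>\<Gamma>0. inj_on (val t') {u \<in> nodes t'. lab t' u = a}"
      unfolding weak_odta_accepts_def by auto
    have n: "nodes t' = nodes t" using out by (simp add: is_output_def)
    have "\<forall>u\<in>nodes (Proj t). label_at (Proj t') u \<in> \<Gamma>" using t' n by (simp add: odtrees_def)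
    then have l: "\<forall>u\<in>nodes t. fst (d (lab t' u)) = lab t u"
      and sat\<phi>: "sat (tree_str (map_utree d (Proj t'))) (\<lambda>_. []) \<phi>"
      using T_iff[of "Proj t'" "Proj t"] out n by simp_all
    have w: "value_string \<Gamma> t' \<in> lists \<S>" "sat (word_str d (value_string \<Gamma> t')) (\<lambda>_. (0, 0)) \<psi>"
      using acc M_iff by blast+
    let ?X = "\<lambda>i. {u \<in> nodes t. i \<in> snd (d (lab t' u))}"
    have "holds tree_interp t ?X (\<lambda>_. []) \<phi> \<and> holds (data_interp t) t ?X (\<lambda>_. []) \<psi>"
      using transfer[OF t' n val l _ inj w(1), of ?X] sat\<phi> w(2) by simp
    then show "models t m \<phi> \<psi>" unfolding models_def by (intro exI[of _ ?X]) simp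
  next
    assume "models t m \<phi> \<psi>"
    then obtain X where X: "\<forall>i<m. X i \<subseteq> nodes t" "holds tree_interp t X (\<lambda>_. []) \<phi>"
      "holds (data_interp t) t X (\<lambda>_. []) \<psi>"
      unfolding models_def by blast
    let ?l = "\<lambda>u. (lab t u, {i. i < m \<and> u \<in> X i})"
    have \<Lambda>: "?l u \<in> \<Lambda>" if "u \<in> nodes t" for u using t that by (auto simp: \<Lambda>_def odtrees_def)
    from ex_numbering[OF finite_nodes, of t "\<lambda>u. (val t u, ?l u)"] obtain h :: "pos \<Rightarrow> nat" where
      h: "(\<forall>u\<in>nodes t. \<forall>v\<in>nodes t. (val t u, ?l u) = (val t v, ?l v) \<longrightarrow> h u = h v \<longrightarrow> u = v) \<and>
        (\<forall>u\<in>nodes t. \<forall>j<h u. \<exists>v\<in>nodes t. (val t v, ?l v) = (val t u, ?l u) \<and> h v = j)" ..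
    have h1: "u = v" if "u \<in> nodes t" "v \<in> nodes t" "val t u = val t v" "?l u = ?l v" "h u = h v" for u v
      using h that by simp
    have h2: "\<exists>v\<in>nodes t. val t v = val t u \<and> ?l v = ?l u \<and> h v = j" if "u \<in> nodes t" "j < h u" for u j
      using h that by simp
    \<comment> \<open>The first \<open>K\<close> nodes of a fibre get counters of their own, and all
      others share \<open>K\<close>.\<close>
    let ?c = "\<lambda>u. min K (h u)"
    from ex_relabel[of t "\<lambda>u. (enc (?l u, ?c u), val t u)"] obtain t' where
      n: "nodes t' = nodes t" and lab': "\<forall>u\<in>nodes t. label_at t' u = (enc (?l u, ?c u), val t u)" by blast
    have val: "\<forall>u\<in>nodes t. val t' u = val t u" and lab: "\<forall>u\<in>nodes t. lab t' u = enc (?l u, ?c u)"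
      using lab' by (simp_all add: val_def lab_def)
    have d: "d (lab t' u) = ?l u" "c (lab t' u) = ?c u" if "u \<in> nodes t" for u
      using d_enc[OF \<Lambda>[OF that], of "?c u"] lab that by simp_all
    have \<Gamma>: "lab t' u \<in> \<Gamma>" if "u \<in> nodes t" for u
      using lab \<Lambda>[OF that] that by (simp add: \<Gamma>_def)
    then have t': "t' \<in> odtrees \<Gamma>" using n by (simp add: odtrees_def)
    have l: "\<forall>u\<in>nodes t. fst (d (lab t' u)) = lab t u" using d by simp
    have X': "\<forall>u\<in>nodes t. \<forall>i<m. i \<in> snd (d (lab t' u)) \<longleftrightarrow> u \<in> X i" using d by simp
    have inj: "\<forall>a\<in>\<Gamma>0. inj_on (val t') {u \<in> nodes t'. lab t' u = a}"
    proof (intro ballI inj_onI)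
      fix a u v assume a: "a \<in> \<Gamma>0" and u: "u \<in> {u \<in> nodes t'. lab t' u = a}"
        and v: "v \<in> {u \<in> nodes t'. lab t' u = a}" and eq: "val t' u = val t' v"
      have uv: "u \<in> nodes t" "v \<in> nodes t" "lab t' u = a" "lab t' v = a" using u v n by simp_all
      show "u = v"
      proof (rule h1[OF uv(1,2)])
        show "val t u = val t v" using val uv eq by simp
        show "?l u = ?l v" using d(1)[OF uv(1)] d(1)[OF uv(2)] uv(3,4) by simp
        have "?c u = c a" "?c v = c a" "c a < K"
          using d(2)[OF uv(1)] d(2)[OF uv(2)] uv(3,4) a by (simp_all add: \<Gamma>0_def)
        then show "h u = h v" by linarith
      qed
    qed
    have w: "value_string \<Gamma> t' \<in> lists \<S>"
    proof -
      have "value_string \<Gamma> t' ! i \<in> \<S>" if i: "i < card (data_values t')" for i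
        unfolding \<S>_def
      proof (intro CollectI conjI ballI allI impI)
        show "value_string \<Gamma> t' ! i \<in> Pow \<Gamma>"
          using value_string_Pow[OF t'] i unfolding in_lists_conv_set by simp
        fix g j assume "g \<in> value_string \<Gamma> t' ! i" and j: "j < c g"
        then obtain u where u: "u \<in> nodes t" "value_rank t' u = i" "lab t' u = g"
          using mem_value_string[OF t' i] n by auto
        have j': "j < K" "j < h u" using j d(2)[OF u(1)] u(3) by simp_all
        obtain v where v: "v \<in> nodes t" "val t v = val t u" "?l v = ?l u" "h v = j" using h2[OF u(1) j'(2)] by blast
        have "lab t' v = enc (?l v, ?c v)" using lab v(1) by blast
        also have "\<dots> = enc (d g, j)" using d(1)[OF u(1)] u(3) v(3,4) j'(1) by simp
        finally have "lab t' v = enc (d g, j)" .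
        moreover have "value_rank t' v = i"
          using value_rank_eq_iff[of v t' u] v(1,2) u(1,2) n val by simp
        ultimately show "enc (d g, j) \<in> value_string \<Gamma> t' ! i"
          using mem_value_string[OF t' i] v(1) n by blast
      qed
      then show ?thesis by (auto simp: in_set_conv_nth)
    qed
    note tr = transfer[OF t' n val l X' inj w]
    have "is_output T (Proj t) (Proj t')"
      using T_iff[of "Proj t'" "Proj t"] n \<Gamma> l tr(1) X(2) by simp
    moreover have "nfa_accepts M (value_string \<Gamma> t')"
      using M_iff w tr(2) X(3) by blast
    ultimately show "weak_odta_accepts \<Gamma> (T, M, \<Gamma>0) t"
      unfolding weak_odta_accepts_def using t' val inj by auto
  qed
  then have "{t \<in> odtrees \<Sigma>. models t m \<phi> \<psi>} = {t \<in> odtrees \<Sigma>. weak_odta_accepts \<Gamma> (T, M, \<Gamma>0) t}" by blast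
  moreover have "weak_odta_over \<Sigma> \<Gamma> (T, M, \<Gamma>0)"
    using fin\<Gamma> T M by (simp add: weak_odta_over_def \<Gamma>0_def)
  ultimately show ?thesis unfolding weak_odta_recognizable_def by blast
qed

subsection \<open>Conditions definable with two variables\<close>

text \<open>\<open>Neg (Eq 0 0)\<close> stands for falsity and mentions only variable 0, so empty
  disjunctions stay within two variables.\<close>

primrec disjs :: "('a, 'r) fo list \<Rightarrow> ('a, 'r) fo" where
  "disjs [] = Neg (Eq 0 0)"
| "disjs (\<phi> # \<phi>s) = Disj \<phi> (disjs \<phi>s)"

lemma holds_disjs: "holds I t X e (disjs \<phi>s) \<longleftrightarrow> (\<exists>\<phi>\<in>set \<phi>s. holds I t X e \<phi>)"
  by (induction \<phi>s) auto

lemma vars_disjs: "vars (disjs \<phi>s) \<subseteq> W \<longleftrightarrow> 0 \<in> W \<and> (\<forall>\<phi>\<in>set \<phi>s. vars \<phi> \<subseteq> W)"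
  by (induction \<phi>s) auto

lemma label_preds_disjs: "label_preds (disjs \<phi>s) = (\<Union>\<phi>\<in>set \<phi>s. label_preds \<phi>)"
  by (induction \<phi>s) auto

lemma set_vars_disjs: "set_vars (disjs \<phi>s) = (\<Union>\<phi>\<in>set \<phi>s. set_vars \<phi>)"
  by (induction \<phi>s) auto

lemma free_vars_subset: "free_vars \<phi> \<subseteq> vars \<phi>"
  by (induction \<phi>) auto

text \<open>Conditions are kept semantic and their definability is derived from closure rules, which
  spares writing out formulas for runs.\<close>

type_synonym 'a cond = "'a odtree \<Rightarrow> (pos \<Rightarrow> nat) \<Rightarrow> pos \<Rightarrow> pos \<Rightarrow> bool"

text \<open>Set variables encode a colouring of the nodes by \<open>{..<N}\<close>.\<close>

definition codes :: "nat \<Rightarrow> 'a odtree \<Rightarrow> (nat \<Rightarrow> pos set) \<Rightarrow> (pos \<Rightarrow> nat) \<Rightarrow> bool" where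
  "codes N t X \<kappa> \<longleftrightarrow> (\<forall>u\<in>nodes t. \<kappa> u < N \<and> (\<forall>i<N. u \<in> X i \<longleftrightarrow> \<kappa> u = i))"

text \<open>\<open>I\<close> takes the tree as an argument because \<open>data_interp\<close> does;
  the other instance is the constant family \<open>tree_interp\<close>.\<close>

locale colouring =
  fixes \<Sigma> :: "'a set" and N :: nat and I :: "'a odtree \<Rightarrow> 'r \<Rightarrow> pos \<Rightarrow> pos \<Rightarrow> bool"
  assumes fin: "finite \<Sigma>"
begin

definition defines_cond :: "('a, 'r) fo \<Rightarrow> 'a cond \<Rightarrow> bool" where
  "defines_cond \<phi> C \<longleftrightarrow> vars \<phi> \<subseteq> {0, 1} \<and> label_preds \<phi> \<subseteq> \<Sigma> \<and> set_vars \<phi> \<subseteq> {..<N} \<and>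
     (\<forall>t X \<kappa> e. t \<in> odtrees \<Sigma> \<longrightarrow> codes N t X \<kappa> \<longrightarrow> e 0 \<in> nodes t \<longrightarrow> e 1 \<in> nodes t \<longrightarrow>
        holds (I t) t X e \<phi> = C t \<kappa> (e 0) (e 1))"

definition fo2 :: "'a cond \<Rightarrow> bool" where
  "fo2 C \<longleftrightarrow> (\<exists>\<phi>. defines_cond \<phi> C)"

lemma fo2I: "defines_cond \<phi> C \<Longrightarrow> fo2 C"
  unfolding fo2_def by blast

lemma fo2_rel: "fo2 (\<lambda>t \<kappa> u v. I t r u v)"
  by (rule fo2I[of "Rel r 0 1"]) (simp add: defines_cond_def)

lemma fo2_rel': "fo2 (\<lambda>t \<kappa> u v. I t r v u)"
  by (rule fo2I[of "Rel r 1 0"]) (simp add: defines_cond_def)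

lemma fo2_eq: "fo2 (\<lambda>t \<kappa> u v. u = v)"
  by (rule fo2I[of "Eq 0 1"]) (simp add: defines_cond_def)

lemma fo2_lab:
  assumes "a \<in> \<Sigma>"
  shows "fo2 (\<lambda>t \<kappa> u v. lab t u = a)" "fo2 (\<lambda>t \<kappa> u v. lab t v = a)"
  by (rule fo2I[of "Lab a 0"], simp add: defines_cond_def assms)
    (rule fo2I[of "Lab a 1"], simp add: defines_cond_def assms)

lemma fo2_mem:
  assumes "i < N"
  shows "fo2 (\<lambda>t \<kappa> u v. \<kappa> u = i)" "fo2 (\<lambda>t \<kappa> u v. \<kappa> v = i)"
  by (rule fo2I[of "Mem i 0"], simp add: defines_cond_def codes_def assms)
    (rule fo2I[of "Mem i 1"], simp add: defines_cond_def codes_def assms)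

lemma fo2_neg: "fo2 C \<Longrightarrow> fo2 (\<lambda>t \<kappa> u v. \<not> C t \<kappa> u v)"
  unfolding fo2_def[of C] by (elim exE, rule_tac \<phi> = "Neg \<phi>" in fo2I) (simp add: defines_cond_def)

lemma fo2_conj:
  assumes "fo2 C" "fo2 D"
  shows "fo2 (\<lambda>t \<kappa> u v. C t \<kappa> u v \<and> D t \<kappa> u v)"
proof -
  obtain \<phi> \<psi> where "defines_cond \<phi> C" "defines_cond \<psi> D" using assms unfolding fo2_def by blast
  then show ?thesis by (intro fo2I[of "Conj \<phi> \<psi>"]) (simp add: defines_cond_def)
qed

lemma fo2_imp: "fo2 C \<Longrightarrow> fo2 D \<Longrightarrow> fo2 (\<lambda>t \<kappa> u v. C t \<kappa> u v \<longrightarrow> D t \<kappa> u v)"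
  using fo2_neg[OF fo2_conj[OF _ fo2_neg], of C D] by simp

lemma fo2_iff: "fo2 C \<Longrightarrow> fo2 D \<Longrightarrow> fo2 (\<lambda>t \<kappa> u v. C t \<kappa> u v \<longleftrightarrow> D t \<kappa> u v)"
  unfolding iff_conv_conj_imp by (intro fo2_conj fo2_imp)

lemma fo2_const: "fo2 (\<lambda>t \<kappa> u v. b)"
proof (cases b)
  case True
  then show ?thesis by (intro fo2I[of "Eq 0 0"]) (simp add: defines_cond_def)
next
  case False
  then show ?thesis by (intro fo2I[of "Neg (Eq 0 0)"]) (simp add: defines_cond_def)
qed

text \<open>The node \<open>u\<close> is forgotten and variable 0 bound again: the existence of a
  neighbour of \<open>v\<close> is stated without a third variable.\<close>

lemma fo2_ex1:
  assumes "fo2 C"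
  shows "fo2 (\<lambda>t \<kappa> u v. \<exists>w\<in>nodes t. C t \<kappa> w v)"
proof -
  obtain \<phi> where "defines_cond \<phi> C" using assms unfolding fo2_def by blast
  then show ?thesis by (intro fo2I[of "Ex 0 \<phi>"]) (simp add: defines_cond_def)
qed

lemma fo2_ex2:
  assumes "fo2 C"
  shows "fo2 (\<lambda>t \<kappa> u v. \<exists>w\<in>nodes t. C t \<kappa> u w)"
proof -
  obtain \<phi> where "defines_cond \<phi> C" using assms unfolding fo2_def by blast
  then show ?thesis by (intro fo2I[of "Ex 1 \<phi>"]) (simp add: defines_cond_def)
qed

lemma fo2_bex:
  assumes "finite S" "\<And>s. s \<in> S \<Longrightarrow> fo2 (C s)"
  shows "fo2 (\<lambda>t \<kappa> u v. \<exists>s\<in>S. C s t \<kappa> u v)"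
proof -
  have "\<forall>s\<in>S. \<exists>\<phi>. defines_cond \<phi> (C s)" using assms(2) unfolding fo2_def by blast
  from bchoice[OF this] obtain \<phi> where \<phi>: "\<forall>s\<in>S. defines_cond (\<phi> s) (C s)" ..
  obtain xs where xs: "set xs = S" using finite_list[OF assms(1)] by blast
  have "defines_cond (disjs (map \<phi> xs)) (\<lambda>t \<kappa> u v. \<exists>s\<in>S. C s t \<kappa> u v)"
    unfolding defines_cond_def
  proof (intro conjI allI impI)
    show "vars (disjs (map \<phi> xs)) \<subseteq> {0, 1}"
      using \<phi> unfolding vars_disjs by (simp add: xs defines_cond_def)
    show "label_preds (disjs (map \<phi> xs)) \<subseteq> \<Sigma>" "set_vars (disjs (map \<phi> xs)) \<subseteq> {..<N}"
      using \<phi> by (auto simp: xs label_preds_disjs set_vars_disjs defines_cond_def)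
    fix t X \<kappa> and e :: "nat \<Rightarrow> pos"
    assume "t \<in> odtrees \<Sigma>" "codes N t X \<kappa>" "e 0 \<in> nodes t" "e 1 \<in> nodes t"
    then show "holds (I t) t X e (disjs (map \<phi> xs)) = (\<exists>s\<in>S. C s t \<kappa> (e 0) (e 1))"
      using \<phi> by (simp add: holds_disjs xs defines_cond_def)
  qed
  then show ?thesis by (rule fo2I)
qed

lemma fo2_ball:
  assumes "finite S" "\<And>s. s \<in> S \<Longrightarrow> fo2 (C s)"
  shows "fo2 (\<lambda>t \<kappa> u v. \<forall>s\<in>S. C s t \<kappa> u v)"
  using fo2_neg[OF fo2_bex[OF assms(1) fo2_neg[OF assms(2)]]] by simp

text \<open>Such a condition is a finite table over pairs of letters and colours. The tests on
  transition relations are of this kind, so no formula has to be designed for them.\<close>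

lemma fo2_col:
  assumes "\<And>t \<kappa> u v t' \<kappa>' u' v'. lab t u = lab t' u' \<Longrightarrow> lab t v = lab t' v' \<Longrightarrow>
    \<kappa> u = \<kappa>' u' \<Longrightarrow> \<kappa> v = \<kappa>' v' \<Longrightarrow> C t \<kappa> u v = C t' \<kappa>' u' v'"
  shows "fo2 C"
proof -
  define Q where "Q a i b j \<longleftrightarrow> (\<exists>t \<kappa> u v. lab t u = a \<and> lab t v = b \<and> \<kappa> u = i \<and> \<kappa> v = j \<and> C t \<kappa> u v)"
    for a i b j
  have C: "C t \<kappa> u v \<longleftrightarrow> Q (lab t u) (\<kappa> u) (lab t v) (\<kappa> v)" for t \<kappa> u v
  proof
    assume "Q (lab t u) (\<kappa> u) (lab t v) (\<kappa> v)"
    then obtain t' \<kappa>' u' v' where "lab t' u' = lab t u" "lab t' v' = lab t v" "\<kappa>' u' = \<kappa> u" "\<kappa>' v' = \<kappa> v"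
      "C t' \<kappa>' u' v'" unfolding Q_def by blast
    then show "C t \<kappa> u v" using assms[of t' u' t u v' v \<kappa>' \<kappa>] by simp
  qed (auto simp: Q_def)
  have "fo2 (\<lambda>t \<kappa> u v. \<exists>a\<in>\<Sigma>. \<exists>i\<in>{..<N}. \<exists>b\<in>\<Sigma>. \<exists>j\<in>{..<N}. lab t u = a \<and> \<kappa> u = i \<and> lab t v = b \<and> \<kappa> v = j \<and> Q a i b j)"
    by (intro fo2_bex fo2_conj fin finite_lessThan fo2_lab fo2_mem fo2_const) auto
  then obtain \<phi> where \<phi>: "defines_cond \<phi> (\<lambda>t \<kappa> u v. \<exists>a\<in>\<Sigma>. \<exists>i\<in>{..<N}. \<exists>b\<in>\<Sigma>. \<exists>j\<in>{..<N}.
    lab t u = a \<and> \<kappa> u = i \<and> lab t v = b \<and> \<kappa> v = j \<and> Q a i b j)" unfolding fo2_def by blast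
  have "defines_cond \<phi> C"
    unfolding defines_cond_def
  proof (intro conjI allI impI)
    fix t X \<kappa> and e :: "nat \<Rightarrow> pos"
    assume "t \<in> odtrees \<Sigma>" "codes N t X \<kappa>" "e 0 \<in> nodes t" "e 1 \<in> nodes t"
    then show "holds (I t) t X e \<phi> = C t \<kappa> (e 0) (e 1)"
      using \<phi> by (simp add: defines_cond_def C) (simp add: odtrees_def codes_def)
  qed (use \<phi> in \<open>simp_all add: defines_cond_def\<close>)
  then show ?thesis by (rule fo2I)
qed

end

text \<open>The quantified sets are arbitrary. This sentence makes every node lie in exactly one of
  them, so that they decode to a colouring.\<close>

lemma ex_one_hot:
  "\<exists>\<phi> :: ('a, 'r) fo. vars \<phi> \<subseteq> {0, 1} \<and> free_vars \<phi> = {} \<and> label_preds \<phi> = {} \<and> set_vars \<phi> \<subseteq> {..<N} \<and>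
    (\<forall>I t X e. holds I t X e \<phi> \<longleftrightarrow> (\<forall>u\<in>nodes t. \<exists>i<N. \<forall>j<N. u \<in> X j \<longleftrightarrow> i = j))"
proof -
  define other :: "nat \<Rightarrow> ('a, 'r) fo" where "other i = disjs (map (\<lambda>j. Mem j 0) (filter (\<lambda>j. j \<noteq> i) [0..<N]))" for i
  define one :: "('a, 'r) fo" where "one = disjs (map (\<lambda>i. Conj (Mem i 0) (Neg (other i))) [0..<N])"
  have v: "vars one \<subseteq> {0}" unfolding one_def other_def vars_disjs by (auto simp: vars_disjs)
  have "free_vars (All 0 one) = {}" using v free_vars_subset[of one] by auto
  moreover have "label_preds (All 0 one) = {}" "set_vars (All 0 one) \<subseteq> {..<N}"
    unfolding one_def other_def by (auto simp: label_preds_disjs set_vars_disjs)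
  moreover have "holds I t X e (All 0 one) \<longleftrightarrow> (\<forall>u\<in>nodes t. \<exists>i<N. \<forall>j<N. u \<in> X j \<longleftrightarrow> i = j)" for I t X e
    unfolding one_def other_def by (simp add: holds_disjs) (fastforce simp: Bex_def)
  ultimately show ?thesis using v by (intro exI[of _ "All 0 one"]) auto
qed

text \<open>The one-hot sentence joins the tree formula. Both conditions are then evaluated under
  the same colouring, which is all that couples the two formulas.\<close>

lemma logic_expressible_colouring:
  fixes \<Sigma> :: "'a set"
  assumes fin: "finite \<Sigma>" and C: "colouring.fo2 \<Sigma> N (\<lambda>_. tree_interp) C" and D: "colouring.fo2 \<Sigma> N data_interp D"
  shows "logic_expressible \<Sigma> {t \<in> odtrees \<Sigma>. \<exists>\<kappa>. (\<forall>u\<in>nodes t. \<kappa> u < N) \<and>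
    (\<forall>u\<in>nodes t. \<forall>v\<in>nodes t. C t \<kappa> u v \<and> D t \<kappa> u v)}"
proof -
  have loc: "colouring \<Sigma>" using fin by unfold_locales
  obtain \<phi> where \<phi>: "colouring.defines_cond \<Sigma> N (\<lambda>_. tree_interp) \<phi> C"
    using C unfolding colouring.fo2_def[OF loc] by blast
  obtain \<psi> where \<psi>: "colouring.defines_cond \<Sigma> N data_interp \<psi> D"
    using D unfolding colouring.fo2_def[OF loc] by blast
  note def = colouring.defines_cond_def[OF loc]
  from ex_one_hot[of N] obtain \<theta> :: "('a, tree_rel) fo" where *: "vars \<theta> \<subseteq> {0, 1} \<and> free_vars \<theta> = {} \<and>
    label_preds \<theta> = {} \<and> set_vars \<theta> \<subseteq> {..<N} \<and>
    (\<forall>I t X e. holds I t X e \<theta> \<longleftrightarrow> (\<forall>u\<in>nodes t. \<exists>i<N. \<forall>j<N. u \<in> X j \<longleftrightarrow> i = j))" ..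
  have \<theta>: "vars \<theta> \<subseteq> {0, 1}" "free_vars \<theta> = {}" "label_preds \<theta> = {}" "set_vars \<theta> \<subseteq> {..<N}"
    "\<forall>I t X e. holds I t X e \<theta> \<longleftrightarrow> (\<forall>u\<in>nodes t. \<exists>i<N. \<forall>j<N. u \<in> X j \<longleftrightarrow> i = j)"
    using * by blast+
  let ?\<phi> = "Conj \<theta> (All 0 (All 1 \<phi>))" and ?\<psi> = "All 0 (All 1 \<psi>)"
  have "sentence_over \<Sigma> N ?\<phi>" "two_variable ?\<phi>" "sentence_over \<Sigma> N ?\<psi>"
    using \<phi> \<psi> \<theta> free_vars_subset[of \<phi>] free_vars_subset[of \<psi>]
    by (auto simp: def sentence_over_def two_variable_def)
  moreover have "models t N ?\<phi> ?\<psi> \<longleftrightarrow> (\<exists>\<kappa>. (\<forall>u\<in>nodes t. \<kappa> u < N) \<and>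
    (\<forall>u\<in>nodes t. \<forall>v\<in>nodes t. C t \<kappa> u v \<and> D t \<kappa> u v))" if t: "t \<in> odtrees \<Sigma>" for t
  proof -
    have eval: "holds tree_interp t X (\<lambda>_. []) (All 0 (All 1 \<phi>)) \<longleftrightarrow> (\<forall>u\<in>nodes t. \<forall>v\<in>nodes t. C t \<kappa> u v)"
      "holds (data_interp t) t X (\<lambda>_. []) (All 0 (All 1 \<psi>)) \<longleftrightarrow> (\<forall>u\<in>nodes t. \<forall>v\<in>nodes t. D t \<kappa> u v)"
      if "codes N t X \<kappa>" for X \<kappa>
      using \<phi> \<psi> t that by (simp_all add: def)
    show ?thesis
    proof
      assume "models t N ?\<phi> ?\<psi>"
      then obtain X where X: "holds tree_interp t X (\<lambda>_. []) \<theta>"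
        "holds tree_interp t X (\<lambda>_. []) (All 0 (All 1 \<phi>))" "holds (data_interp t) t X (\<lambda>_. []) ?\<psi>"
        unfolding models_def holds.simps(6) by blast
      have "\<forall>u\<in>nodes t. \<exists>i. i < N \<and> (\<forall>j<N. u \<in> X j \<longleftrightarrow> i = j)" using X(1) \<theta>(5) by simp
      from bchoice[OF this] obtain \<kappa> where \<kappa>: "\<forall>u\<in>nodes t. \<kappa> u < N \<and> (\<forall>j<N. u \<in> X j \<longleftrightarrow> \<kappa> u = j)" ..
      then have "codes N t X \<kappa>" by (simp add: codes_def)
      from eval[OF this] X(2,3) have "\<forall>u\<in>nodes t. \<forall>v\<in>nodes t. C t \<kappa> u v \<and> D t \<kappa> u v" by simp
      then show "\<exists>\<kappa>. (\<forall>u\<in>nodes t. \<kappa> u < N) \<and> (\<forall>u\<in>nodes t. \<forall>v\<in>nodes t. C t \<kappa> u v \<and> D t \<kappa> u v)"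
        using \<kappa> by (intro exI[of _ \<kappa>]) simp
    next
      assume "\<exists>\<kappa>. (\<forall>u\<in>nodes t. \<kappa> u < N) \<and> (\<forall>u\<in>nodes t. \<forall>v\<in>nodes t. C t \<kappa> u v \<and> D t \<kappa> u v)"
      then obtain \<kappa> where \<kappa>: "\<forall>u\<in>nodes t. \<kappa> u < N" "\<forall>u\<in>nodes t. \<forall>v\<in>nodes t. C t \<kappa> u v \<and> D t \<kappa> u v" by blast
      let ?X = "\<lambda>i. {u \<in> nodes t. \<kappa> u = i}"
      have "codes N t ?X \<kappa>" using \<kappa> by (simp add: codes_def)
      note ev = eval[OF this]
      have "\<exists>i<N. \<forall>j<N. u \<in> ?X j \<longleftrightarrow> i = j" if "u \<in> nodes t" for u
        by (rule exI[of _ "\<kappa> u"]) (use that \<kappa>(1) in simp)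
      then have "holds tree_interp t ?X (\<lambda>_. []) \<theta>" using \<theta>(5) by blast
      then have "holds tree_interp t ?X (\<lambda>_. []) ?\<phi>" using ev(1) \<kappa>(2) by simp
      moreover have "holds (data_interp t) t ?X (\<lambda>_. []) ?\<psi>" using ev(2) \<kappa>(2) by blast
      ultimately show "models t N ?\<phi> ?\<psi>" unfolding models_def by (intro exI[of _ ?X]) simp
    qed
  qed
  ultimately show ?thesis unfolding logic_expressible_def
    by (intro exI[of _ N] exI[of _ ?\<phi>] exI[of _ ?\<psi>] conjI) blast+
qed

subsection \<open>From automata to logic\<close>

text \<open>At a node \<open>v\<close> with parent \<open>u\<close>, \<open>s v\<close> and \<open>s' v\<close> are the states of the horizontal automaton
  \<open>A (q u) (lab t u)\<close> before and after reading \<open>q v\<close>.\<close>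

definition runs_cond ::
  "(nat, 'a, nat) transducer \<Rightarrow> (nat \<Rightarrow> 'a \<Rightarrow> (nat, nat) nfa) \<Rightarrow> (pos \<Rightarrow> nat) \<Rightarrow> (pos \<Rightarrow> nat) \<Rightarrow> (pos \<Rightarrow> nat) \<Rightarrow>
   (pos \<Rightarrow> nat) \<Rightarrow> 'a odtree \<Rightarrow> pos \<Rightarrow> pos \<Rightarrow> bool" where
  "runs_cond T A q g s s' t u v \<longleftrightarrow>
     (q u, lab t u, g u) \<in> tr_out T \<and>
     (\<not> (\<exists>w\<in>nodes t. tree_interp Child w u) \<longrightarrow> q u \<in> tr_final T) \<and>
     (\<not> (\<exists>w\<in>nodes t. tree_interp Child u w) \<longrightarrow> [] \<in> tr_delta T (q u) (lab t u)) \<and>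
     (tree_interp Child u v \<longrightarrow> (s v, q v, s' v) \<in> nfa_trans (A (q u) (lab t u)) \<and>
        (\<not> (\<exists>w\<in>nodes t. tree_interp Next_Sibling w v) \<longrightarrow> s v \<in> nfa_init (A (q u) (lab t u))) \<and>
        (\<not> (\<exists>w\<in>nodes t. tree_interp Next_Sibling v w) \<longrightarrow> s' v \<in> nfa_final (A (q u) (lab t u)))) \<and>
     (tree_interp Next_Sibling u v \<longrightarrow> s' u = s v)"

text \<open>\<open>p u\<close> and \<open>p' u\<close> are the states of \<open>M\<close> before and
  after the letter at the value of \<open>u\<close>. That letter is guessed as a set
  \<open>S\<close> and compared with the nodes one element at a time. Initial and final states are
  tested at the least and the largest value; the last line is the requirement of
  \<open>\<Gamma>0\<close>.\<close>

definition values_cond ::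
  "nat set \<Rightarrow> (nat, nat set) nfa \<Rightarrow> nat set \<Rightarrow> (pos \<Rightarrow> nat) \<Rightarrow> (pos \<Rightarrow> nat) \<Rightarrow> (pos \<Rightarrow> nat) \<Rightarrow>
   'a odtree \<Rightarrow> pos \<Rightarrow> pos \<Rightarrow> bool" where
  "values_cond \<Gamma> M \<Gamma>0 g p p' t u v \<longleftrightarrow>
     (data_interp t Sim u v \<longrightarrow> p u = p v \<and> p' u = p' v) \<and>
     (\<exists>S\<in>Pow \<Gamma>. (p u, S, p' u) \<in> nfa_trans M \<and> (\<forall>a\<in>\<Gamma>. a \<in> S \<longleftrightarrow> (\<exists>w\<in>nodes t. data_interp t Sim u w \<and> g w = a))) \<and>
     (\<not> (\<exists>w\<in>nodes t. data_interp t Prec w u) \<longrightarrow> p u \<in> nfa_init M) \<and>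
     (\<not> (\<exists>w\<in>nodes t. data_interp t Prec u w) \<longrightarrow> p' u \<in> nfa_final M) \<and>
     (data_interp t Prec_Suc u v \<longrightarrow> p' u = p v) \<and>
     (g u \<in> \<Gamma>0 \<and> g u = g v \<and> data_interp t Sim u v \<longrightarrow> u = v)"

lemma runs_cond_cong:
  assumes "\<And>w. w \<in> {u, v} \<Longrightarrow> q w = q2 w \<and> g w = g2 w \<and> s w = s2 w \<and> s' w = s2' w"
  shows "runs_cond T A q g s s' t u v \<longleftrightarrow> runs_cond T A q2 g2 s2 s2' t u v"
  unfolding runs_cond_def by (simp only: assms[of u] assms[of v] insertI1 insert_iff simp_thms)

text \<open>Agreement is asked on all nodes, not just at \<open>u\<close> and \<open>v\<close>,
  because \<open>g\<close> is also evaluated at the witnesses \<open>w\<close>.\<close>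

lemma values_cond_cong:
  assumes "\<And>w. w \<in> nodes t \<Longrightarrow> g w = g2 w \<and> p w = p2 w \<and> p' w = p2' w"
    and uv: "u \<in> nodes t" "v \<in> nodes t"
  shows "values_cond \<Gamma> M \<Gamma>0 g p p' t u v \<longleftrightarrow> values_cond \<Gamma> M \<Gamma>0 g2 p2 p2' t u v"
proof -
  have "(\<exists>w\<in>nodes t. data_interp t Sim u w \<and> g w = a) \<longleftrightarrow> (\<exists>w\<in>nodes t. data_interp t Sim u w \<and> g2 w = a)" for a
    using assms(1) by auto
  then show ?thesis
    unfolding values_cond_def by (simp only: assms(1)[OF uv(1)] assms(1)[OF uv(2)])
qed

section \<open>Parents, children and siblings in terms of positions\<close>

lemma no_child_iff: "u \<in> nodes t \<Longrightarrow> (\<exists>w\<in>nodes t. tree_interp Child u w) \<longleftrightarrow> 0 < arity t u"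
proof -
  assume u: "u \<in> nodes t"
  have "(\<exists>w\<in>nodes t. tree_interp Child u w) \<longleftrightarrow> (\<exists>i. u @ [i] \<in> nodes t)" by auto
  also have "\<dots> \<longleftrightarrow> 0 < arity t u" using u by (auto simp: child_in_nodes)
  finally show ?thesis .
qed

lemma no_parent_iff: "u \<in> nodes t \<Longrightarrow> (\<exists>w\<in>nodes t. tree_interp Child w u) \<longleftrightarrow> u \<noteq> []"
  by (cases u rule: rev_cases) (auto simp: child_in_nodes)

lemma prev_sibling_iff:
  "u @ [i] \<in> nodes t \<Longrightarrow> (\<exists>w\<in>nodes t. tree_interp Next_Sibling w (u @ [i])) \<longleftrightarrow> 0 < i"
  by (cases i) (auto simp: child_in_nodes)

lemma next_sibling_iff:
  "u @ [i] \<in> nodes t \<Longrightarrow> (\<exists>w\<in>nodes t. tree_interp Next_Sibling (u @ [i]) w) \<longleftrightarrow> Suc i < arity t u"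
  by (auto simp: child_in_nodes)

text \<open>Forwards, an accepting horizontal run is chosen at every node and distributed over its
  children; backwards, the states found at the children are chained into a run.\<close>

lemma runs_cond_iff:
  fixes T :: "(nat, 'a, nat) transducer"
  assumes t: "t \<in> odtrees \<Sigma>"
    and A: "\<forall>q\<in>tr_states T. \<forall>a\<in>\<Sigma>. nfa_over (tr_states T) (A q a) \<and> tr_delta T q a = {w. nfa_accepts (A q a) w}"
    and out: "tr_out T \<subseteq> tr_states T \<times> \<Sigma> \<times> \<Gamma>"
    and H: "0 \<in> H" "\<forall>q\<in>tr_states T. \<forall>a\<in>\<Sigma>. nfa_states (A q a) \<subseteq> H"
  shows "accepting_run T (Proj t) q \<and> (\<forall>u\<in>nodes t. (q u, lab t u, g u) \<in> tr_out T) \<longleftrightarrow>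
    (\<exists>s s'. (\<forall>u\<in>nodes t. s u \<in> H \<and> s' u \<in> H) \<and> (\<forall>u\<in>nodes t. \<forall>v\<in>nodes t. runs_cond T A q g s s' t u v))"
    (is "?l \<longleftrightarrow> ?r")
proof
  assume ?l
  then have run: "accepting_run T (Proj t) q" and o: "\<forall>u\<in>nodes t. (q u, lab t u, g u) \<in> tr_out T" by blast+
  have q: "q u \<in> tr_states T" "lab t u \<in> \<Sigma>" if "u \<in> nodes t" for u using o out that by blast+
  have "\<exists>r. r 0 \<in> nfa_init (A (q u) (lab t u)) \<and>
     (\<forall>i<arity t u. (r i, q (u @ [i]), r (Suc i)) \<in> nfa_trans (A (q u) (lab t u))) \<and>
     r (arity t u) \<in> nfa_final (A (q u) (lab t u))" if u: "u \<in> nodes t" for u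
  proof -
    have "map (\<lambda>i. q (u @ [i])) [0..<arity t u] \<in> tr_delta T (q u) (lab t u)"
      using run u unfolding accepting_run_def by simp
    then have "nfa_accepts (A (q u) (lab t u)) (map (\<lambda>i. q (u @ [i])) [0..<arity t u])"
      using A q[OF u] by simp
    then show ?thesis unfolding nfa_accepts_def by simp
  qed
  then have "\<forall>u\<in>nodes t. \<exists>r. r 0 \<in> nfa_init (A (q u) (lab t u)) \<and>
     (\<forall>i<arity t u. (r i, q (u @ [i]), r (Suc i)) \<in> nfa_trans (A (q u) (lab t u))) \<and>
     r (arity t u) \<in> nfa_final (A (q u) (lab t u))" by blast
  from bchoice[OF this] obtain r where r: "\<forall>u\<in>nodes t. r u 0 \<in> nfa_init (A (q u) (lab t u)) \<and>
     (\<forall>i<arity t u. (r u i, q (u @ [i]), r u (Suc i)) \<in> nfa_trans (A (q u) (lab t u))) \<and>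
     r u (arity t u) \<in> nfa_final (A (q u) (lab t u))" ..
  \<comment> \<open>No horizontal automaton reads the root. Its two states get the default 0, which
    is why \<open>H\<close> contains 0.\<close>
  define s where "s v = (if v = [] then 0 else r (butlast v) (last v))" for v
  define s' where "s' v = (if v = [] then 0 else r (butlast v) (Suc (last v)))" for v
  have snoc [simp]: "s (u @ [i]) = r u i" "s' (u @ [i]) = r u (Suc i)" for u i
    by (simp_all add: s_def s'_def)
  show ?r
  proof (rule exI[of _ s], rule exI[of _ s'], intro conjI ballI)
    fix u assume u: "u \<in> nodes t"
    have "s u \<in> H \<and> s' u \<in> H"
    proof (cases u rule: rev_cases)
      case Nil
      then show ?thesis using H(1) by (simp add: s_def s'_def)
    next
      case (snoc w i)
      then have w: "w \<in> nodes t" "i < arity t w" using u by (simp_all add: child_in_nodes)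
      then have "(r w i, q u, r w (Suc i)) \<in> nfa_trans (A (q w) (lab t w))" using r snoc by simp
      then show ?thesis using bspec[OF bspec[OF A q(1)[OF w(1)]] q(2)[OF w(1)]] bspec[OF bspec[OF H(2) q(1)[OF w(1)]] q(2)[OF w(1)]]
        unfolding snoc by (auto simp: nfa_over_def)
    qed
    then show "s u \<in> H" "s' u \<in> H" by blast+
  next
    fix u v assume u: "u \<in> nodes t" and v: "v \<in> nodes t"
    show "runs_cond T A q g s s' t u v"
      unfolding runs_cond_def
    proof (intro conjI impI)
      show "(q u, lab t u, g u) \<in> tr_out T" using o u by blast
      show "q u \<in> tr_final T" if "\<not> (\<exists>w\<in>nodes t. tree_interp Child w u)"
        using run that unfolding no_parent_iff[OF u] accepting_run_def by simp
      show "[] \<in> tr_delta T (q u) (lab t u)" if "\<not> (\<exists>w\<in>nodes t. tree_interp Child u w)"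
      proof -
        have "arity t u = 0" using that no_child_iff[OF u] by simp
        moreover have "map (\<lambda>i. q (u @ [i])) [0..<arity t u] \<in> tr_delta T (q u) (lab t u)"
          using run u unfolding accepting_run_def by simp
        ultimately show ?thesis by simp
      qed
      show "s' u = s v" if "tree_interp Next_Sibling u v" using that by auto
      assume "tree_interp Child u v"
      then obtain i where v': "v = u @ [i]" by auto
      then have i: "i < arity t u" using v child_in_nodes by blast
      show "(s v, q v, s' v) \<in> nfa_trans (A (q u) (lab t u))" using r u i v' by simp
      show "s v \<in> nfa_init (A (q u) (lab t u))" if "\<not> (\<exists>w\<in>nodes t. tree_interp Next_Sibling w v)"
      proof -
        have "i = 0" using that prev_sibling_iff[of u i t] v unfolding v' by blast
        then show ?thesis using r u v' by simp
      qed
      show "s' v \<in> nfa_final (A (q u) (lab t u))" if "\<not> (\<exists>w\<in>nodes t. tree_interp Next_Sibling v w)"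
      proof -
        have "\<not> Suc i < arity t u" using that next_sibling_iff[of u i t] v unfolding v' by blast
        then have "Suc i = arity t u" using i by linarith
        then show ?thesis using r u v' by simp
      qed
    qed
  qed
next
  assume ?r
  then obtain s s' where c: "\<forall>u\<in>nodes t. \<forall>v\<in>nodes t. runs_cond T A q g s s' t u v" by blast
  have o: "(q u, lab t u, g u) \<in> tr_out T" if "u \<in> nodes t" for u
    using c that unfolding runs_cond_def by blast
  have q: "q u \<in> tr_states T" "lab t u \<in> \<Sigma>" if "u \<in> nodes t" for u using o out that by blast+
  have "map (\<lambda>i. q (u @ [i])) [0..<arity t u] \<in> tr_delta T (q u) (lab t u)" if u: "u \<in> nodes t" for u
  proof (cases "arity t u")
    \<comment> \<open>Without children nothing records the horizontal run, so
      \<open>runs_cond\<close> has a separate clause for the empty word.\<close>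
    case 0
    then show ?thesis using c u no_child_iff[OF u] unfolding runs_cond_def by simp
  next
    case (Suc n)
    let ?A = "A (q u) (lab t u)"
    have ch: "u @ [i] \<in> nodes t" if "i \<le> n" for i using that u Suc by (simp add: child_in_nodes)
    have step: "(s (u @ [i]), q (u @ [i]), s' (u @ [i])) \<in> nfa_trans ?A"
      and init: "i = 0 \<Longrightarrow> s (u @ [i]) \<in> nfa_init ?A"
      and final: "i = n \<Longrightarrow> s' (u @ [i]) \<in> nfa_final ?A" if "i \<le> n" for i
    proof -
      have *: "runs_cond T A q g s s' t u (u @ [i])" using c u ch[OF that] by blast
      then show "(s (u @ [i]), q (u @ [i]), s' (u @ [i])) \<in> nfa_trans ?A" unfolding runs_cond_def by simp
      show "s (u @ [i]) \<in> nfa_init ?A" if "i = 0"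
        using * prev_sibling_iff[OF ch[OF \<open>i \<le> n\<close>]] that unfolding runs_cond_def by simp
      show "s' (u @ [i]) \<in> nfa_final ?A" if "i = n"
        using * next_sibling_iff[OF ch[OF \<open>i \<le> n\<close>]] that Suc unfolding runs_cond_def by simp
    qed
    have adj: "s' (u @ [i]) = s (u @ [Suc i])" if "Suc i \<le> n" for i
    proof -
      have "runs_cond T A q g s s' t (u @ [i]) (u @ [Suc i])" using c ch that by simp
      then show ?thesis unfolding runs_cond_def by simp
    qed
    \<comment> \<open>There are \<open>n + 1\<close> children and \<open>n + 2\<close> states: those
      before each child, then the one after the last.\<close>
    let ?r = "\<lambda>i. if i \<le> n then s (u @ [i]) else s' (u @ [n])"
    have "(?r i, q (u @ [i]), ?r (Suc i)) \<in> nfa_trans ?A" if "i < Suc n" for i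
      using step[of i] adj[of i] that by (cases "i = n") simp_all
    then have "nfa_accepts ?A (map (\<lambda>i. q (u @ [i])) [0..<Suc n])"
      unfolding nfa_accepts_def using init[of 0] final[of n] by (intro exI[of _ ?r]) (simp del: upt_Suc)
    then show ?thesis using A q[OF u] Suc by simp
  qed
  moreover have "q [] \<in> tr_final T"
  proof -
    have "runs_cond T A q g s s' t [] []" using c by simp
    then show ?thesis using no_parent_iff[of "[]" t] unfolding runs_cond_def by simp
  qed
  ultimately show ?l using q o unfolding accepting_run_def by simp
qed

lemma values_cond_iff:
  fixes t :: "'a odtree" and t' :: "nat odtree"
  assumes M: "nfa_over (Pow \<Gamma>) M" and t': "t' \<in> odtrees \<Gamma>" "nodes t' = nodes t"
    and val: "\<forall>u\<in>nodes t. val t' u = val t u" and g: "\<forall>u\<in>nodes t. lab t' u = g u"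
  shows "nfa_accepts M (value_string \<Gamma> t') \<and> (\<forall>a\<in>\<Gamma>0. inj_on (val t') {u \<in> nodes t'. lab t' u = a}) \<longleftrightarrow>
    (\<exists>p p'. (\<forall>u\<in>nodes t. p u \<in> nfa_states M \<and> p' u \<in> nfa_states M) \<and>
      (\<forall>u\<in>nodes t. \<forall>v\<in>nodes t. values_cond \<Gamma> M \<Gamma>0 g p p' t u v))"
    (is "?l \<longleftrightarrow> ?r")
proof -
  let ?w = "value_string \<Gamma> t'" and ?k = "value_rank t'"
  let ?n = "card (data_values t')"
  have I: "data_interp t r u v \<longleftrightarrow> rank_interp r (?k u) (?k v)" if "u \<in> nodes t" "v \<in> nodes t" for r u v
    using data_interp_cong[OF t'(2) val that] data_interp_iff[of u t' v r] that t'(2) by simp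
  have w: "a \<in> ?w ! ?k u \<longleftrightarrow> (\<exists>w\<in>nodes t. data_interp t Sim u w \<and> g w = a)" if "u \<in> nodes t" for u a
  proof -
    have "a \<in> ?w ! ?k u \<longleftrightarrow> (\<exists>w\<in>nodes t. ?k w = ?k u \<and> lab t' w = a)"
      using mem_value_string[OF t'(1) value_rank_less[of u t'], of a] that t'(2) by simp
    also have "\<dots> \<longleftrightarrow> (\<exists>w\<in>nodes t. data_interp t Sim u w \<and> g w = a)"
      by (rule bex_cong[OF refl]) (use I[OF that, of _ Sim] g in \<open>simp add: eq_commute\<close>)
    finally show ?thesis .
  qed
  have w\<Gamma>: "?w ! ?k u \<in> Pow \<Gamma>" if "u \<in> nodes t" for u
    using value_string_Pow[OF t'(1)] value_rank_less[of u t'] that t'(2) unfolding in_lists_conv_set by simp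
  have k: "?k u < ?n" if "u \<in> nodes t" for u using value_rank_less[of u t'] that t'(2) by simp
  have surj: "\<exists>u\<in>nodes t. ?k u = i" if "i < ?n" for i using value_rank_surj[OF that] t'(2) by simp
  have prec: "(\<exists>w\<in>nodes t. data_interp t Prec w u) \<longleftrightarrow> 0 < ?k u"
    "(\<exists>w\<in>nodes t. data_interp t Prec u w) \<longleftrightarrow> Suc (?k u) < ?n" if u: "u \<in> nodes t" for u
  proof -
    have "(\<exists>w\<in>nodes t. ?k w < ?k u) \<longleftrightarrow> 0 < ?k u"
    proof
      assume "0 < ?k u"
      then show "\<exists>w\<in>nodes t. ?k w < ?k u" using surj[of 0] k[OF u] by force
    qed auto
    then show "(\<exists>w\<in>nodes t. data_interp t Prec w u) \<longleftrightarrow> 0 < ?k u" using I[OF _ u, of _ Prec] by simp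
    have "(\<exists>w\<in>nodes t. ?k u < ?k w) \<longleftrightarrow> Suc (?k u) < ?n"
    proof
      assume "Suc (?k u) < ?n"
      then show "\<exists>w\<in>nodes t. ?k u < ?k w" using surj[of "Suc (?k u)"] by force
    next
      assume "\<exists>w\<in>nodes t. ?k u < ?k w"
      then obtain w where "w \<in> nodes t" "?k u < ?k w" by blast
      then show "Suc (?k u) < ?n" using k[of w] by linarith
    qed
    then show "(\<exists>w\<in>nodes t. data_interp t Prec u w) \<longleftrightarrow> Suc (?k u) < ?n" using I[OF u, of _ Prec] by simp
  qed
  have inj_iff: "(\<forall>a\<in>\<Gamma>0. inj_on (val t') {u \<in> nodes t'. lab t' u = a}) \<longleftrightarrow>
      (\<forall>u\<in>nodes t. \<forall>v\<in>nodes t. g u \<in> \<Gamma>0 \<and> g u = g v \<and> data_interp t Sim u v \<longrightarrow> u = v)"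
    using t'(2) val g by (auto simp: inj_on_def)
  show ?thesis
  proof
    assume ?l
    then obtain r where r: "r 0 \<in> nfa_init M" "\<forall>i<?n. (r i, ?w ! i, r (Suc i)) \<in> nfa_trans M" "r ?n \<in> nfa_final M"
      unfolding nfa_accepts_def by auto
    \<comment> \<open>States are attached to ranks, so nodes with equal values agree.\<close>
    let ?p = "\<lambda>u. r (?k u)" and ?p' = "\<lambda>u. r (Suc (?k u))"
    have tr: "(?p u, ?w ! ?k u, ?p' u) \<in> nfa_trans M" if "u \<in> nodes t" for u using r(2) k[OF that] by blast
    show ?r
    proof (rule exI[of _ ?p], rule exI[of _ ?p'], intro conjI ballI)
      show "?p u \<in> nfa_states M" "?p' u \<in> nfa_states M" if "u \<in> nodes t" for u
        using tr[OF that] M unfolding nfa_over_def by blast+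
      fix u v assume u: "u \<in> nodes t" and v: "v \<in> nodes t"
      show "values_cond \<Gamma> M \<Gamma>0 g ?p ?p' t u v"
        unfolding values_cond_def
      proof (intro conjI)
        show "data_interp t Sim u v \<longrightarrow> ?p u = ?p v \<and> ?p' u = ?p' v" using I[OF u v, of Sim] by simp
        show "\<exists>S\<in>Pow \<Gamma>. (?p u, S, ?p' u) \<in> nfa_trans M \<and>
            (\<forall>a\<in>\<Gamma>. a \<in> S \<longleftrightarrow> (\<exists>w\<in>nodes t. data_interp t Sim u w \<and> g w = a))"
          by (intro bexI[of _ "?w ! ?k u"] conjI ballI tr[OF u] w[OF u] w\<Gamma>[OF u])
        show "\<not> (\<exists>w\<in>nodes t. data_interp t Prec w u) \<longrightarrow> ?p u \<in> nfa_init M"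
          unfolding prec[OF u] using r(1) by simp
        show "\<not> (\<exists>w\<in>nodes t. data_interp t Prec u w) \<longrightarrow> ?p' u \<in> nfa_final M"
          unfolding prec[OF u] using r(3) k[OF u] by (metis Suc_lessI)
        show "data_interp t Prec_Suc u v \<longrightarrow> ?p' u = ?p v" using I[OF u v, of Prec_Suc] by simp
        show "g u \<in> \<Gamma>0 \<and> g u = g v \<and> data_interp t Sim u v \<longrightarrow> u = v" using \<open>?l\<close> inj_iff u v by blast
      qed
    qed
  next
    assume ?r
    then obtain p p' where c: "\<forall>u\<in>nodes t. \<forall>v\<in>nodes t. values_cond \<Gamma> M \<Gamma>0 g p p' t u v" by blast
    \<comment> \<open>One node is selected to represent each rank, and the run is read off these
      nodes.\<close>
    have "\<forall>i. \<exists>u. i < ?n \<longrightarrow> u \<in> nodes t \<and> ?k u = i" using surj by blast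
    from choice[OF this] obtain x where x: "\<forall>i. i < ?n \<longrightarrow> x i \<in> nodes t \<and> ?k (x i) = i" ..
    have n: "0 < ?n" using k[of "[]"] by simp
    let ?r = "\<lambda>i. if i < ?n then p (x i) else p' (x (?n - 1))"
    have last: "?n - 1 < ?n" "Suc (?n - 1) = ?n" using n by simp_all
    have "(?r i, ?w ! i, ?r (Suc i)) \<in> nfa_trans M" if i: "i < ?n" for i
    proof -
      have xi: "x i \<in> nodes t" "?k (x i) = i" using x i by simp_all
      then have "values_cond \<Gamma> M \<Gamma>0 g p p' t (x i) (x i)" using c by blast
      then obtain S where S: "S \<in> Pow \<Gamma>" "(p (x i), S, p' (x i)) \<in> nfa_trans M"
        "\<forall>a\<in>\<Gamma>. a \<in> S \<longleftrightarrow> (\<exists>w\<in>nodes t. data_interp t Sim (x i) w \<and> g w = a)"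
        unfolding values_cond_def by blast
      \<comment> \<open>\<open>values_cond\<close> describes \<open>S\<close> only on \<Gamma>, but
        both sets are subsets of \<Gamma>.\<close>
      have "S = ?w ! i"
      proof (rule set_eqI)
        fix a show "a \<in> S \<longleftrightarrow> a \<in> ?w ! i"
        proof (cases "a \<in> \<Gamma>")
          case True
          then show ?thesis using bspec[OF S(3) True] w[OF xi(1), of a] unfolding xi(2) by (simp only:)
        next
          case False
          then show ?thesis using S(1) w\<Gamma>[OF xi(1)] unfolding xi(2) by auto
        qed
      qed
      moreover have "p' (x i) = ?r (Suc i)"
      proof (cases "Suc i < ?n")
        case True
        then have y: "x (Suc i) \<in> nodes t" "?k (x (Suc i)) = Suc i" using x by simp_all
        have "values_cond \<Gamma> M \<Gamma>0 g p p' t (x i) (x (Suc i))" using c xi y by blast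
        then show ?thesis using True I[OF xi(1) y(1), of Prec_Suc] xi(2) y(2) unfolding values_cond_def by simp
      next
        case False
        then have "i = ?n - 1" using i by linarith
        then show ?thesis using False by simp
      qed
      ultimately show ?thesis using S(2) i by simp
    qed
    moreover have "?r 0 \<in> nfa_init M"
    proof -
      have x0: "x 0 \<in> nodes t" "?k (x 0) = 0" using x n by simp_all
      then have "values_cond \<Gamma> M \<Gamma>0 g p p' t (x 0) (x 0)" using c by blast
      then show ?thesis using prec(1)[OF x0(1)] x0(2) n unfolding values_cond_def by simp
    qed
    moreover have "?r ?n \<in> nfa_final M"
    proof -
      let ?x = "x (?n - 1)"
      have xl: "?x \<in> nodes t" "?k ?x = ?n - 1" using x last by simp_all
      then have "values_cond \<Gamma> M \<Gamma>0 g p p' t ?x ?x" using c by blast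
      then show ?thesis using prec(2)[OF xl(1)] xl(2) last unfolding values_cond_def by simp
    qed
    ultimately have "nfa_accepts M ?w" unfolding nfa_accepts_def by (intro exI[of _ ?r]) simp
    moreover have "\<forall>u\<in>nodes t. \<forall>v\<in>nodes t. g u \<in> \<Gamma>0 \<and> g u = g v \<and> data_interp t Sim u v \<longrightarrow> u = v"
      using c unfolding values_cond_def by blast
    ultimately show ?l using inj_iff by blast
  qed
qed

text \<open>The rules split off relation atoms and quantified neighbours; what remains compares
  labels and colours and falls under \<open>fo2_col\<close>.\<close>

lemma fo2_runs_cond:
  assumes "finite \<Sigma>"
  shows "colouring.fo2 \<Sigma> N (\<lambda>_. tree_interp)
    (\<lambda>t \<kappa>. runs_cond T A (\<lambda>u. q (\<kappa> u)) (\<lambda>u. g (\<kappa> u)) (\<lambda>u. s (\<kappa> u)) (\<lambda>u. s' (\<kappa> u)) t)"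
proof -
  interpret colouring \<Sigma> N "\<lambda>_. tree_interp" using assms by unfold_locales
  show ?thesis
    unfolding runs_cond_def
    by (intro fo2_conj fo2_imp fo2_neg fo2_ex1 fo2_ex2 fo2_rel fo2_rel') (rule fo2_col; simp)+
qed

lemma fo2_values_cond:
  assumes "finite \<Sigma>" "finite \<Gamma>"
  shows "colouring.fo2 \<Sigma> N data_interp
    (\<lambda>t \<kappa>. values_cond \<Gamma> M \<Gamma>0 (\<lambda>u. g (\<kappa> u)) (\<lambda>u. p (\<kappa> u)) (\<lambda>u. p' (\<kappa> u)) t)"
proof -
  interpret colouring \<Sigma> N data_interp using assms by unfold_locales
  have "finite (Pow \<Gamma>)" using assms by simp
  then show ?thesis
    unfolding values_cond_def
    by (intro fo2_conj fo2_imp fo2_neg fo2_bex fo2_ball fo2_iff fo2_ex1 fo2_ex2 fo2_rel fo2_rel' fo2_eq assms)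
      ((assumption | rule fo2_const | rule fo2_col; simp)+)
qed

lemma weak_odta_imp_logic:
  fixes \<Sigma> :: "'a set"
  assumes fin: "finite \<Sigma>" and rec: "weak_odta_recognizable \<Sigma> L"
  shows "logic_expressible \<Sigma> L"
proof -
  obtain \<Gamma> :: "nat set" and T :: "(nat, 'a, nat) transducer" and M :: "(nat, nat set) nfa" and \<Gamma>0 where
    W: "weak_odta_over \<Sigma> \<Gamma> (T, M, \<Gamma>0)" and L: "L = {t \<in> odtrees \<Sigma>. weak_odta_accepts \<Gamma> (T, M, \<Gamma>0) t}"
    using rec unfolding weak_odta_recognizable_def by auto
  have fin\<Gamma>: "finite \<Gamma>" and T: "transducer_over \<Sigma> \<Gamma> T" and M: "nfa_over (Pow \<Gamma>) M"
    using W by (simp_all add: weak_odta_over_def)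
  have out: "tr_out T \<subseteq> tr_states T \<times> \<Sigma> \<times> \<Gamma>" using T by (simp add: transducer_over_def)
  have "\<forall>x\<in>tr_states T \<times> \<Sigma>. \<exists>B :: (nat, nat) nfa. nfa_over (tr_states T) B \<and>
      tr_delta T (fst x) (snd x) = {w. nfa_accepts B w}"
    using T by (auto simp: transducer_over_def regular_def)
  from bchoice[OF this] obtain B :: "nat \<times> 'a \<Rightarrow> (nat, nat) nfa" where
    B: "\<forall>x\<in>tr_states T \<times> \<Sigma>. nfa_over (tr_states T) (B x) \<and> tr_delta T (fst x) (snd x) = {w. nfa_accepts (B x) w}" ..
  define A where "A q a = B (q, a)" for q a
  have A: "\<forall>q\<in>tr_states T. \<forall>a\<in>\<Sigma>. nfa_over (tr_states T) (A q a) \<and> tr_delta T q a = {w. nfa_accepts (A q a) w}"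
    using B by (simp add: A_def)
  define H where "H = insert 0 (\<Union>q\<in>tr_states T. \<Union>a\<in>\<Sigma>. nfa_states (A q a))"
  have H: "0 \<in> H" "\<forall>q\<in>tr_states T. \<forall>a\<in>\<Sigma>. nfa_states (A q a) \<subseteq> H" by (auto simp: H_def)
  have finT: "finite (tr_states T)" using T by (simp add: transducer_over_def)
  then have finH: "finite H" using A fin by (simp add: H_def nfa_over_def)
  \<comment> \<open>A colour is a whole tuple: tree state, output letter, horizontal states before
    and after, states of \<open>M\<close> before and after. A single colouring makes both formulas
    speak of the same output letters.\<close>
  let ?C = "tr_states T \<times> \<Gamma> \<times> H \<times> H \<times> nfa_states M \<times> nfa_states M"
  have "finite ?C" using finT fin\<Gamma> finH M by (simp add: nfa_over_def)
  from ex_bij_betw_nat_finite[OF this] obtain dec where dec: "bij_betw dec {0..<card ?C} ?C" ..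
  let ?N = "card ?C"
  let ?q = "\<lambda>i. fst (dec i)" and ?g = "\<lambda>i. fst (snd (dec i))" and ?s = "\<lambda>i. fst (snd (snd (dec i)))"
    and ?s' = "\<lambda>i. fst (snd (snd (snd (dec i))))" and ?p = "\<lambda>i. fst (snd (snd (snd (snd (dec i)))))"
    and ?p' = "\<lambda>i. snd (snd (snd (snd (snd (dec i)))))"
  \<comment> \<open>Replaces the output tree by functions on positions, which a colouring can
    encode.\<close>
  have accepts: "weak_odta_accepts \<Gamma> (T, M, \<Gamma>0) t \<longleftrightarrow>
     (\<exists>q g. accepting_run T (Proj t) q \<and> (\<forall>u\<in>nodes t. (q u, lab t u, g u) \<in> tr_out T) \<and>
       (\<exists>p p'. (\<forall>u\<in>nodes t. p u \<in> nfa_states M \<and> p' u \<in> nfa_states M) \<and>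
      (\<forall>u\<in>nodes t. \<forall>v\<in>nodes t. values_cond \<Gamma> M \<Gamma>0 g p p' t u v)))" (is "_ \<longleftrightarrow> ?R") for t
  proof
    assume "weak_odta_accepts \<Gamma> (T, M, \<Gamma>0) t"
    then obtain t' where t': "t' \<in> odtrees \<Gamma>" and o: "is_output T (Proj t) (Proj t')"
      and val: "\<forall>u\<in>nodes t. val t' u = val t u" and acc: "nfa_accepts M (value_string \<Gamma> t')"
      "\<forall>a\<in>\<Gamma>0. inj_on (val t') {u \<in> nodes t'. lab t' u = a}"
      unfolding weak_odta_accepts_def by auto
    from o obtain q where n: "nodes t' = nodes t" and q: "accepting_run T (Proj t) q"
      "\<forall>u\<in>nodes t. (q u, lab t u, lab t' u) \<in> tr_out T"
      unfolding is_output_def by auto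
    then show ?R using values_cond_iff[OF M t' n val, of "lab t'" \<Gamma>0] acc by blast
  next
    assume ?R
    then obtain q g where q: "accepting_run T (Proj t) q" "\<forall>u\<in>nodes t. (q u, lab t u, g u) \<in> tr_out T" and
      v: "\<exists>p p'. (\<forall>u\<in>nodes t. p u \<in> nfa_states M \<and> p' u \<in> nfa_states M) \<and>
      (\<forall>u\<in>nodes t. \<forall>v\<in>nodes t. values_cond \<Gamma> M \<Gamma>0 g p p' t u v)" by blast
    from ex_relabel[of t "\<lambda>u. (g u, val t u)"] obtain t' where n: "nodes t' = nodes t"
      and l: "\<forall>u\<in>nodes t. label_at t' u = (g u, val t u)" by blast
    have val: "\<forall>u\<in>nodes t. val t' u = val t u" and g: "\<forall>u\<in>nodes t. lab t' u = g u"
      using l by (simp_all add: val_def lab_def)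
    have t': "t' \<in> odtrees \<Gamma>" using q(2) out g n by (auto simp: odtrees_def)
    have "is_output T (Proj t) (Proj t')"
      unfolding is_output_def using n q g by (auto intro!: exI[of _ q])
    then show "weak_odta_accepts \<Gamma> (T, M, \<Gamma>0) t"
      using values_cond_iff[OF M t' n val g, of \<Gamma>0] v t' val unfolding weak_odta_accepts_def by auto
  qed
  have "weak_odta_accepts \<Gamma> (T, M, \<Gamma>0) t \<longleftrightarrow> (\<exists>\<kappa>. (\<forall>u\<in>nodes t. \<kappa> u < ?N) \<and>
      (\<forall>u\<in>nodes t. \<forall>v\<in>nodes t.
        runs_cond T A (\<lambda>u. ?q (\<kappa> u)) (\<lambda>u. ?g (\<kappa> u)) (\<lambda>u. ?s (\<kappa> u)) (\<lambda>u. ?s' (\<kappa> u)) t u v \<and>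
        values_cond \<Gamma> M \<Gamma>0 (\<lambda>u. ?g (\<kappa> u)) (\<lambda>u. ?p (\<kappa> u)) (\<lambda>u. ?p' (\<kappa> u)) t u v))" (is "_ \<longleftrightarrow> ?R")
    if t: "t \<in> odtrees \<Sigma>" for t
  proof
    assume "weak_odta_accepts \<Gamma> (T, M, \<Gamma>0) t"
    then obtain q g p p' where qg: "accepting_run T (Proj t) q" "\<forall>u\<in>nodes t. (q u, lab t u, g u) \<in> tr_out T"
      and p: "\<forall>u\<in>nodes t. p u \<in> nfa_states M \<and> p' u \<in> nfa_states M"
      and v: "\<forall>u\<in>nodes t. \<forall>v\<in>nodes t. values_cond \<Gamma> M \<Gamma>0 g p p' t u v"
      unfolding accepts by blast
    from runs_cond_iff[OF t A out H, of q g] qg obtain s s' where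
      s: "\<forall>u\<in>nodes t. s u \<in> H \<and> s' u \<in> H" and r: "\<forall>u\<in>nodes t. \<forall>v\<in>nodes t. runs_cond T A q g s s' t u v"
      by blast
    \<comment> \<open>Only at nodes does the tuple lie in \<open>?C\<close>, so decoding recovers
      the functions there and nowhere else; hence the congruence lemmas.\<close>
    define \<kappa> where "\<kappa> u = inv_into {0..<?N} dec (q u, g u, s u, s' u, p u, p' u)" for u
    have C: "(q u, g u, s u, s' u, p u, p' u) \<in> dec ` {0..<?N}" if "u \<in> nodes t" for u
      using dec qg(2) out p s that unfolding bij_betw_def by fast
    have N: "\<kappa> u < ?N" if "u \<in> nodes t" for u using inv_into_into[OF C[OF that]] by (simp add: \<kappa>_def)
    have d: "dec (\<kappa> u) = (q u, g u, s u, s' u, p u, p' u)" if "u \<in> nodes t" for u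
      unfolding \<kappa>_def by (rule f_inv_into_f[OF C[OF that]])
    have c: "runs_cond T A (\<lambda>u. ?q (\<kappa> u)) (\<lambda>u. ?g (\<kappa> u)) (\<lambda>u. ?s (\<kappa> u)) (\<lambda>u. ?s' (\<kappa> u)) t u v \<and>
        values_cond \<Gamma> M \<Gamma>0 (\<lambda>u. ?g (\<kappa> u)) (\<lambda>u. ?p (\<kappa> u)) (\<lambda>u. ?p' (\<kappa> u)) t u v"
      if "u \<in> nodes t" "v \<in> nodes t" for u v
    proof
      show "runs_cond T A (\<lambda>u. ?q (\<kappa> u)) (\<lambda>u. ?g (\<kappa> u)) (\<lambda>u. ?s (\<kappa> u)) (\<lambda>u. ?s' (\<kappa> u)) t u v"
        by (subst runs_cond_cong[where ?q2.0 = q and ?g2.0 = g and ?s2.0 = s and s2' = s'])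
          (use that r d in auto)
      show "values_cond \<Gamma> M \<Gamma>0 (\<lambda>u. ?g (\<kappa> u)) (\<lambda>u. ?p (\<kappa> u)) (\<lambda>u. ?p' (\<kappa> u)) t u v"
        by (subst values_cond_cong[where ?g2.0 = g and ?p2.0 = p and p2' = p'])
          (use that v d in auto)
    qed
    then have "\<forall>u\<in>nodes t. \<forall>v\<in>nodes t.
        runs_cond T A (\<lambda>u. ?q (\<kappa> u)) (\<lambda>u. ?g (\<kappa> u)) (\<lambda>u. ?s (\<kappa> u)) (\<lambda>u. ?s' (\<kappa> u)) t u v \<and>
        values_cond \<Gamma> M \<Gamma>0 (\<lambda>u. ?g (\<kappa> u)) (\<lambda>u. ?p (\<kappa> u)) (\<lambda>u. ?p' (\<kappa> u)) t u v"
      by (intro ballI)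
    moreover have "\<forall>u\<in>nodes t. \<kappa> u < ?N" by (intro ballI N)
    ultimately show ?R by (intro exI[of _ \<kappa>] conjI)
  next
    assume ?R
    then obtain \<kappa> where \<kappa>: "\<forall>u\<in>nodes t. \<kappa> u < ?N" and
      r: "\<forall>u\<in>nodes t. \<forall>v\<in>nodes t.
        runs_cond T A (\<lambda>u. ?q (\<kappa> u)) (\<lambda>u. ?g (\<kappa> u)) (\<lambda>u. ?s (\<kappa> u)) (\<lambda>u. ?s' (\<kappa> u)) t u v" and
      v: "\<forall>u\<in>nodes t. \<forall>v\<in>nodes t. values_cond \<Gamma> M \<Gamma>0 (\<lambda>u. ?g (\<kappa> u)) (\<lambda>u. ?p (\<kappa> u)) (\<lambda>u. ?p' (\<kappa> u)) t u v"
      by blast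
    have C: "dec (\<kappa> u) \<in> ?C" if "u \<in> nodes t" for u
      by (rule bij_betwE[OF dec, rule_format]) (use \<kappa> that in simp)
    have C': "\<forall>u\<in>nodes t. ?s (\<kappa> u) \<in> H \<and> ?s' (\<kappa> u) \<in> H"
      "\<forall>u\<in>nodes t. ?p (\<kappa> u) \<in> nfa_states M \<and> ?p' (\<kappa> u) \<in> nfa_states M"
      using C by (simp_all add: mem_Times_iff)
    have "\<exists>s s'. (\<forall>u\<in>nodes t. s u \<in> H \<and> s' u \<in> H) \<and>
        (\<forall>u\<in>nodes t. \<forall>v\<in>nodes t. runs_cond T A (\<lambda>u. ?q (\<kappa> u)) (\<lambda>u. ?g (\<kappa> u)) s s' t u v)"
      by (rule exI[of _ "\<lambda>u. ?s (\<kappa> u)"], rule exI[of _ "\<lambda>u. ?s' (\<kappa> u)"], rule conjI[OF C'(1) r])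
    then have 1: "accepting_run T (Proj t) (\<lambda>u. ?q (\<kappa> u)) \<and>
        (\<forall>u\<in>nodes t. (?q (\<kappa> u), lab t u, ?g (\<kappa> u)) \<in> tr_out T)"
      by (rule runs_cond_iff[OF t A out H, of "\<lambda>u. ?q (\<kappa> u)" "\<lambda>u. ?g (\<kappa> u)", THEN iffD2])
    have 2: "\<exists>p p'. (\<forall>u\<in>nodes t. p u \<in> nfa_states M \<and> p' u \<in> nfa_states M) \<and>
        (\<forall>u\<in>nodes t. \<forall>v\<in>nodes t. values_cond \<Gamma> M \<Gamma>0 (\<lambda>u. ?g (\<kappa> u)) p p' t u v)"
      by (rule exI[of _ "\<lambda>u. ?p (\<kappa> u)"], rule exI[of _ "\<lambda>u. ?p' (\<kappa> u)"], rule conjI[OF C'(2) v])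
    show "weak_odta_accepts \<Gamma> (T, M, \<Gamma>0) t"
      unfolding accepts
      by (rule exI[of _ "\<lambda>u. ?q (\<kappa> u)"], rule exI[of _ "\<lambda>u. ?g (\<kappa> u)"])
        (intro conjI conjunct1[OF 1] conjunct2[OF 1] 2)
  qed
  then have "L = {t \<in> odtrees \<Sigma>. \<exists>\<kappa>. (\<forall>u\<in>nodes t. \<kappa> u < ?N) \<and>
      (\<forall>u\<in>nodes t. \<forall>v\<in>nodes t.
        runs_cond T A (\<lambda>u. ?q (\<kappa> u)) (\<lambda>u. ?g (\<kappa> u)) (\<lambda>u. ?s (\<kappa> u)) (\<lambda>u. ?s' (\<kappa> u)) t u v \<and>
        values_cond \<Gamma> M \<Gamma>0 (\<lambda>u. ?g (\<kappa> u)) (\<lambda>u. ?p (\<kappa> u)) (\<lambda>u. ?p' (\<kappa> u)) t u v)}"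
    unfolding L by blast
  with logic_expressible_colouring[OF fin fo2_runs_cond[OF fin] fo2_values_cond[OF fin fin\<Gamma>]]
  show ?thesis by simp
qed

theorem theorem6p2:
  fixes \<Sigma> :: "'a set" and L :: "'a odtree set"
  assumes "finite \<Sigma>" and "L \<subseteq> odtrees \<Sigma>"
  shows "weak_odta_recognizable \<Sigma> L \<longleftrightarrow> logic_expressible \<Sigma> L"
proof
  show "weak_odta_recognizable \<Sigma> L \<Longrightarrow> logic_expressible \<Sigma> L"
    by (rule weak_odta_imp_logic[OF assms(1)])
  assume "logic_expressible \<Sigma> L"
  then show "weak_odta_recognizable \<Sigma> L"
    unfolding logic_expressible_def using logic_imp_weak_odta[OF assms(1)] by blast
qed

end
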